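(* Let $m,n$ be integers with $|m|,|n|\ge 2$ and $\Gamma=\mathrm{BS}(m,n)$. For every $(m,n)$-phenotype $q$, the action of $\Gamma$ by conjugation on $\mathcal K_q$ is highly topologically transitive: for every $d\ge1$ and all nonempty open subsets $U_1,\dots,U_d,V_1,\dots,V_d$ of $\mathcal K_q$ with the $U_i$ pairwise disjoint and the $V_i$ pairwise disjoint, there exists $\gamma\in\Gamma$ with $(U_i\cdot\gamma)\cap V_i\neq\emptyset$ for all $i\in\{1,\dots,d\}$.
   Context: $\mathrm{BS}(m,n)=\langle b,t\mid tb^mt^{-1}=b^n\rangle$. $\mathrm{Sub}(\Gamma)$ is the space of subgroups with the topology generated by $\{\Lambda:\mathcal I\subseteq\Lambda,\ \mathcal O\cap\Lambda=\emptyset\}$, $\mathcal I,\mathcal O$ finite; $\Gamma$ acts by conjugation, $\Lambda\cdot\gamma=\gamma^{-1}\Lambda\gamma$. For a prime $p$, $|k|_p$ is the $p$-adic valuation. For $L\in\mathbb{Z}_{\ge1}$, $\mathrm{Ph}_{m,n}(L)=\prod p^{|L|_p}$ over primes $p$ with $|m|_p=|n|_p$ and $|L|_p>|n|_p$; $\mathrm{Ph}_{m,n}(\infty)=\infty$; $\mathrm{PH}_{m,n}(\Lambda)=\mathrm{Ph}_{m,n}([\langle b\rangle:\langle b\rangle\cap\Lambda])$; a phenotype is a value of $\mathrm{PH}_{m,n}$. $\mathcal K(\Gamma)$ is the perfect kernel of $\mathrm{Sub}(\Gamma)$ (equal to the set of $\Lambda$ with $\Lambda\backslash\Gamma/\langle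 b\rangle$ infinite), and $\mathcal K_q=\mathcal K(\Gamma)\cap\mathrm{PH}_{m,n}^{-1}(q)$; it is a perfect Polish $\Gamma$-invariant space. *)

theory Defs
  imports "HOL-Analysis.Analysis" "HOL-Algebra.Coset" "HOL-Library.Extended_Nat"
    "HOL-Computational_Algebra.Primes"
begin

datatype gen = GB | GT
type_synonym letter = "gen \<times> bool"   (* (generator, True = positive exponent) *)
type_synonym word = "letter list"

definition linv :: "letter \<Rightarrow> letter" where
  "linv x = (fst x, \<not> snd x)"

definition bpow :: "int \<Rightarrow> word" where
  "bpow k = (if k \<ge> 0 then replicate (nat k) (GB, True) else replicate (nat (- k)) (GB, False))"

inductive bs_eq :: "int \<Rightarrow> int \<Rightarrow> word \<Rightarrow> word \<Rightarrow> bool" for m n where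
  bs_refl: "bs_eq m n w w"
| bs_sym: "bs_eq m n v w \<Longrightarrow> bs_eq m n w v"
| bs_trans: "bs_eq m n u v \<Longrightarrow> bs_eq m n v w \<Longrightarrow> bs_eq m n u w"
| bs_cancel: "bs_eq m n (u @ [x, linv x] @ v) (u @ v)"
| bs_rel: "bs_eq m n (u @ [(GT, True)] @ bpow m @ [(GT, False)] @ v) (u @ bpow n @ v)"

definition bs_class :: "int \<Rightarrow> int \<Rightarrow> word \<Rightarrow> word set" where
  "bs_class m n w = {v. bs_eq m n w v}"

definition BS :: "int \<Rightarrow> int \<Rightarrow> word set monoid" where
  "BS m n = \<lparr> carrier = range (bs_class m n),
              mult = (\<lambda>A B. bs_class m n ((SOME a. a \<in> A) @ (SOME b. b \<in> B))),
              one = bs_class m n [] \<rparr>"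

definition bs_b :: "int \<Rightarrow> int \<Rightarrow> word set" where
  "bs_b m n = bs_class m n [(GB, True)]"

definition bs_t :: "int \<Rightarrow> int \<Rightarrow> word set" where
  "bs_t m n = bs_class m n [(GT, True)]"

definition b_sub :: "int \<Rightarrow> int \<Rightarrow> word set set" where
  "b_sub m n = {bs_b m n [^]\<^bsub>BS m n\<^esub> (k::int) | k. True}"

definition SubG :: "int \<Rightarrow> int \<Rightarrow> word set set set" where
  "SubG m n = {H. subgroup H (BS m n)}"

definition Sub_top :: "int \<Rightarrow> int \<Rightarrow> word set set topology" where
  "Sub_top m n = subtopology
     (topology_generated_by
        {{\<Lambda> \<in> SubG m n. I \<subseteq> \<Lambda> \<and> Ex \<inter> \<Lambda> = {}} | I Ex. finite I \<and> finite Ex})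
     (SubG m n)"

text \<open>Perfect kernel: the largest subset without isolated points (union of all
  dense-in-itself subsets); in a Polish space this is the largest perfect closed subset.\<close>
definition perfect_kernel :: "'a topology \<Rightarrow> 'a set" where
  "perfect_kernel X = \<Union>{S. S \<subseteq> topspace X \<and> S \<subseteq> X derived_set_of S}"

definition conj_act :: "int \<Rightarrow> int \<Rightarrow> word set set \<Rightarrow> word set \<Rightarrow> word set set" where
  "conj_act m n \<Lambda> \<gamma> = (\<lambda>x. inv\<^bsub>BS m n\<^esub> \<gamma> \<otimes>\<^bsub>BS m n\<^esub> x \<otimes>\<^bsub>BS m n\<^esub> \<gamma>) ` \<Lambda>"

definition pval :: "nat \<Rightarrow> int \<Rightarrow> nat" where
  "pval p k = multiplicity (int p) k"

definition Ph :: "int \<Rightarrow> int \<Rightarrow> enat \<Rightarrow> enat" where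
  "Ph m n L = (case L of
      \<infinity> \<Rightarrow> \<infinity>
    | enat l \<Rightarrow> enat (\<Prod>p \<in> {p. prime p \<and> pval p m = pval p n \<and> pval p (int l) > pval p n}.
                         p ^ pval p (int l)))"

definition b_index :: "int \<Rightarrow> int \<Rightarrow> word set set \<Rightarrow> enat" where
  "b_index m n \<Lambda> =
     (let C = {(b_sub m n \<inter> \<Lambda>) #>\<^bsub>BS m n\<^esub> g | g. g \<in> b_sub m n}
      in if finite C then enat (card C) else \<infinity>)"

definition PH :: "int \<Rightarrow> int \<Rightarrow> word set set \<Rightarrow> enat" where
  "PH m n \<Lambda> = Ph m n (b_index m n \<Lambda>)"

definition phenotypes :: "int \<Rightarrow> int \<Rightarrow> enat set" where
  "phenotypes m n = PH m n ` SubG m n"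

definition Kq :: "int \<Rightarrow> int \<Rightarrow> enat \<Rightarrow> word set set set" where
  "Kq m n q = perfect_kernel (Sub_top m n) \<inter> {\<Lambda>. PH m n \<Lambda> = q}"

end

theory Submission
  imports Defs
begin

text \<open>
  Subgroups of \<open>BS(m,n)\<close> are point stabilizers of (right) actions, and only the behaviour of short
  words matters for the topology. Given subgroups \<open>\<Lambda>\<^sub>i\<close>, \<open>\<Lambda>'\<^sub>i\<close> with infinitely many \<open>b\<close>-orbits and the same
  phenotype, keep only finitely many \<open>b\<close>-orbits of their coset actions and extend the resulting partial
  actions freely, in a tree-like manner, to full actions.

  A positive word (no \<open>t\<^sup>-\<^sup>1\<close>) moves every base point out of the finite part: otherwise the points it
  reaches would form a set invariant under \<open>t\<close>, hence under the group, having finitely many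
  \<open>b\<close>-orbits. Once outside, positive words only move further out, so a single positive word \<open>g\<close> serves
  all base points. Going on with \<open>t\<^sup>N b t\<^sup>-\<^sup>M\<close>, the length of the \<open>b\<close>-orbit reached depends, for
  \<open>M\<close> and \<open>N\<close> large, only on the phenotype. Two \<open>t\<close>-edges leaving orbits of equal length can be switched
  without destroying the action, and this joins the two base points by a word not depending on \<open>i\<close>.

  The same statement shows that an isolated point of the set \<open>S\<close> of subgroups with infinitely many
  \<open>b\<close>-orbits and phenotype \<open>q\<close> would be its only point, while switching edges creates loops and hence
  a second one. So \<open>S\<close> lies in the perfect kernel. Conversely, subgroups with finitely many \<open>b\<close>-orbits
  are finitely generated, and one that is minimal with respect to the index or the number of its \<open>b\<close>-orbits is
  isolated, so the perfect kernel contains none of them.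
\<close>

subsection \<open>Orbit lengths and phenotypes\<close>

text \<open>The period of \<open>x t b\<^sup>j\<close> when \<open>x\<close> has \<open>b\<close>-period \<open>L\<close> and the edge \<open>x t\<close> is added freely
  (\<open>c = n\<close>, \<open>d = m\<close>; for \<open>t\<^sup>-\<^sup>1\<close> exchange \<open>c\<close> and \<open>d\<close>). The period \<open>0\<close> stands for an infinite orbit.\<close>
definition nper :: "int \<Rightarrow> int \<Rightarrow> nat \<Rightarrow> nat" where
  "nper c d L = L div gcd L (nat \<bar>c\<bar>) * nat \<bar>d\<bar>"

lemma multiplicity_int_int: "multiplicity (int p) (int k) = multiplicity p k"
proof -
  have "int p ^ i dvd int k \<longleftrightarrow> p ^ i dvd k" for i
    by (metis int_dvd_int_iff of_nat_power)
  then show ?thesis by (simp add: multiplicity_def)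
qed

lemma pval_nat_abs: "pval p k = multiplicity p (nat \<bar>k\<bar>)"
proof -
  have "multiplicity (int p) k = multiplicity (int p) \<bar>k\<bar>"
    using multiplicity_normalize_right[of "int p" k] by simp
  also have "\<dots> = multiplicity p (nat \<bar>k\<bar>)"
    by (metis abs_ge_zero int_nat_eq multiplicity_int_int)
  finally show ?thesis by (simp add: pval_def)
qed

lemma nper_pos: "L > 0 \<Longrightarrow> d \<noteq> 0 \<Longrightarrow> nper c d L > 0"
  unfolding nper_def by (metis dvd_div_eq_0_iff gcd_dvd1 gr0I mult_is_0 nat_0_iff abs_le_zero_iff)

lemma nper_0 [simp]: "nper c d 0 = 0"
  by (simp add: nper_def)

lemma multiplicity_nper:
  assumes p: "prime p" and L: "L > 0" and c: "c \<noteq> 0" and d: "d \<noteq> 0"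
  shows "multiplicity p (nper c d L) = max (multiplicity p L) (pval p c) - pval p c + pval p d"
proof -
  let ?g = "gcd L (nat \<bar>c\<bar>)"
  have g: "?g > 0" using L by simp
  obtain k where k: "L = ?g * k" by (metis dvdE gcd_dvd1)
  have kp: "k > 0" using k L by (metis gr0I mult_0_right)
  have "multiplicity p L = multiplicity p (?g * k)" using k by simp
  also have "\<dots> = multiplicity p ?g + multiplicity p k"
    by (intro prime_elem_multiplicity_mult_distrib) (use p g kp in \<open>simp_all only: prime_imp_prime_elem neq0_conv\<close>)
  also have "multiplicity p ?g = min (multiplicity p L) (pval p c)"
    unfolding pval_nat_abs by (rule multiplicity_gcd) (use L c p in auto)
  finally have mk: "multiplicity p k = max (multiplicity p L) (pval p c) - pval p c" by linarith
  have "nper c d L = k * nat \<bar>d\<bar>"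
    unfolding nper_def using k g by (metis nonzero_mult_div_cancel_left less_not_refl)
  also have "multiplicity p \<dots> = multiplicity p k + pval p d"
    using p kp d by (subst prime_elem_multiplicity_mult_distrib) (auto simp: pval_nat_abs)
  finally show ?thesis using mk by simp
qed

lemma nper_nper_nper:
  assumes "c \<noteq> 0" "d \<noteq> 0"
  shows "nper c d (nper d c (nper c d L)) = nper c d L"
proof -
  define k where "k = L div gcd L (nat \<bar>c\<bar>)"
  have "nper c d L = k * nat \<bar>d\<bar>" by (simp add: nper_def k_def)
  moreover have "nper d c (k * nat \<bar>d\<bar>) = k * nat \<bar>c\<bar>"
    using assms by (simp add: nper_def gcd_proj2_if_dvd_nat)
  moreover have "nper c d (k * nat \<bar>c\<bar>) = k * nat \<bar>d\<bar>"
    using assms by (simp add: nper_def gcd_proj2_if_dvd_nat)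
  ultimately show ?thesis by simp
qed

definition same_ph :: "int \<Rightarrow> int \<Rightarrow> nat \<Rightarrow> nat \<Rightarrow> bool" where
  "same_ph m n L L' \<longleftrightarrow> (L = 0 \<longleftrightarrow> L' = 0) \<and>
     (\<forall>p. prime p \<longrightarrow> pval p m = pval p n \<longrightarrow>
        max (multiplicity p L) (pval p n) = max (multiplicity p L') (pval p n))"

lemma decreasing_iterate_eq:
  fixes f :: "nat \<Rightarrow> nat"
  assumes lo: "\<And>l. b \<le> f l" and hi: "\<And>l. f l \<le> max (l - 1) b"
    and N: "l \<le> N" "1 \<le> N"
  shows "(f ^^ N) l = b"
proof -
  have "(f ^^ k) l \<le> max (l - k) b" for k
  proof (induction k)
    case (Suc k)
    then show ?case using hi[of "(f ^^ k) l"] by simp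
  qed simp
  moreover have "b \<le> (f ^^ N) l" using N lo by (cases N) auto
  ultimately show ?thesis using N by (metis diff_is_0_eq le_antisym max_0L)
qed

lemma valuation_iterates_agree:
  fixes a c l l' N M :: nat
  defines "f \<equiv> \<lambda>l. max l c - c + a" and "g \<equiv> \<lambda>l. max l a - a + c"
  assumes N: "l \<le> N" "l' \<le> N" "1 \<le> N" and M: "N + N * a \<le> M"
    and eq: "a = c \<Longrightarrow> max l c = max l' c"
  shows "(g ^^ M) ((f ^^ N) l) = (g ^^ M) ((f ^^ N) l')"
proof -
  consider "a < c" | "a = c" | "c < a" by linarith
  then show ?thesis
  proof cases
    case 1
    have "(f ^^ N) k = a" if "k \<le> N" for k
      by (rule decreasing_iterate_eq) (use 1 N that in \<open>auto simp: f_def\<close>)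
    then show ?thesis using N by simp
  next
    case 2
    have fm: "(f ^^ k) x = max x c" if "1 \<le> k" for k x
      using that 2 by (induction k rule: dec_induct) (auto simp: f_def)
    then show ?thesis using eq[OF 2] N by simp
  next
    case 3
    have bd: "(f ^^ k) x \<le> x + k * a" for k x
      by (induction k) (auto simp: f_def)
    have "(g ^^ M) y = c" if "y \<le> N + N * a" for y
      by (rule decreasing_iterate_eq) (use 3 N M that in \<open>auto simp: g_def\<close>)
    moreover have "(f ^^ N) k \<le> N + N * a" if "k \<le> N" for k
      using bd[of N k] that by linarith
    ultimately show ?thesis using N by simp
  qed
qed

lemma multiplicity_nper_iterate:
  assumes p: "prime p" and L: "L > 0" and c: "c \<noteq> 0" and d: "d \<noteq> 0"
  shows "(nper c d ^^ N) L > 0 \<and> multiplicity p ((nper c d ^^ N) L) =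
    ((\<lambda>l. max l (pval p c) - pval p c + pval p d) ^^ N) (multiplicity p L)"
  using L by (induction N) (auto simp: multiplicity_nper nper_pos p c d)

lemma multiplicity_le_nat: "multiplicity p L \<le> (L::nat)" if "prime p" "L > 0"
proof -
  have "p ^ multiplicity p L \<le> L" using that by (meson multiplicity_dvd dvd_imp_le)
  moreover have "multiplicity p L < p ^ multiplicity p L"
    using that prime_gt_1_nat by (simp add: power_gt_expt)
  ultimately show ?thesis by simp
qed

lemma nper_iterates_agree:
  assumes m: "m \<noteq> 0" and n: "n \<noteq> 0" and ph: "same_ph m n L L'"
    and N: "L \<le> N" "L' \<le> N" "1 \<le> N" and M: "N + N * nat \<bar>m\<bar> \<le> M"
  shows "(nper m n ^^ M) ((nper n m ^^ N) L) = (nper m n ^^ M) ((nper n m ^^ N) L')"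
proof (cases "L = 0")
  case True
  then show ?thesis using ph by (simp add: same_ph_def)
next
  case False
  then have L: "L > 0" "L' > 0" using ph by (auto simp: same_ph_def)
  have pos: "(nper m n ^^ M) ((nper n m ^^ N) K) > 0" if "K > 0" for K
    using multiplicity_nper_iterate[of 2] that m n by (metis two_is_prime_nat)
  show ?thesis
  proof (rule multiplicity_eq_nat)
    fix p :: nat assume p: "prime p"
    have "pval p m \<le> nat \<bar>m\<bar>" using p m by (simp add: pval_nat_abs multiplicity_le_nat)
    then have M': "N + N * pval p m \<le> M" using M by (meson add_left_mono le_trans mult_le_mono2)
    have "multiplicity p ((nper m n ^^ M) ((nper n m ^^ N) K)) =
      ((\<lambda>l. max l (pval p m) - pval p m + pval p n) ^^ M)
       (((\<lambda>l. max l (pval p n) - pval p n + pval p m) ^^ N) (multiplicity p K))" if "K > 0" for K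
      using multiplicity_nper_iterate[OF p _ m n] multiplicity_nper_iterate[OF p that n m] by simp
    moreover have "((\<lambda>l. max l (pval p m) - pval p m + pval p n) ^^ M)
       (((\<lambda>l. max l (pval p n) - pval p n + pval p m) ^^ N) (multiplicity p L)) =
       ((\<lambda>l. max l (pval p m) - pval p m + pval p n) ^^ M)
       (((\<lambda>l. max l (pval p n) - pval p n + pval p m) ^^ N) (multiplicity p L'))"
      by (rule valuation_iterates_agree)
         (use L N M' ph p multiplicity_le_nat[of p] in \<open>auto simp: same_ph_def intro: le_trans\<close>)
    ultimately show "multiplicity p ((nper m n ^^ M) ((nper n m ^^ N) L)) =
       multiplicity p ((nper m n ^^ M) ((nper n m ^^ N) L'))" using L by simp
  qed (use pos L in auto)
qed

lemma Ph_eq_iff_same_ph: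
  assumes L: "L > 0" "L' > 0"
  shows "Ph m n (enat L) = Ph m n (enat L') \<longleftrightarrow> same_ph m n L L'"
proof -
  define S where "S K = {p::nat. prime p \<and> pval p m = pval p n \<and> pval p (int K) > pval p n}" for K
  have pv: "pval p (int K) = multiplicity p K" for p K by (simp add: pval_nat_abs)
  have fin: "finite (S K)" if "K > 0" for K
  proof (rule finite_subset[of _ "prime_factors K"])
    show "S K \<subseteq> prime_factors K"
    proof
      fix p assume "p \<in> S K"
      then have "prime p" "multiplicity p K > 0" by (auto simp: S_def pv)
      then show "p \<in> prime_factors K" by (simp add: prime_factors_multiplicity)
    qed
  qed simp
  have pr: "prime p" if "p \<in> S K" for p K using that by (simp add: S_def)
  have mu: "multiplicity p (\<Prod>p\<in>S K. p ^ multiplicity p K) = (if p \<in> S K then multiplicity p K else 0)"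
    if "prime p" "K > 0" for p K
    by (rule multiplicity_prod_prime_powers) (use that fin pr in auto)
  have pos: "(\<Prod>p\<in>S K. p ^ multiplicity p K) > 0" for K
    using pr by (auto intro!: prod_pos simp: prime_gt_0_nat)
  have "Ph m n (enat K) = enat (\<Prod>p\<in>S K. p ^ multiplicity p K)" for K
    by (simp add: Ph_def S_def pv)
  then have "Ph m n (enat L) = Ph m n (enat L') \<longleftrightarrow>
     (\<Prod>p\<in>S L. p ^ multiplicity p L) = (\<Prod>p\<in>S L'. p ^ multiplicity p L')" by simp
  also have "\<dots> \<longleftrightarrow> (\<forall>p. prime p \<longrightarrow> (if p \<in> S L then multiplicity p L else 0) =
       (if p \<in> S L' then multiplicity p L' else 0))"
  proof
    assume eq: "(\<Prod>p\<in>S L. p ^ multiplicity p L) = (\<Prod>p\<in>S L'. p ^ multiplicity p L')"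
    show "\<forall>p. prime p \<longrightarrow> (if p \<in> S L then multiplicity p L else 0) =
       (if p \<in> S L' then multiplicity p L' else 0)"
      using mu[OF _ L(1)] mu[OF _ L(2)] eq by metis
  next
    assume *: "\<forall>p. prime p \<longrightarrow> (if p \<in> S L then multiplicity p L else 0) =
       (if p \<in> S L' then multiplicity p L' else 0)"
    show "(\<Prod>p\<in>S L. p ^ multiplicity p L) = (\<Prod>p\<in>S L'. p ^ multiplicity p L')"
      by (rule multiplicity_eq_nat[OF pos pos]) (use mu[OF _ L(1)] mu[OF _ L(2)] * in metis)
  qed
  also have "\<dots> \<longleftrightarrow> same_ph m n L L'"
  proof -
    have "(if p \<in> S L then multiplicity p L else 0) = (if p \<in> S L' then multiplicity p L' else 0) \<longleftrightarrow>
       (pval p m = pval p n \<longrightarrow>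
        max (multiplicity p L) (pval p n) = max (multiplicity p L') (pval p n))" if "prime p" for p
      using that unfolding S_def mem_Collect_eq pv by (auto simp: max_def)
    then show ?thesis using L unfolding same_ph_def by auto
  qed
  finally show ?thesis .
qed

subsection \<open>Actions of Baumslag-Solitar groups\<close>

fun lact :: "(int \<Rightarrow> 'a \<Rightarrow> 'a) \<Rightarrow> (bool \<Rightarrow> 'a \<Rightarrow> 'a) \<Rightarrow> letter \<Rightarrow> 'a \<Rightarrow> 'a" where
  "lact \<beta> \<tau> (GB, e) x = \<beta> (if e then 1 else -1) x"
| "lact \<beta> \<tau> (GT, e) x = \<tau> e x"

abbreviation run :: "(int \<Rightarrow> 'a \<Rightarrow> 'a) \<Rightarrow> (bool \<Rightarrow> 'a \<Rightarrow> 'a) \<Rightarrow> word \<Rightarrow> 'a \<Rightarrow> 'a" where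
  "run \<beta> \<tau> \<equiv> fold (lact \<beta> \<tau>)"

definition winv :: "word \<Rightarrow> word" where
  "winv w = rev (map linv w)"

lemma linv_linv [simp]: "linv (linv l) = l"
  by (simp add: linv_def)

lemma linv_Pair [simp]: "linv (g, e) = (g, \<not> e)"
  by (simp add: linv_def)

lemma winv_Nil [simp]: "winv [] = []"
  by (simp add: winv_def)

lemma winv_append [simp]: "winv (u @ v) = winv v @ winv u"
  by (simp add: winv_def)

lemma winv_Cons: "winv (l # w) = winv w @ [linv l]"
  by (simp add: winv_def)

lemma winv_winv [simp]: "winv (winv w) = w"
  by (simp add: winv_def rev_map o_def)

definition has_per :: "(int \<Rightarrow> 'a \<Rightarrow> 'a) \<Rightarrow> 'a \<Rightarrow> nat \<Rightarrow> bool" where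
  "has_per \<beta> x L \<longleftrightarrow> (\<forall>k. \<beta> k x = x \<longleftrightarrow> int L dvd k)"

lemma has_per_unique: "has_per \<beta> x L \<Longrightarrow> has_per \<beta> x L' \<Longrightarrow> L = L'"
  unfolding has_per_def by (metis dvd_antisym dvd_refl int_dvd_int_iff)

definition flip :: "letter \<Rightarrow> letter" where
  "flip l = (if fst l = GT then linv l else l)"

lemma run_flip: "run \<beta> (\<lambda>e. \<tau> (\<not> e)) w x = run \<beta> \<tau> (map flip w) x"
proof -
  have "lact \<beta> (\<lambda>e. \<tau> (\<not> e)) l y = lact \<beta> \<tau> (flip l) y" for l y
    by (cases "(\<beta>, \<tau>, l, y)" rule: lact.cases) (auto simp: flip_def)
  then show ?thesis by (induction w arbitrary: x) auto
qed

lemma map_flip_flip [simp]: "map flip (map flip w) = w"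
  by (induction w) (auto simp: flip_def)

locale bs_action =
  fixes m n :: int and C :: "'a set" and \<beta> :: "int \<Rightarrow> 'a \<Rightarrow> 'a" and \<tau> :: "bool \<Rightarrow> 'a \<Rightarrow> 'a"
  assumes m0: "m \<noteq> 0" and n0: "n \<noteq> 0"
    and beta_closed [simp]: "x \<in> C \<Longrightarrow> \<beta> k x \<in> C"
    and beta_0 [simp]: "x \<in> C \<Longrightarrow> \<beta> 0 x = x"
    and beta_add: "x \<in> C \<Longrightarrow> \<beta> (j + k) x = \<beta> j (\<beta> k x)"
    and tau_closed [simp]: "x \<in> C \<Longrightarrow> \<tau> e x \<in> C"
    and tau_inv: "x \<in> C \<Longrightarrow> \<tau> (\<not> e) (\<tau> e x) = x"
    and tau_beta: "x \<in> C \<Longrightarrow> \<tau> True (\<beta> n x) = \<beta> m (\<tau> True x)"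
begin

definition Mo :: "bool \<Rightarrow> int" where "Mo e = (if e then m else n)"
definition Ca :: "bool \<Rightarrow> int" where "Ca e = (if e then n else m)"

lemma Mo_simps [simp]: "Mo True = m" "Mo False = n" "Mo (\<not> e) = Ca e"
  and Ca_simps [simp]: "Ca True = n" "Ca False = m" "Ca (\<not> e) = Mo e"
  by (auto simp: Mo_def Ca_def)

lemma Mo_neq_0 [simp]: "Mo e \<noteq> 0" and Ca_neq_0 [simp]: "Ca e \<noteq> 0"
  by (auto simp: Mo_def Ca_def m0 n0)

lemma tau_inv_simps [simp]:
  "x \<in> C \<Longrightarrow> \<tau> False (\<tau> True x) = x" "x \<in> C \<Longrightarrow> \<tau> True (\<tau> False x) = x"
  using tau_inv[of x True] tau_inv[of x False] by auto

lemma beta_beta: "x \<in> C \<Longrightarrow> \<beta> j (\<beta> k x) = \<beta> (j + k) x"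
  by (simp add: beta_add)

lemma beta_minus [simp]:
  assumes "x \<in> C" shows "\<beta> (- k) (\<beta> k x) = x" "\<beta> k (\<beta> (- k) x) = x"
  using assms beta_add[of x "- k" k] beta_add[of x k "- k"] by auto

lemma beta_eq_iff: "x \<in> C \<Longrightarrow> y \<in> C \<Longrightarrow> \<beta> k x = \<beta> k y \<longleftrightarrow> x = y"
  by (metis beta_minus(1))

lemma beta_commute: "x \<in> C \<Longrightarrow> \<beta> j (\<beta> k x) = \<beta> k (\<beta> j x)"
  by (simp add: beta_beta add.commute)

lemma beta_beta_eq_iff:
  assumes "x \<in> C" shows "\<beta> i x = \<beta> j x \<longleftrightarrow> \<beta> (i - j) x = x"
proof -
  have "\<beta> i x = \<beta> j (\<beta> (i - j) x)" using assms by (simp add: beta_beta)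
  then show ?thesis using assms by (simp add: beta_eq_iff)
qed

lemma tau_eq_iff: "x \<in> C \<Longrightarrow> y \<in> C \<Longrightarrow> \<tau> e x = \<tau> e y \<longleftrightarrow> x = y"
  by (metis tau_inv)

lemma tau_beta_nat: "x \<in> C \<Longrightarrow> \<tau> True (\<beta> (n * int k) x) = \<beta> (m * int k) (\<tau> True x)"
proof (induction k)
  case (Suc k)
  have "\<beta> (n * int (Suc k)) x = \<beta> n (\<beta> (n * int k) x)"
    using Suc.prems by (simp add: beta_beta algebra_simps)
  also have "\<tau> True \<dots> = \<beta> m (\<beta> (m * int k) (\<tau> True x))"
    using Suc by (simp add: tau_beta)
  finally show ?case using Suc.prems by (simp add: beta_beta algebra_simps)
qed simp

lemma tau_beta_True:
  assumes x: "x \<in> C" shows "\<tau> True (\<beta> (n * k) x) = \<beta> (m * k) (\<tau> True x)"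
proof (cases "k \<ge> 0")
  case True
  then show ?thesis using tau_beta_nat[OF x, of "nat k"] by simp
next
  case False
  define y where "y = \<beta> (n * k) x"
  have y: "y \<in> C" "\<beta> (n * (- k)) y = x" using x by (auto simp: y_def beta_beta)
  have "\<tau> True x = \<beta> (m * (- k)) (\<tau> True y)"
    using tau_beta_nat[OF y(1), of "nat (- k)"] False y(2) by simp
  then show ?thesis using y(1) by (simp add: beta_beta flip: y_def)
qed

lemma tau_beta_gen:
  assumes x: "x \<in> C" shows "\<tau> e (\<beta> (Ca e * k) x) = \<beta> (Mo e * k) (\<tau> e x)"
proof (cases e)
  case False
  define y where "y = \<tau> False x"
  have y: "y \<in> C" "\<tau> True y = x" using x by (auto simp: y_def)
  have "\<tau> True (\<beta> (n * k) y) = \<beta> (m * k) x" using tau_beta_True[OF y(1)] y(2) by simp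
  then have "\<tau> False (\<beta> (m * k) x) = \<beta> (n * k) y"
    by (metis beta_closed tau_inv_simps(1) y(1))
  then show ?thesis using False by (simp add: y_def)
qed (use tau_beta_True[OF x] in simp)

lemma lact_closed [simp]: "x \<in> C \<Longrightarrow> lact \<beta> \<tau> l x \<in> C"
  by (cases "(\<beta>, \<tau>, l, x)" rule: lact.cases) auto

lemma run_closed [simp]: "x \<in> C \<Longrightarrow> run \<beta> \<tau> w x \<in> C"
  by (induction w arbitrary: x) auto

lemma lact_linv [simp]: "x \<in> C \<Longrightarrow> lact \<beta> \<tau> (linv l) (lact \<beta> \<tau> l x) = x"
  by (cases "(\<beta>, \<tau>, l, x)" rule: lact.cases) (auto simp: tau_inv)

lemma run_winv [simp]: "x \<in> C \<Longrightarrow> run \<beta> \<tau> (winv w) (run \<beta> \<tau> w x) = x"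
  by (induction w arbitrary: x) (auto simp: winv_Cons)

lemma run_winv' [simp]: "x \<in> C \<Longrightarrow> run \<beta> \<tau> w (run \<beta> \<tau> (winv w) x) = x"
  using run_winv[of x "winv w"] by simp

lemma run_replicate_GB:
  "x \<in> C \<Longrightarrow> run \<beta> \<tau> (replicate k (GB, e)) x = \<beta> (if e then int k else - int k) x"
  by (induction k arbitrary: x) (auto simp: beta_beta algebra_simps simp del: fold_replicate)

lemma run_bpow [simp]: "x \<in> C \<Longrightarrow> run \<beta> \<tau> (bpow k) x = \<beta> k x"
  by (simp add: bpow_def run_replicate_GB del: fold_replicate)

lemma run_bs_eq: "bs_eq m n u v \<Longrightarrow> x \<in> C \<Longrightarrow> run \<beta> \<tau> u x = run \<beta> \<tau> v x"
proof (induction arbitrary: x rule: bs_eq.induct)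
  case (bs_rel u v)
  let ?y = "run \<beta> \<tau> u x"
  have "\<tau> False (\<beta> m (\<tau> True ?y)) = \<beta> n ?y"
    using bs_rel tau_beta[of ?y] by (metis run_closed beta_closed tau_inv_simps(1))
  then show ?case using bs_rel by simp
qed auto

lemma has_per_exists:
  assumes x: "x \<in> C" shows "\<exists>L. has_per \<beta> x L"
proof -
  define P where "P k \<longleftrightarrow> \<beta> k x = x" for k
  have add: "P (j + k)" if "P j" "P k" for j k using that x by (simp add: P_def beta_add)
  have neg: "P (- k)" if "P k" for k using that x by (metis P_def beta_minus(1))
  have zero: "P 0" using x by (simp add: P_def)
  have multn: "P (int i * k)" if "P k" for i k
    by (induction i) (auto simp: zero distrib_right intro: add that)
  have mult: "P (i * k)" if "P k" for i k
    using multn[OF that, of "nat i"] multn[OF neg[OF that], of "nat (- i)"] by (cases "i \<ge> 0") auto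
  show ?thesis
  proof (cases "\<exists>k > 0. P (int k)")
    case False
    have "P k \<longleftrightarrow> k = 0" for k
    proof
      assume k: "P k"
      have "\<not> nat k > 0" "\<not> nat (- k) > 0" using False k neg[OF k] by (metis int_nat_eq of_nat_0_less_iff less_le not_le zero neg nat_eq_iff2)+
      then show "k = 0" by simp
    qed (simp add: zero)
    then show ?thesis by (intro exI[of _ 0]) (simp add: has_per_def P_def)
  next
    case True
    define L where "L = (LEAST k. k > 0 \<and> P (int k))"
    have L: "L > 0" "P (int L)" using LeastI_ex[OF True[unfolded Bex_def]] by (auto simp: L_def)
    have min: "\<not> P (int k)" if "0 < k" "k < L" for k
      using not_less_Least[of k "\<lambda>k. k > 0 \<and> P (int k)"] that by (auto simp: L_def)
    have "P k \<longleftrightarrow> int L dvd k" for k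
    proof
      assume k: "P k"
      have "P (k + (- (k div int L)) * int L)" by (intro add k mult L)
      then have "P (k mod int L)" by (simp add: minus_div_mult_eq_mod[symmetric])
      moreover have "0 \<le> k mod int L" "k mod int L < int L" using L by auto
      ultimately have "k mod int L = 0"
        using min[of "nat (k mod int L)"] by (metis int_nat_eq less_le nat_less_iff zero_less_nat_eq)
      then show "int L dvd k" by auto
    next
      assume "int L dvd k"
      then show "P k" using mult[OF L(2)] by (metis dvdE mult.commute)
    qed
    then show ?thesis by (intro exI[of _ L]) (simp add: has_per_def P_def)
  qed
qed

lemma has_per_beta: "x \<in> C \<Longrightarrow> has_per \<beta> (\<beta> j x) L \<longleftrightarrow> has_per \<beta> x L"
proof -
  assume x: "x \<in> C"
  have "\<beta> k (\<beta> j x) = \<beta> j x \<longleftrightarrow> \<beta> k x = x" for k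
    using x by (simp add: beta_commute[of x k j] beta_eq_iff)
  then show ?thesis by (simp add: has_per_def)
qed

lemma flip_action: "bs_action n m C \<beta> (\<lambda>e. \<tau> (\<not> e))"
proof
  fix x assume "x \<in> C"
  then show "\<tau> (\<not> True) (\<beta> m x) = \<beta> n (\<tau> (\<not> True) x)" using tau_beta_gen[of x False 1] by simp
next
  fix x e assume "x \<in> C"
  then show "\<tau> (\<not> \<not> e) (\<tau> (\<not> e) x) = x" using tau_inv[of x "\<not> e"] by simp
qed (auto simp: m0 n0 beta_add)

definition cls :: "'a \<Rightarrow> 'a set" where
  "cls p = range (\<lambda>k. \<beta> (n * k) p)"

definition switch :: "'a \<Rightarrow> 'a \<Rightarrow> 'a \<Rightarrow> 'a" where
  "switch p q x =
    (if x \<in> cls p then \<beta> (n * (SOME k. x = \<beta> (n * k) p)) q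
     else if x \<in> cls q then \<beta> (n * (SOME k. x = \<beta> (n * k) q)) p else x)"

definition stau :: "'a \<Rightarrow> 'a \<Rightarrow> bool \<Rightarrow> 'a \<Rightarrow> 'a" where
  "stau p q e x = (if e then \<tau> True (switch p q x) else switch p q (\<tau> False x))"

lemma cls_beta: "x \<in> cls p \<Longrightarrow> p \<in> C \<Longrightarrow> \<beta> (n * k) x \<in> cls p"
  by (auto simp: cls_def beta_beta distrib_left[symmetric])

lemma cls_beta_iff: "x \<in> C \<Longrightarrow> p \<in> C \<Longrightarrow> \<beta> n x \<in> cls p \<longleftrightarrow> x \<in> cls p"
  using cls_beta[of "\<beta> n x" p "-1"] cls_beta[of x p 1] by auto

context
  fixes p q assumes p: "p \<in> C" and q: "q \<in> C" and pq: "q \<notin> cls p"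
    and st: "\<And>k. \<beta> (n * k) p = p \<longleftrightarrow> \<beta> (n * k) q = q"
begin

lemma cls_disjoint: "x \<in> cls p \<Longrightarrow> x \<notin> cls q"
proof
  assume "x \<in> cls p" "x \<in> cls q"
  then obtain i j where "x = \<beta> (n * i) p" "x = \<beta> (n * j) q" unfolding cls_def by blast
  then have "q = \<beta> (- (n * j)) (\<beta> (n * i) p)" using q by (metis beta_minus(1))
  then have "q = \<beta> (n * (i - j)) p" using p by (simp add: beta_beta algebra_simps)
  then show False using pq by (auto simp: cls_def)
qed

lemma beta_cls_eq: "\<beta> (n * i) p = \<beta> (n * j) p \<longleftrightarrow> \<beta> (n * i) q = \<beta> (n * j) q"
proof -
  have "\<beta> (n * i) r = \<beta> (n * j) r \<longleftrightarrow> \<beta> (n * (i - j)) r = r" if "r \<in> C" for r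
    using beta_beta_eq_iff[OF that] by (simp add: right_diff_distrib)
  then show ?thesis using p q st by simp
qed

lemma switch_p: "switch p q (\<beta> (n * k) p) = \<beta> (n * k) q"
proof -
  have "\<beta> (n * k) p \<in> cls p" by (auto simp: cls_def)
  moreover have "\<beta> (n * k) p = \<beta> (n * (SOME i. \<beta> (n * k) p = \<beta> (n * i) p)) p"
    by (rule someI[of _ k]) simp
  ultimately show ?thesis using beta_cls_eq unfolding switch_def by metis
qed

lemma switch_q: "switch p q (\<beta> (n * k) q) = \<beta> (n * k) p"
proof -
  have "\<beta> (n * k) q \<in> cls q" by (auto simp: cls_def)
  moreover have "\<beta> (n * k) q \<notin> cls p" using calculation cls_disjoint by blast
  moreover have "\<beta> (n * k) q = \<beta> (n * (SOME i. \<beta> (n * k) q = \<beta> (n * i) q)) q"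
    by (rule someI[of _ k]) simp
  ultimately show ?thesis using beta_cls_eq unfolding switch_def by metis
qed

lemma switch_other: "x \<notin> cls p \<union> cls q \<Longrightarrow> switch p q x = x"
  by (simp add: switch_def)

lemma switch_cases:
  obtains k where "x = \<beta> (n * k) p" | k where "x = \<beta> (n * k) q" | "x \<notin> cls p \<union> cls q"
  by (auto simp: cls_def)

lemma switch_switch: "switch p q (switch p q x) = x"
  by (rule switch_cases[of x]) (simp_all add: switch_p switch_q switch_other)

lemma switch_closed: "x \<in> C \<Longrightarrow> switch p q x \<in> C"
  by (rule switch_cases[of x]) (simp_all add: switch_p switch_q switch_other p q)

lemma switch_beta:
  assumes x: "x \<in> C" shows "switch p q (\<beta> n x) = \<beta> n (switch p q x)"
proof (rule switch_cases[of x])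
  fix k assume k: "x = \<beta> (n * k) p"
  have "\<beta> n x = \<beta> (n * (1 + k)) p" using k p by (simp add: beta_beta algebra_simps)
  then show ?thesis using q k by (simp only: switch_p) (simp add: beta_beta algebra_simps switch_p)
next
  fix k assume k: "x = \<beta> (n * k) q"
  have "\<beta> n x = \<beta> (n * (1 + k)) q" using k q by (simp add: beta_beta algebra_simps)
  then show ?thesis using p k by (simp only: switch_q) (simp add: beta_beta algebra_simps switch_q)
next
  assume "x \<notin> cls p \<union> cls q"
  then show ?thesis using x p q by (simp add: switch_other cls_beta_iff)
qed

lemma stau_action: "bs_action m n C \<beta> (stau p q)"
proof
  fix x e assume "x \<in> C"
  then show "stau p q (\<not> e) (stau p q e x) = x"
    by (cases e) (simp_all add: stau_def switch_switch switch_closed)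
next
  fix x assume "x \<in> C"
  then show "stau p q True (\<beta> n x) = \<beta> m (stau p q True x)"
    by (simp add: stau_def switch_beta switch_closed tau_beta)
qed (auto simp: m0 n0 beta_add stau_def switch_closed)

lemma stau_p: "stau p q True p = \<tau> True q"
  using switch_p[of 0] p q by (simp add: stau_def)

end

fun avoid :: "'a set \<Rightarrow> word \<Rightarrow> 'a \<Rightarrow> bool" where
  "avoid K [] x = True"
| "avoid K (l # w) x \<longleftrightarrow> (l = (GT, True) \<longrightarrow> x \<notin> K) \<and> (l = (GT, False) \<longrightarrow> \<tau> False x \<notin> K)
     \<and> avoid K w (lact \<beta> \<tau> l x)"

lemma run_stau: "avoid (cls p \<union> cls q) w x \<Longrightarrow> run \<beta> (stau p q) w x = run \<beta> \<tau> w x"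
proof (induction w arbitrary: x)
  case (Cons l w)
  have "lact \<beta> (stau p q) l x = lact \<beta> \<tau> l x"
    using Cons.prems by (cases "(\<beta>, \<tau>, l, x)" rule: lact.cases) (auto simp: stau_def switch_def)
  then show ?case using Cons by simp
qed simp

end

subsection \<open>Leaving a finite part\<close>

lemma dvd_mult_iff_div_gcd_nat:
  fixes L a c :: nat assumes "a > 0"
  shows "L dvd a * c \<longleftrightarrow> L div gcd L a dvd c"
proof -
  have g: "gcd L a \<noteq> 0" using assms by simp
  obtain L' a' where d: "L = L' * gcd L a" "a = a' * gcd L a" "coprime L' a'"
    using gcd_coprime_exists[OF g] by blast
  have "L dvd a * c \<longleftrightarrow> L' * gcd L a dvd (a' * c) * gcd L a"
    using d(1,2) by (metis mult.assoc mult.commute)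
  also have "\<dots> \<longleftrightarrow> L' dvd c" using d(3) g by (simp add: coprime_dvd_mult_right_iff)
  also have "L' = L div gcd L a" using d(1) g by (metis nonzero_mult_div_cancel_right)
  finally show ?thesis .
qed

lemma nper_dvd_iff:
  assumes c: "c \<noteq> 0" and d: "d \<noteq> 0"
  shows "int (nper c d L) dvd k \<longleftrightarrow> d dvd k \<and> int L dvd c * (k div d)"
proof (cases "d dvd k")
  case False
  have "int (nper c d L) = int (L div gcd L (nat \<bar>c\<bar>)) * \<bar>d\<bar>"
    unfolding nper_def by (simp only: of_nat_mult int_nat_eq abs_ge_zero if_True)
  then have "d dvd int (nper c d L)" by simp
  then show ?thesis using False dvd_trans by blast
next
  case True
  then obtain j where j: "k = d * j" by auto
  have "int (nper c d L) dvd k \<longleftrightarrow> nper c d L dvd nat \<bar>k\<bar>"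
    by (simp add: int_dvd_int_iff[symmetric])
  also have "\<dots> \<longleftrightarrow> L div gcd L (nat \<bar>c\<bar>) dvd nat \<bar>j\<bar>"
    unfolding nper_def j using d by (simp only: abs_mult nat_mult_distrib abs_ge_zero) (simp add: mult.commute)
  also have "\<dots> \<longleftrightarrow> L dvd nat \<bar>c\<bar> * nat \<bar>j\<bar>"
    using c by (subst dvd_mult_iff_div_gcd_nat) auto
  also have "\<dots> \<longleftrightarrow> int L dvd c * j"
    by (metis abs_ge_zero abs_mult dvd_abs_iff int_dvd_int_iff int_nat_eq nat_mult_distrib)
  finally show ?thesis using True d j by simp
qed

definition posw :: "word \<Rightarrow> bool" where
  "posw w \<longleftrightarrow> (GT, False) \<notin> set w"

lemma posw_append [simp]: "posw (u @ v) \<longleftrightarrow> posw u \<and> posw v"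
  by (auto simp: posw_def)

lemma posw_bpow [simp]: "posw (bpow k)"
  by (auto simp: posw_def bpow_def)

definition fin_cover :: "(int \<Rightarrow> 'a \<Rightarrow> 'a) \<Rightarrow> (bool \<Rightarrow> 'a \<Rightarrow> 'a) \<Rightarrow> 'a \<Rightarrow> bool" where
  "fin_cover \<beta> \<tau> x \<longleftrightarrow> (\<exists>U. finite U \<and> (\<forall>w. \<exists>u\<in>U. \<exists>k. run \<beta> \<tau> w x = \<beta> k (run \<beta> \<tau> u x)))"

context bs_action begin

definition orb :: "'a \<Rightarrow> 'a set" where
  "orb x = range (\<lambda>k. \<beta> k x)"

lemma orb_eqI: "x \<in> C \<Longrightarrow> orb (\<beta> k x) = orb x"
proof -
  assume x: "x \<in> C"
  have "\<beta> i x \<in> orb (\<beta> k x)" for i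
    using x by (auto simp: orb_def beta_beta intro!: image_eqI[of _ _ "i - k"])
  then show ?thesis using x by (auto simp: orb_def beta_beta)
qed

lemma orb_self: "x \<in> C \<Longrightarrow> x \<in> orb x"
  by (auto simp: orb_def intro!: image_eqI[of _ _ 0])

lemma beta_fixed_mult:
  assumes x: "x \<in> C" and k: "\<beta> k x = x" shows "\<beta> (j * k) x = x"
proof -
  obtain L where L: "has_per \<beta> x L" using has_per_exists[OF x] by blast
  then have "int L dvd j * k" using k unfolding has_per_def by (meson dvd_mult)
  then show ?thesis using L unfolding has_per_def by blast
qed

lemma nonzero_period_run:
  assumes "x \<in> C" and "\<exists>k. k \<noteq> 0 \<and> \<beta> k x = x"
  shows "\<exists>k. k \<noteq> 0 \<and> \<beta> k (run \<beta> \<tau> w x) = run \<beta> \<tau> w x"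
  using assms
proof (induction w arbitrary: x)
  case (Cons l w)
  then obtain k where k: "k \<noteq> 0" "\<beta> k x = x" by auto
  have "\<exists>k. k \<noteq> 0 \<and> \<beta> k (lact \<beta> \<tau> l x) = lact \<beta> \<tau> l x"
  proof (cases "fst l")
    case GB
    then obtain e where l: "l = (GB, e)" by (cases l) auto
    then show ?thesis using k Cons.prems(1) by (intro exI[of _ k]) (simp add: beta_commute[of x k])
  next
    case GT
    then obtain e where l: "l = (GT, e)" by (cases l) auto
    have "\<beta> (Mo e * k) (\<tau> e x) = \<tau> e x"
      using tau_beta_gen[OF Cons.prems(1), of e k] beta_fixed_mult[OF Cons.prems(1) k(2)] by simp
    then show ?thesis using l k by (intro exI[of _ "Mo e * k"]) simp
  qed
  then show ?case using Cons.IH[of "lact \<beta> \<tau> l x"] Cons.prems(1) by simp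
qed simp

lemma zero_period_run:
  assumes x: "x \<in> C" and "\<forall>k. \<beta> k x = x \<longrightarrow> k = 0"
  shows "\<forall>k. \<beta> k (run \<beta> \<tau> w x) = run \<beta> \<tau> w x \<longrightarrow> k = 0"
  using nonzero_period_run[of "run \<beta> \<tau> w x" "winv w"] assms by auto

lemma finite_orb:
  assumes x: "x \<in> C" and k: "k \<noteq> 0" "\<beta> k x = x" shows "finite (orb x)"
proof -
  obtain L where L: "has_per \<beta> x L" using has_per_exists[OF x] by blast
  then have "int L dvd k" using k by (simp add: has_per_def)
  then have Lp: "L > 0" using k by (cases L) auto
  have "orb x \<subseteq> (\<lambda>i. \<beta> i x) ` {0..<int L}"
  proof
    fix y assume "y \<in> orb x"
    then obtain i where i: "y = \<beta> i x" by (auto simp: orb_def)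
    have "\<beta> (i - i mod int L) x = x" using L by (simp add: has_per_def)
    then have "y = \<beta> (i mod int L) x" using i beta_add[OF x, of "i mod int L" "i - i mod int L"] by simp
    then show "y \<in> (\<lambda>i. \<beta> i x) ` {0..<int L}" using Lp by auto
  qed
  then show ?thesis using finite_subset by blast
qed

text \<open>Infinite orbits are compared through their \<open>b\<^sup>n\<close>- and \<open>b\<^sup>m\<close>-classes:
  \<open>t\<close> embeds the former into the latter, and there are \<open>\<bar>n\<bar>\<close> resp. \<open>\<bar>m\<bar>\<close> of them in each orbit.\<close>
lemma tau_image_free_orbits:
  assumes D: "D \<subseteq> C" and Db: "\<And>d k. d \<in> D \<Longrightarrow> \<beta> k d \<in> D" and Dt: "\<And>d. d \<in> D \<Longrightarrow> \<tau> True d \<in> D"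
    and free: "\<And>d k. d \<in> D \<Longrightarrow> \<beta> k d = d \<Longrightarrow> k = 0"
    and fin: "finite (orb ` D)" and mn: "\<bar>m\<bar> \<le> \<bar>n\<bar>" and d: "d \<in> D"
  shows "\<tau> False d \<in> D"
proof -
  define rp where "rp d = (SOME x. x \<in> D \<and> orb x = orb d)" for d
  have rp: "rp d \<in> D" "orb (rp d) = orb d" if "d \<in> D" for d
    using someI[of "\<lambda>x. x \<in> D \<and> orb x = orb d" d] that by (auto simp: rp_def)
  have rp_cong: "orb d = orb d' \<Longrightarrow> rp d = rp d'" for d d' by (simp add: rp_def)
  have "\<exists>k. d = \<beta> k (rp d)" if "d \<in> D" for d
  proof -
    have "d \<in> orb (rp d)" using orb_self[of d] rp[OF that] that D by blast
    then show ?thesis by (simp add: orb_def image_iff)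
  qed
  then obtain ex where ex: "\<And>d. d \<in> D \<Longrightarrow> d = \<beta> (ex d) (rp d)" by metis
  define Rp where "Rp = rp ` D"
  have "Rp = (\<lambda>o'. SOME x. x \<in> D \<and> orb x = o') ` (orb ` D)" by (auto simp: Rp_def rp_def image_image)
  then have finR: "finite Rp" using fin by simp
  have RD: "r \<in> D" if "r \<in> Rp" for r using that rp by (auto simp: Rp_def)
  have inC: "r \<in> C" if "r \<in> D" for r using that D by blast
  have rp_r: "rp (\<beta> i r) = r" if r: "r \<in> Rp" for r i
  proof -
    obtain d where d: "d \<in> D" "r = rp d" using r by (auto simp: Rp_def)
    have "orb (\<beta> i r) = orb d" using orb_eqI[OF inC[OF RD[OF r]]] rp(2)[OF d(1)] d(2) by simp
    then show ?thesis using rp_cong d(2) by blast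
  qed
  define S where "S = Rp \<times> {0..<\<bar>n\<bar>}"
  define S' where "S' = Rp \<times> {0..<\<bar>m\<bar>}"
  define \<phi> where "\<phi> = (\<lambda>(r, i). (rp (\<tau> True (\<beta> i r)), ex (\<tau> True (\<beta> i r)) mod \<bar>m\<bar>))"
  have sub: "\<phi> ` S \<subseteq> S'" using m0 RD Db Dt by (auto simp: \<phi>_def S_def S'_def Rp_def rp(1))
  have inj: "inj_on \<phi> S"
  proof (rule inj_onI)
    fix a b assume ab: "a \<in> S" "b \<in> S" "\<phi> a = \<phi> b"
    obtain r i r' i' where [simp]: "a = (r, i)" "b = (r', i')" by (cases a, cases b)
    let ?x = "\<tau> True (\<beta> i r)" and ?y = "\<tau> True (\<beta> i' r')"
    have rr: "r \<in> Rp" "r' \<in> Rp" and ii: "i \<in> {0..<\<bar>n\<bar>}" "i' \<in> {0..<\<bar>n\<bar>}" using ab by (auto simp: S_def)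
    note rD = rr[THEN RD] and rC = rr[THEN RD, THEN inC]
    have xy: "?x \<in> D" "?y \<in> D" using rD Db Dt by auto
    have eq: "rp ?x = rp ?y" "ex ?x mod \<bar>m\<bar> = ex ?y mod \<bar>m\<bar>" using ab(3) by (auto simp: \<phi>_def)
    then have "m dvd ex ?y - ex ?x" using mod_eq_dvd_iff[of "ex ?y" "\<bar>m\<bar>" "ex ?x"] by simp
    then obtain c where "ex ?y - ex ?x = m * c" ..
    then have c: "ex ?y = m * c + ex ?x" by simp
    have rpC: "rp ?x \<in> C" using rp(1)[OF xy(1)] inC by blast
    have "?y = \<beta> (m * c + ex ?x) (rp ?x)" using ex[OF xy(2)] eq(1) c by simp
    also have "\<dots> = \<beta> (m * c) ?x" using ex[OF xy(1)] beta_add[OF rpC, of "m * c" "ex ?x"] by simp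
    also have "\<dots> = \<tau> True (\<beta> (n * c + i) r)"
      using tau_beta_gen[of "\<beta> i r" True c] rC by (simp add: beta_beta)
    finally have e: "\<beta> i' r' = \<beta> (n * c + i) r" using rC by (simp add: tau_eq_iff)
    then have "r = r'" using rp_r rr by metis
    then have "\<beta> (n * c + i - i') r = r"
      using e rC by (simp add: beta_beta_eq_iff[symmetric])
    then have "n * c + i - i' = 0" using free rD by blast
    then have "i' = i + n * c" by simp
    then have "i' mod \<bar>n\<bar> = i mod \<bar>n\<bar>" by (simp add: mod_eq_dvd_iff)
    then have "i = i'" using ii by simp
    then show "a = b" using \<open>r = r'\<close> by simp
  qed
  have "card S' \<le> card S"
    using mn by (simp add: S_def S'_def card_cartesian_product nat_mono)
  then have "card S' \<le> card (\<phi> ` S)" by (simp add: card_image[OF inj])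
  then have surj: "\<phi> ` S = S'" using sub finR by (intro card_seteq) (auto simp: S'_def)
  have "(rp d, ex d mod \<bar>m\<bar>) \<in> S'" using d m0 by (auto simp: S'_def Rp_def)
  then obtain r i where ri: "r \<in> Rp" "\<phi> (r, i) = (rp d, ex d mod \<bar>m\<bar>)"
    unfolding surj[symmetric] S_def by force
  let ?x = "\<tau> True (\<beta> i r)"
  note rC = RD[OF ri(1), THEN inC]
  have x: "?x \<in> D" using ri Db Dt RD by auto
  have eq: "rp ?x = rp d" "ex d mod \<bar>m\<bar> = ex ?x mod \<bar>m\<bar>" using ri(2) by (auto simp: \<phi>_def)
  then have "m dvd ex d - ex ?x" using mod_eq_dvd_iff[of "ex d" "\<bar>m\<bar>" "ex ?x"] by simp
  then obtain c where "ex d - ex ?x = m * c" ..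
  then have c: "ex d = m * c + ex ?x" by simp
  have "d = \<beta> (m * c + ex ?x) (rp ?x)" using ex[OF d] eq(1) c by simp
  also have "\<dots> = \<beta> (m * c) ?x" using ex[OF x] beta_add[OF inC[OF rp(1)[OF x]], of "m * c" "ex ?x"] by simp
  also have "\<dots> = \<tau> True (\<beta> (n * c) (\<beta> i r))"
    using tau_beta_gen[of "\<beta> i r" True c] rC by simp
  finally have "\<tau> False d = \<beta> (n * c) (\<beta> i r)" using rC by simp
  then show ?thesis using Db RD ri(1) by simp
qed

lemma positive_word_escapes:
  assumes A: "A \<subseteq> C" and fin: "finite (orb ` A)" and a: "a \<in> A" and inf: "\<not> fin_cover \<beta> \<tau> a"
    and per: "(\<exists>k. k \<noteq> 0 \<and> \<beta> k a = a) \<or> (\<bar>m\<bar> \<le> \<bar>n\<bar> \<and> (\<forall>k. \<beta> k a = a \<longrightarrow> k = 0))"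
  shows "\<exists>w. posw w \<and> run \<beta> \<tau> w a \<notin> A"
proof (rule ccontr)
  assume neg: "\<not> ?thesis"
  define D where "D = {run \<beta> \<tau> w a |w. posw w}"
  have aC: "a \<in> C" using a A by blast
  have DA: "D \<subseteq> A" using neg by (auto simp: D_def)
  have DC: "d \<in> C" if "d \<in> D" for d using that DA A by blast
  have Drun: "run \<beta> \<tau> w d \<in> D" if dD: "d \<in> D" and w: "posw w" for d w
  proof -
    obtain u where "posw u" "d = run \<beta> \<tau> u a" using dD by (auto simp: D_def)
    then have "posw (u @ w) \<and> run \<beta> \<tau> w d = run \<beta> \<tau> (u @ w) a" using w by simp
    then show ?thesis unfolding D_def by blast
  qed
  have Db: "\<beta> k d \<in> D" if "d \<in> D" for d k using Drun[OF that, of "bpow k"] DC[OF that] by simp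
  have Dt: "\<tau> True d \<in> D" if "d \<in> D" for d using Drun[OF that, of "[(GT,True)]"] by (simp add: posw_def)
  have finD: "finite (orb ` D)" using fin DA by (meson finite_subset image_mono)
  have Dti: "\<tau> False d \<in> D" if d: "d \<in> D" for d
    using per
  proof (elim disjE conjE)
    assume "\<exists>k. k \<noteq> 0 \<and> \<beta> k a = a"
    then have "\<exists>k. k \<noteq> 0 \<and> \<beta> k d = d" if "d \<in> D" for d
      using that nonzero_period_run[OF aC] unfolding D_def by blast
    then have "finite (orb d)" if "d \<in> D" for d using that finite_orb DC[OF that] by blast
    moreover have "D \<subseteq> \<Union> (orb ` D)" using orb_self DC by blast
    ultimately have "finite D" using finD by (auto intro: finite_subset[of D "\<Union> (orb ` D)"])
    moreover have "inj_on (\<tau> True) D" by (rule inj_onI) (use DC tau_eq_iff in blast)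
    ultimately have "\<tau> True ` D = D" using Dt by (intro endo_inj_surj) auto
    then obtain d' where "d' \<in> D" "d = \<tau> True d'" using d by blast
    then show ?thesis using DC by simp
  next
    assume mn: "\<bar>m\<bar> \<le> \<bar>n\<bar>" and fr: "\<forall>k. \<beta> k a = a \<longrightarrow> k = 0"
    have frD: "k = 0" if "d \<in> D" "\<beta> k d = d" for d k
      using that zero_period_run[OF aC fr] unfolding D_def by blast
    show ?thesis
      by (rule tau_image_free_orbits[OF _ Db Dt frD finD mn d]) (use DC in auto)
  qed
  have all: "run \<beta> \<tau> w d \<in> D" if "d \<in> D" for w d
    using that
  proof (induction w arbitrary: d)
    case (Cons l w)
    obtain g e where l: "l = (g, e)" by (cases l)
    have "lact \<beta> \<tau> l d \<in> D" using Cons.prems Db Dt Dti by (cases g; cases e) (simp_all add: l)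
    then show ?case using Cons.IH by simp
  qed simp
  obtain F where F: "finite F" "F \<subseteq> D" "orb ` D = orb ` F"
    using finite_subset_image[OF finD order_refl] by blast
  have "a = run \<beta> \<tau> [] a \<and> posw []" by (simp add: posw_def)
  then have aD: "a \<in> D" unfolding D_def by blast
  have "\<exists>v. f = run \<beta> \<tau> v a" if "f \<in> F" for f using that F(2) unfolding D_def by blast
  then obtain wd where wd: "\<And>f. f \<in> F \<Longrightarrow> f = run \<beta> \<tau> (wd f) a" by metis
  have "\<exists>f\<in>F. \<exists>k. run \<beta> \<tau> w a = \<beta> k f" for w
  proof -
    have "orb (run \<beta> \<tau> w a) \<in> orb ` F" using all[OF aD] F(3) by blast
    then obtain f where "f \<in> F" "orb (run \<beta> \<tau> w a) = orb f" by blast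
    then show ?thesis using orb_self[of "run \<beta> \<tau> w a"] aC by (auto simp: orb_def)
  qed
  then have "\<exists>u\<in>wd ` F. \<exists>k. run \<beta> \<tau> w a = \<beta> k (run \<beta> \<tau> u a)" for w using wd by (metis imageI)
  then have "fin_cover \<beta> \<tau> a" unfolding fin_cover_def using F(1) by (meson finite_imageI)
  then show False using inf by contradiction
qed

lemma same_ph_tau:
  assumes x: "x \<in> C" and L: "has_per \<beta> x L" and L': "has_per \<beta> (\<tau> True x) L'"
  shows "same_ph m n L L'"
proof -
  have "int L dvd n * k \<longleftrightarrow> int L' dvd m * k" for k
    using tau_beta_gen[OF x, of True k] L L' x unfolding has_per_def
    by (metis Ca_simps(1) Mo_simps(1) beta_closed tau_eq_iff)
  then have "int (nper n 1 L) dvd k \<longleftrightarrow> int (nper m 1 L') dvd k" for k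
    using m0 n0 by (simp add: nper_dvd_iff)
  then have eq: "nper n 1 L = nper m 1 L'" by (metis dvd_antisym dvd_refl int_dvd_int_iff)
  have zero: "L = 0 \<longleftrightarrow> L' = 0" using eq nper_pos[of L 1 n] nper_pos[of L' 1 m] by fastforce
  show ?thesis
  proof (cases "L = 0")
    case False
    have "max (multiplicity p L) (pval p n) - pval p n = max (multiplicity p L') (pval p m) - pval p m"
      if "prime p" for p
      using multiplicity_nper[of p L n 1] multiplicity_nper[of p L' m 1] that False zero eq m0 n0
      by (simp add: pval_def)
    then show ?thesis unfolding same_ph_def using zero by (metis le_add_diff_inverse2 max.cobounded2)
  qed (use zero in \<open>simp add: same_ph_def\<close>)
qed

lemma same_ph_run:
  assumes "x \<in> C" and "has_per \<beta> x L" and "has_per \<beta> (run \<beta> \<tau> w x) L'"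
  shows "same_ph m n L L'"
  using assms
proof (induction w arbitrary: x L)
  case Nil
  then have "L = L'" by (simp add: has_per_unique)
  then show ?case by (simp add: same_ph_def)
next
  case (Cons l w)
  let ?y = "lact \<beta> \<tau> l x"
  obtain K where K: "has_per \<beta> ?y K" using has_per_exists Cons.prems(1) by (meson lact_closed)
  have "same_ph m n L K"
  proof (cases "fst l")
    case GB
    then obtain e where "l = (GB, e)" by (cases l) auto
    then have "L = K" using K Cons.prems by (simp add: has_per_beta has_per_unique)
    then show ?thesis by (simp add: same_ph_def)
  next
    case GT
    then obtain e where l: "l = (GT, e)" by (cases l) auto
    show ?thesis
    proof (cases e)
      case True
      then show ?thesis using same_ph_tau Cons.prems K l by simp
    next
      case False
      then have "same_ph m n K L" using same_ph_tau[of ?y K L] Cons.prems K l by simp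
      then show ?thesis by (simp add: same_ph_def)
    qed
  qed
  moreover have "same_ph m n K L'" using Cons.IH[OF _ K] Cons.prems by simp
  ultimately show ?case by (simp add: same_ph_def)
qed

lemma fin_cover_run:
  assumes "x \<in> C" shows "fin_cover \<beta> \<tau> (run \<beta> \<tau> u x) \<longleftrightarrow> fin_cover \<beta> \<tau> x"
proof -
  have *: "fin_cover \<beta> \<tau> (run \<beta> \<tau> u x)" if fc: "fin_cover \<beta> \<tau> x" and x: "x \<in> C" for u x
  proof -
    obtain U where U: "finite U" "\<And>w. \<exists>v\<in>U. \<exists>k. run \<beta> \<tau> w x = \<beta> k (run \<beta> \<tau> v x)"
      using fc unfolding fin_cover_def by blast
    have "run \<beta> \<tau> v x = run \<beta> \<tau> (winv u @ v) (run \<beta> \<tau> u x)" for v using x by simp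
    then have "\<exists>v\<in>(\<lambda>v. winv u @ v) ` U. \<exists>k. run \<beta> \<tau> w (run \<beta> \<tau> u x) = \<beta> k (run \<beta> \<tau> v (run \<beta> \<tau> u x))" for w
      using U(2)[of "u @ w"] by (metis fold_append comp_apply imageI)
    then show ?thesis unfolding fin_cover_def using U(1) by (meson finite_imageI)
  qed
  show ?thesis using * *[of "run \<beta> \<tau> u x" "winv u"] assms by auto
qed

lemma avoid_if_prefixes:
  "(\<And>i. i \<le> length w \<Longrightarrow> run \<beta> \<tau> (take i w) x \<notin> K) \<Longrightarrow> avoid K w x"
proof (induction w arbitrary: x)
  case (Cons l w)
  have "x \<notin> K" using Cons.prems[of 0] by simp
  moreover have "run \<beta> \<tau> (take i w) (lact \<beta> \<tau> l x) \<notin> K" if "i \<le> length w" for i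
    using Cons.prems[of "Suc i"] that by simp
  ultimately show ?case using Cons.IH[of "lact \<beta> \<tau> l x"]
      Cons.prems[of 1] by auto
qed simp

end

subsection \<open>Free extension of a partial action\<close>

text \<open>\<open>Up e j x\<close> stands for \<open>x t b\<^sup>j\<close> or, if \<open>e\<close> is false, \<open>x t\<^sup>-\<^sup>1 b\<^sup>j\<close>, where \<open>j\<close> is a residue modulo \<open>m\<close> resp. \<open>n\<close>.\<close>
datatype 'a pt = Base 'a | Up bool int "'a pt"

primrec height :: "'a pt \<Rightarrow> nat" where
  "height (Base a) = 0"
| "height (Up e j x) = Suc (height x)"

primrec root :: "'a pt \<Rightarrow> 'a" where
  "root (Base a) = a"
| "root (Up e j x) = root x"

primrec signs :: "'a pt \<Rightarrow> bool list" where
  "signs (Base a) = []"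
| "signs (Up e j x) = e # signs x"

fun top_index :: "'a pt \<Rightarrow> int" where
  "top_index (Up e j x) = j"
| "top_index (Base a) = 0"

lemma height_Up_funpow [simp]: "height ((Up e j ^^ k) x) = k + height x"
  by (induction k) auto

lemma root_Up_funpow [simp]: "root ((Up e j ^^ k) x) = root x"
  by (induction k) auto

locale bs_forest = bs_action +
  fixes A :: "'a set"
  assumes A_sub: "A \<subseteq> C" and A_beta: "a \<in> A \<Longrightarrow> \<beta> k a \<in> A"
begin

primrec wb :: "int \<Rightarrow> 'a pt \<Rightarrow> 'a pt" where
  "wb k (Base a) = Base (\<beta> k a)"
| "wb k (Up e j x) = Up e ((j + k) mod Mo e) (wb (Ca e * ((j + k) div Mo e)) x)"

definition inner :: "bool \<Rightarrow> 'a \<Rightarrow> bool" where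
  "inner e a \<longleftrightarrow> a \<in> A \<and> \<tau> e a \<in> A"

fun free :: "bool \<Rightarrow> 'a pt \<Rightarrow> bool" where
  "free e (Base a) \<longleftrightarrow> \<not> inner e a"
| "free e (Up e' j x) \<longleftrightarrow> e = e' \<or> j \<noteq> 0"

fun wt :: "bool \<Rightarrow> 'a pt \<Rightarrow> 'a pt" where
  "wt e (Base a) = (if inner e a then Base (\<tau> e a) else Up e 0 (Base a))"
| "wt e (Up e' j x) = (if e = e' \<or> j \<noteq> 0 then Up e 0 (Up e' j x) else x)"

primrec valid :: "'a pt \<Rightarrow> bool" where
  "valid (Base a) \<longleftrightarrow> a \<in> C"
| "valid (Up e j x) \<longleftrightarrow> j mod Mo e = j \<and> valid x \<and> free e x"

lemma wt_free [simp]: "free e x \<Longrightarrow> wt e x = Up e 0 x"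
  by (cases x) auto

lemma height_wb [simp]: "height (wb k x) = height x"
  by (induction x arbitrary: k) auto

lemma signs_wb [simp]: "signs (wb k x) = signs x"
  by (induction x arbitrary: k) auto

lemma inner_beta:
  assumes "a \<in> C" shows "inner e (\<beta> (Ca e * k) a) \<longleftrightarrow> inner e a"
proof -
  have *: "inner e (\<beta> (Ca e * k) a)" if "inner e a" for a k
    using that A_beta A_sub tau_beta_gen[of a e k] by (auto simp: inner_def)
  have "\<beta> (Ca e * (- k)) (\<beta> (Ca e * k) a) = a" using assms by simp
  then show ?thesis using * by metis
qed

lemma free_wb: "valid x \<Longrightarrow> free e (wb (Ca e * k) x) \<longleftrightarrow> free e x"
proof (cases x)
  case (Up e' j y)
  assume v: "valid x"
  show ?thesis
  proof (cases "e = e'")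
    case False
    then have "Mo e' = Ca e" by (cases e; cases e') auto
    then show ?thesis using v Up by simp
  qed (use Up in simp)
qed (simp add: inner_beta)

lemma valid_wb [simp]: "valid x \<Longrightarrow> valid (wb k x)"
  by (induction x arbitrary: k) (auto simp: free_wb)

lemma wb_0: "valid x \<Longrightarrow> wb 0 x = x"
proof (induction x)
  case (Up e j x)
  then have "j div Mo e = 0" by (metis Mo_neq_0 div_mult_mod_eq add_cancel_left_left mult_eq_0_iff valid.simps(2))
  then show ?case using Up by simp
qed simp

lemma wb_add: "valid x \<Longrightarrow> wb (i + k) x = wb i (wb k x)"
proof (induction x arbitrary: i k)
  case (Base a)
  then show ?case by (simp add: beta_add)
next
  case (Up e j x)
  let ?M = "Mo e"
  have d: "(j + (i + k)) div ?M = ((j + k) mod ?M + i) div ?M + (j + k) div ?M"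
  proof -
    have "j + (i + k) = ((j + k) mod ?M + i) + (j + k) div ?M * ?M"
      by (simp add: algebra_simps)
    then have "(j + (i + k)) div ?M = (((j + k) mod ?M + i) + (j + k) div ?M * ?M) div ?M"
      by (rule arg_cong)
    also have "\<dots> = (j + k) div ?M + ((j + k) mod ?M + i) div ?M" by (rule div_mult_self1) simp
    finally show ?thesis by (simp only: add.commute)
  qed
  have "wb (Ca e * ((j + (i + k)) div ?M)) x =
    wb (Ca e * (((j + k) mod ?M + i) div ?M)) (wb (Ca e * ((j + k) div ?M)) x)"
    unfolding d distrib_left by (rule Up.IH) (use Up.prems in simp)
  moreover have "(j + (i + k)) mod ?M = ((j + k) mod ?M + i) mod ?M"
    by (simp add: mod_add_left_eq ac_simps mod_add_right_eq)
  ultimately show ?case by simp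
qed

lemma wt_inv:
  assumes "valid x" shows "wt (\<not> e) (wt e x) = x"
proof (cases "free e x")
  case False
  then show ?thesis
  proof (cases x)
    case (Base a)
    then have "inner e a" "a \<in> C" using False assms by auto
    then have "inner (\<not> e) (\<tau> e a)" "\<tau> (\<not> e) (\<tau> e a) = a"
      using tau_inv by (auto simp: inner_def)
    then show ?thesis using Base \<open>inner e a\<close> by simp
  next
    case (Up e' j y)
    then have e: "e' = (\<not> e)" "j = 0" using False by auto
    then have "free (\<not> e) y" using assms Up by simp
    then show ?thesis using Up e by simp
  qed
qed simp

lemma valid_wt:
  assumes "valid x" shows "valid (wt e x)"
proof (cases "free e x")
  case False
  then show ?thesis using assms by (cases x) (auto simp: inner_def)
qed (use assms in simp)

lemma wt_wb:
  assumes "valid x" shows "wt e (wb (Ca e * k) x) = wb (Mo e * k) (wt e x)"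
proof (cases "free e x")
  case True
  then show ?thesis using assms by (simp add: free_wb)
next
  case False
  show ?thesis
  proof (cases x)
    case (Base a)
    then show ?thesis using False assms inner_beta[of a e k] by (simp add: tau_beta_gen)
  next
    case (Up e' j y)
    then have "e' = (\<not> e)" "j = 0" using False by auto
    then show ?thesis using Up by simp
  qed
qed

sublocale W: bs_action m n "Collect valid" wb wt
proof
  fix x assume "x \<in> Collect valid"
  then show "wt True (wb n x) = wb m (wt True x)" using wt_wb[of x True 1] by simp
qed (auto simp: m0 n0 wb_0 wb_add valid_wt wt_inv)

lemma has_per_Base: "has_per wb (Base a) L \<longleftrightarrow> has_per \<beta> a L"
  by (simp add: has_per_def)

lemma has_per_Up:
  assumes v: "valid (Up e j x)" and L: "has_per wb x L"
  shows "has_per wb (Up e j x) (nper (Ca e) (Mo e) L)"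
  unfolding has_per_def
proof
  fix k
  have jm: "j mod Mo e = j" using v by simp
  then have jd: "j div Mo e = 0" by (metis Mo_neq_0 div_mult_mod_eq add_cancel_left_left mult_eq_0_iff)
  have "(j + k) mod Mo e = j \<longleftrightarrow> Mo e dvd k"
    using jm mod_eq_dvd_iff[of "j + k" "Mo e" j] by simp
  moreover have "(j + k) div Mo e = k div Mo e" if "Mo e dvd k"
    using that jd by (simp add: div_plus_div_distrib_dvd_right)
  moreover have "wb i x = x \<longleftrightarrow> int L dvd i" for i using L by (simp add: has_per_def)
  ultimately show "wb k (Up e j x) = Up e j x \<longleftrightarrow> int (nper (Ca e) (Mo e) L) dvd k"
    by (cases "Mo e dvd k") (simp_all add: nper_dvd_iff)
qed

lemma has_per_Up_funpow:
  assumes "valid x" "free e x" "has_per wb x L"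
  shows "valid ((Up e 0 ^^ k) x) \<and> free e ((Up e 0 ^^ k) x) \<and>
     has_per wb ((Up e 0 ^^ k) x) ((nper (Ca e) (Mo e) ^^ k) L)"
  using assms by (induction k) (auto intro: has_per_Up simp del: wb.simps)

lemma wt_funpow: "free e x \<Longrightarrow> (wt e ^^ k) x = (Up e 0 ^^ k) x \<and> free e ((Up e 0 ^^ k) x)"
  by (induction k) auto

lemma run_replicate_GT:
  "free e x \<Longrightarrow> run wb wt (replicate k (GT, e)) x = (Up e 0 ^^ k) x"
proof -
  have "lact wb wt (GT, e) = wt e" by auto
  then show "free e x \<Longrightarrow> ?thesis" using wt_funpow by simp
qed

lemma not_fin_cover_if_heights:
  assumes "\<And>k. \<exists>w. height (run wb \<tau>' w x) \<ge> k"
  shows "\<not> fin_cover wb \<tau>' x"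
proof
  assume "fin_cover wb \<tau>' x"
  then obtain U where U: "finite U" "\<And>w. \<exists>u\<in>U. \<exists>k. run wb \<tau>' w x = wb k (run wb \<tau>' u x)"
    unfolding fin_cover_def by blast
  define F where "F = (\<lambda>u. run wb \<tau>' u x) ` U"
  obtain w where w: "height (run wb \<tau>' w x) \<ge> Suc (Max (height ` F))" using assms by blast
  obtain f k where "f \<in> F" "run wb \<tau>' w x = wb k f" using U(2)[of w] by (auto simp: F_def)
  then have "height (run wb \<tau>' w x) \<le> Max (height ` F)" using U(1) by (simp add: F_def)
  then show False using w by simp
qed

fun asc :: "word \<Rightarrow> 'a pt \<Rightarrow> bool" where
  "asc [] x = True"
| "asc (l # w) x \<longleftrightarrow> height x \<le> height (lact wb wt l x) \<and> asc w (lact wb wt l x)"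

lemma asc_append: "asc (u @ v) x \<longleftrightarrow> asc u x \<and> asc v (run wb wt u x)"
  by (induction u arbitrary: x) auto

lemma asc_height: "asc w x \<Longrightarrow> height x \<le> height (run wb wt w x)"
  by (induction w arbitrary: x) force+

lemma asc_prefix: "asc w x \<Longrightarrow> height (run wb wt (take i w) x) \<le> height (run wb wt w x)"
  by (metis append_take_drop_id asc_append asc_height fold_append comp_apply)

lemma asc_replicate_GT: "free e x \<Longrightarrow> asc (replicate k (GT, e)) x"
  by (induction k arbitrary: x) auto

definition pos_pt :: "'a pt \<Rightarrow> bool" where
  "pos_pt x \<longleftrightarrow> False \<notin> set (signs x)"

lemma pos_pt_step:
  assumes "pos_pt x" "l \<noteq> (GT, False)"
  shows "pos_pt (lact wb wt l x) \<and> height x \<le> height (lact wb wt l x)"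
proof (cases "(wb, wt, l, x)" rule: lact.cases)
  case (2 b t e y)
  then have "l = (GT, True)" using assms by auto
  then show ?thesis using assms(1) by (cases x) (auto simp: pos_pt_def)
qed (use assms in \<open>auto simp: pos_pt_def\<close>)

lemma pos_pt_run: "pos_pt x \<Longrightarrow> posw w \<Longrightarrow> pos_pt (run wb wt w x) \<and> asc w x"
proof (induction w arbitrary: x)
  case (Cons l w)
  then have "l \<noteq> (GT, False)" "posw w" by (auto simp: posw_def)
  then show ?case using Cons pos_pt_step by auto
qed simp

lemma pos_pt_free: "pos_pt x \<Longrightarrow> height x > 0 \<Longrightarrow> free True x"
  by (cases x) (auto simp: pos_pt_def)

lemma run_Base_prefixes:
  "(\<And>i. i \<le> length w \<Longrightarrow> run \<beta> \<tau> (take i w) a \<in> A) \<Longrightarrow> run wb wt w (Base a) = Base (run \<beta> \<tau> w a)"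
proof (induction w arbitrary: a)
  case (Cons l w)
  let ?b = "lact \<beta> \<tau> l a"
  have "a \<in> A" using Cons.prems[of 0] by simp
  moreover have "?b \<in> A" using Cons.prems[of 1] by simp
  ultimately have "lact wb wt l (Base a) = Base ?b"
    by (cases "(\<beta>, \<tau>, l, a)" rule: lact.cases) (auto simp: inner_def)
  moreover have "run \<beta> \<tau> (take i w) ?b \<in> A" if "i \<le> length w" for i
    using Cons.prems[of "Suc i"] that by simp
  ultimately show ?case using Cons.IH[of ?b] by simp
qed simp

lemma run_positive_height_0:
  assumes "a \<in> A" "posw w" "height (run wb wt w (Base a)) = 0"
  shows "run wb wt w (Base a) = Base (run \<beta> \<tau> w a) \<and> run \<beta> \<tau> w a \<in> A"
  using assms(2,3)
proof (induction w rule: rev_induct)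
  case (snoc l w)
  have pw: "posw w" "l \<noteq> (GT, False)" using snoc.prems by (auto simp: posw_def)
  let ?x = "run wb wt w (Base a)"
  have "asc (w @ [l]) (Base a)"
    using pos_pt_run[of "Base a" "w @ [l]"] snoc.prems by (simp add: pos_pt_def)
  then have "height ?x \<le> height (run wb wt (w @ [l]) (Base a))" by (simp add: asc_append)
  then have "height ?x = 0" using snoc.prems by simp
  then have IH: "?x = Base (run \<beta> \<tau> w a)" "run \<beta> \<tau> w a \<in> A" using snoc.IH pw by auto
  show ?case
  proof (cases "fst l")
    case GB
    then obtain e where "l = (GB, e)" by (cases l) auto
    then show ?thesis using IH A_beta by simp
  next
    case GT
    then have l: "l = (GT, True)" using pw by (cases l) auto
    then have "inner True (run \<beta> \<tau> w a)" using snoc.prems(2) IH by (auto split: if_splits)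
    then show ?thesis using IH l by (simp add: inner_def)
  qed
qed (use assms(1) in simp)

lemma common_escape:
  assumes esc: "\<And>a. a \<in> A \<Longrightarrow> \<exists>w. posw w \<and> run \<beta> \<tau> w a \<notin> A" and "finite Q" "Q \<subseteq> A"
  shows "\<exists>g. posw g \<and> (\<forall>a\<in>Q. height (run wb wt g (Base a)) > 0)"
  using assms(2,3)
proof (induction Q rule: finite_induct)
  case empty
  then show ?case by (auto intro: exI[of _ "[]"] simp: posw_def)
next
  case (insert a Q)
  then obtain g where g: "posw g" "\<forall>a\<in>Q. height (run wb wt g (Base a)) > 0" by auto
  have more: "height (run wb wt (g @ w) (Base b)) > 0"
    if "posw w" "height (run wb wt g (Base b)) > 0" for b w
  proof -
    have "asc (g @ w) (Base b)"
      using pos_pt_run[of "Base b" "g @ w"] that g(1) by (simp add: pos_pt_def)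
    then have "asc w (run wb wt g (Base b))" by (simp add: asc_append)
    from asc_height[OF this] that(2) show ?thesis by simp
  qed
  show ?case
  proof (cases "height (run wb wt g (Base a)) > 0")
    case False
    then have *: "run wb wt g (Base a) = Base (run \<beta> \<tau> g a)" "run \<beta> \<tau> g a \<in> A"
      using run_positive_height_0[of a g] insert.prems g(1) by auto
    then obtain w where w: "posw w" "run \<beta> \<tau> w (run \<beta> \<tau> g a) \<notin> A" using esc by blast
    have "height (run wb wt w (Base (run \<beta> \<tau> g a))) > 0"
      using run_positive_height_0[OF *(2) w(1)] w(2) by auto
    then have "height (run wb wt (g @ w) (Base a)) > 0" using *(1) by simp
    then show ?thesis using more g w(1) by (intro exI[of _ "g @ w"]) (simp del: fold_append)
  qed (use g in auto)
qed

definition lead_word :: "word \<Rightarrow> nat \<Rightarrow> word" where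
  "lead_word g N = g @ replicate N (GT, True) @ [(GB, True)]"

lemma run_lead_word:
  assumes a: "a \<in> C" and g: "posw g" "height (run wb wt g (Base a)) > 0" and N: "N \<ge> 1"
    and m2: "\<bar>m\<bar> \<ge> 2" and L: "has_per wb (run wb wt g (Base a)) L"
  obtains j x where "run wb wt (lead_word g N) (Base a) = Up True j x" "j \<noteq> 0"
    "has_per wb (Up True j x) ((nper n m ^^ N) L)" "asc (lead_word g N) (Base a)" "valid (Up True j x)"
proof -
  let ?y = "run wb wt g (Base a)"
  have vb: "Base a \<in> Collect valid" using a by simp
  have p: "pos_pt ?y" "asc g (Base a)" using pos_pt_run[of "Base a" g] g by (auto simp: pos_pt_def)
  have y: "valid ?y" "free True ?y" using W.run_closed[OF vb] pos_pt_free[OF p(1) g(2)] by auto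
  let ?z = "(Up True 0 ^^ N) ?y"
  have z: "valid ?z" "has_per wb ?z ((nper n m ^^ N) L)" using has_per_Up_funpow[OF y L, of N] by auto
  have rz: "run wb wt (replicate N (GT, True)) ?y = ?z" using run_replicate_GT[OF y(2)] .
  obtain N' where N': "N = Suc N'" using N by (cases N) auto
  define x where "x = wb (n * (1 div m)) ((Up True 0 ^^ N') ?y)"
  have wz: "wb 1 ?z = Up True (1 mod m) x" by (simp add: N' x_def)
  have "1 mod m \<noteq> 0" using m2 by (auto simp: mod_eq_0_iff_dvd zdvd1_eq)
  moreover have "run wb wt (lead_word g N) (Base a) = Up True (1 mod m) x"
    using rz wz by (simp add: lead_word_def del: fold_replicate)
  moreover have "has_per wb (Up True (1 mod m) x) ((nper n m ^^ N) L)"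
    using z W.has_per_beta[of ?z 1] unfolding wz[symmetric] by simp
  moreover have "asc (lead_word g N) (Base a)"
    using p(2) asc_replicate_GT[OF y(2)] rz by (simp add: lead_word_def asc_append del: fold_replicate)
  moreover have "valid (Up True (1 mod m) x)" unfolding wz[symmetric] using z(1) by simp
  ultimately show ?thesis using that by blast
qed

lemma cls_invariants: "y \<in> W.cls x \<Longrightarrow> height y = height x \<and> signs y = signs x"
  by (auto simp: W.cls_def)

lemma cls_top_index:
  assumes "valid (Up False j x)" "y \<in> W.cls (Up False j x)" shows "top_index y = j"
  using assms by (auto simp: W.cls_def)

end

subsection \<open>Joining two points by switching edges\<close>

definition link_word :: "word \<Rightarrow> nat \<Rightarrow> word" where
  "link_word u M = (u @ replicate M (GT, False) @ [(GB, True)]) @ [(GT, True)]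
     @ winv (u @ replicate (M - 1) (GT, False))"

lemma one_mod_neq_0: "\<bar>k\<bar> \<ge> 2 \<Longrightarrow> 1 mod k \<noteq> (0::int)"
  by (auto simp: mod_eq_0_iff_dvd zdvd1_eq)

context bs_forest begin

lemma lab_root_wb:
  assumes "\<And>a k. a \<in> C \<Longrightarrow> lab (\<beta> k a) = lab a" and "valid x"
  shows "lab (root (wb k x)) = lab (root x)"
  using assms(2) by (induction x arbitrary: k) (auto simp: assms(1))

lemma lab_root_run:
  assumes b: "\<And>a k. a \<in> C \<Longrightarrow> lab (\<beta> k a) = lab a" and t: "\<And>a e. a \<in> C \<Longrightarrow> lab (\<tau> e a) = lab a"
    and "valid x"
  shows "lab (root (run wb wt w x)) = lab (root x)"
  using assms(3)
proof (induction w arbitrary: x)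
  case (Cons l w)
  have t': "lab (root (wt e x)) = lab (root x)" for e using Cons.prems t by (cases x) auto
  have "lab (root (lact wb wt l x)) = lab (root x)"
    using lab_root_wb[OF b Cons.prems] t' by (cases "(wb, wt, l, x)" rule: lact.cases) auto
  then show ?case using Cons.IH[of "lact wb wt l x"] Cons.prems W.lact_closed[of x l] by simp
qed simp

lemma avoid_run_Base:
  assumes K: "\<And>k. k \<in> K \<Longrightarrow> height k > 0" and w: "\<And>i. i \<le> length w \<Longrightarrow> run \<beta> \<tau> (take i w) a \<in> A"
  shows "W.avoid K w (Base a)"
proof (rule W.avoid_if_prefixes)
  fix i assume i: "i \<le> length w"
  have "run wb wt (take i w) (Base a) = Base (run \<beta> \<tau> (take i w) a)"
  proof (rule run_Base_prefixes)
    fix j assume "j \<le> length (take i w)"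
    then show "run \<beta> \<tau> (take j (take i w)) a \<in> A" using w[of "min j i"] i by simp
  qed
  then show "run wb wt (take i w) (Base a) \<notin> K" using K by fastforce
qed

lemma height_lead_tail:
  assumes x: "run wb wt u (Base a) = Up True j x" "j \<noteq> 0" and asc: "asc u (Base a)" and M: "M \<ge> 1"
  shows "height (run wb wt (take i (u @ replicate k (GT, False))) (Base a)) < Suc (height x) + M \<or>
    (\<exists>k'\<ge>M. run wb wt (take i (u @ replicate k (GT, False))) (Base a) = (Up False 0 ^^ k') (Up True j x))"
proof (cases "i \<le> length u")
  case True
  have "height (run wb wt (take i u) (Base a)) \<le> Suc (height x)" using asc_prefix[OF asc, of i] x by simp
  then show ?thesis using True M by simp
next
  case False
  define k' where "k' = min (i - length u) k"
  have "take i (u @ replicate k (GT, False)) = u @ replicate k' (GT, False)"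
    using False by (simp add: k'_def take_replicate)
  then have r: "run wb wt (take i (u @ replicate k (GT, False))) (Base a) = (Up False 0 ^^ k') (Up True j x)"
    using x run_replicate_GT[of False "Up True j x" k'] by (simp del: fold_replicate)
  show ?thesis
  proof (cases "k' < M")
    case True
    then show ?thesis unfolding r by simp
  next
    case False
    then show ?thesis using r by (metis not_less)
  qed
qed

lemma forest_switch:
  fixes lab :: "'a \<Rightarrow> 'l"
  assumes m2: "\<bar>m\<bar> \<ge> 2" and n2: "\<bar>n\<bar> \<ge> 2"
    and lab: "\<And>a k. a \<in> C \<Longrightarrow> lab (\<beta> k a) = lab a" "\<And>a e. a \<in> C \<Longrightarrow> lab (\<tau> e a) = lab a"
    and A: "a \<in> A" "b \<in> A" and ab: "lab a \<noteq> lab b"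
    and g: "posw g" "height (run wb wt g (Base a)) > 0" "height (run wb wt g (Base b)) > 0"
    and N: "N \<ge> 1" and M: "M \<ge> 1"
    and L: "has_per wb (run wb wt g (Base a)) L" "has_per wb (run wb wt g (Base b)) L'"
    and LL: "(nper m n ^^ M) ((nper n m ^^ N) L) = (nper m n ^^ M) ((nper n m ^^ N) L')"
  shows "\<exists>\<tau>'. bs_action m n (Collect valid) wb \<tau>' \<and> \<not> fin_cover wb \<tau>' (Base a) \<and>
     run wb \<tau>' (link_word (lead_word g N) M) (Base a) = Base b \<and>
     (\<forall>c\<in>{a, b}. \<forall>w. (\<forall>i\<le>length w. run \<beta> \<tau> (take i w) c \<in> A) \<longrightarrow>
        run wb \<tau>' w (Base c) = Base (run \<beta> \<tau> w c))"
proof -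
  let ?u = "lead_word g N"
  let ?Ti = "\<lambda>k. replicate k (GT, False)"
  have AC: "a \<in> C" "b \<in> C" using A A_sub by auto
  obtain j x where x: "run wb wt ?u (Base a) = Up True j x" "j \<noteq> 0"
    "has_per wb (Up True j x) ((nper n m ^^ N) L)" "asc ?u (Base a)" "valid (Up True j x)"
    using run_lead_word[OF AC(1) g(1,2) N m2 L(1)] .
  obtain j' y where y: "run wb wt ?u (Base b) = Up True j' y" "j' \<noteq> 0"
    "has_per wb (Up True j' y) ((nper n m ^^ N) L')" "asc ?u (Base b)" "valid (Up True j' y)"
    using run_lead_word[OF AC(2) g(1,3) N m2 L(2)] .
  define X where "X k = (Up False 0 ^^ k) (Up True j x)" for k
  define Y where "Y k = (Up False 0 ^^ k) (Up True j' y)" for k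
  have X: "run wb wt (?u @ ?Ti k) (Base a) = X k" "valid (X k)" "has_per wb (X k) ((nper m n ^^ k) ((nper n m ^^ N) L))"
    "lab (root (X k)) = lab a" for k
  proof -
    show r: "run wb wt (?u @ ?Ti k) (Base a) = X k"
      using x run_replicate_GT[of False "Up True j x" k] by (simp add: X_def del: fold_replicate)
    show "valid (X k)" "has_per wb (X k) ((nper m n ^^ k) ((nper n m ^^ N) L))"
      using has_per_Up_funpow[OF x(5) _ x(3), of False k] x(2) by (auto simp: X_def)
    show "lab (root (X k)) = lab a" using lab_root_run[OF lab, of "Base a"] AC r by (metis root.simps(1) valid.simps(1))
  qed
  have Y: "run wb wt (?u @ ?Ti k) (Base b) = Y k" "valid (Y k)" "has_per wb (Y k) ((nper m n ^^ k) ((nper n m ^^ N) L'))"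
    "lab (root (Y k)) = lab b" for k
  proof -
    show r: "run wb wt (?u @ ?Ti k) (Base b) = Y k"
      using y run_replicate_GT[of False "Up True j' y" k] by (simp add: Y_def del: fold_replicate)
    show "valid (Y k)" "has_per wb (Y k) ((nper m n ^^ k) ((nper n m ^^ N) L'))"
      using has_per_Up_funpow[OF y(5) _ y(3), of False k] y(2) by (auto simp: Y_def)
    show "lab (root (Y k)) = lab b" using lab_root_run[OF lab, of "Base b"] AC r by (metis root.simps(1) valid.simps(1))
  qed
  obtain M' where M': "M = Suc M'" using M by (cases M) auto
  define p where "p = wb 1 (X M)"
  define q where "q = Y M"
  have pU: "p = Up False (1 mod n) (wb (m * (1 div n)) (X M'))" by (simp add: p_def X_def M')
  have v: "valid p" "valid q" using X Y by (auto simp: p_def q_def)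
  have hX: "height (X k) = Suc (height x) + k" and hY: "height (Y k) = Suc (height y) + k" for k
    by (simp_all add: X_def Y_def)
  have cp: "height k = Suc (height x) + M \<and> lab (root k) = lab a \<and> top_index k = 1 mod n"
    if kp: "k \<in> W.cls p" for k
  proof -
    obtain i where k: "k = wb (n * i) p" using kp by (auto simp: W.cls_def)
    have "lab (root k) = lab a"
      using lab_root_wb[OF lab(1)] v X by (simp add: k p_def)
    moreover have "height k = Suc (height x) + M" using hX by (simp add: k p_def)
    moreover have "top_index k = 1 mod n" using cls_top_index v(1) kp unfolding pU by blast
    ultimately show ?thesis by simp
  qed
  have cq: "height k = Suc (height y) + M \<and> lab (root k) = lab b" if kq: "k \<in> W.cls q" for k
  proof -
    obtain i where k: "k = wb (n * i) q" using kq by (auto simp: W.cls_def)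
    then show ?thesis using lab_root_wb[OF lab(1)] v Y hY by (simp add: k q_def)
  qed
  have qp: "q \<notin> W.cls p" using cp Y(4)[of M] ab by (auto simp: q_def)
  have "has_per wb p ((nper m n ^^ M) ((nper n m ^^ N) L))"
    using X W.has_per_beta[of "X M" 1] by (simp add: p_def)
  then have st: "wb (n * k) p = p \<longleftrightarrow> wb (n * k) q = q" for k
    using Y(3)[of M] LL by (simp add: q_def has_per_def)
  define K where "K = W.cls p \<union> W.cls q"
  have Kpos: "height k > 0" if "k \<in> K" for k using that cp cq by (auto simp: K_def)
  define \<tau>' where "\<tau>' = W.stau p q"
  have act: "bs_action m n (Collect valid) wb \<tau>'"
    unfolding \<tau>'_def by (rule W.stau_action) (use v qp st in auto)
  have av: "run wb \<tau>' w z = run wb wt w z" if "W.avoid K w z" for w z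
    using W.run_stau that by (simp add: \<tau>'_def K_def)
  have avX: "W.avoid K (?u @ ?Ti k) (Base a)" for k
  proof (rule W.avoid_if_prefixes)
    fix i
    let ?z = "run wb wt (take i (?u @ ?Ti k)) (Base a)"
    have lz: "lab (root ?z) = lab a" using lab_root_run[OF lab, of "Base a"] AC by (metis root.simps(1) valid.simps(1))
    have "?z \<notin> W.cls p"
    proof
      assume z: "?z \<in> W.cls p"
      then obtain k' where "k' \<ge> M" "?z = X k'"
        using height_lead_tail[OF x(1,2,4) M, of i k] cp[OF z] by (auto simp: X_def)
      then have "top_index ?z = 0" using M by (cases k') (auto simp: X_def)
      then show False using cp[OF z] one_mod_neq_0[OF n2] by simp
    qed
    moreover have "?z \<notin> W.cls q" using cq lz ab by metis
    ultimately show "?z \<notin> K" by (simp add: K_def)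
  qed
  have avY: "W.avoid K (?u @ ?Ti (M - 1)) (Base b)"
  proof (rule W.avoid_if_prefixes)
    fix i
    let ?z = "run wb wt (take i (?u @ ?Ti (M - 1))) (Base b)"
    have lz: "lab (root ?z) = lab b" using lab_root_run[OF lab, of "Base b"] AC by (metis root.simps(1) valid.simps(1))
    have "asc (?u @ ?Ti (M - 1)) (Base b)"
      using y asc_replicate_GT[of False "Up True j' y" "M - 1"] by (simp add: asc_append)
    from asc_prefix[OF this, of i] have "height ?z < Suc (height y) + M"
      unfolding Y(1) using hY[of "M - 1"] M by simp
    then have "?z \<notin> W.cls q" using cq by fastforce
    moreover have "?z \<notin> W.cls p" using cp lz ab by metis
    ultimately show "?z \<notin> K" by (simp add: K_def)
  qed
  have runX: "run wb \<tau>' (?u @ ?Ti k) (Base a) = X k" for k using av[OF avX] X(1) by simp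
  have runY: "run wb \<tau>' (?u @ ?Ti (M - 1)) (Base b) = Y M'" using av[OF avY] Y(1) M' by simp
  have "free False (Y M')" using y(2) by (cases M') (auto simp: Y_def)
  then have "q = wt False (Y M')" by (simp add: q_def Y_def M')
  then have tq: "wt True q = Y M'" using Y(2) W.tau_inv_simps(2) by simp
  have tp: "\<tau>' True p = Y M'"
    unfolding \<tau>'_def using W.stau_p[of p q] v qp st tq by simp
  interpret Z: bs_action m n "Collect valid" wb \<tau>' by (rule act)
  have "run wb \<tau>' (link_word ?u M) (Base a) = run wb \<tau>' (winv (?u @ ?Ti (M - 1))) (\<tau>' True (wb 1 (run wb \<tau>' (?u @ ?Ti M) (Base a))))"
    by (simp add: link_word_def)
  also have "\<dots> = run wb \<tau>' (winv (?u @ ?Ti (M - 1))) (run wb \<tau>' (?u @ ?Ti (M - 1)) (Base b))"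
    unfolding runX runY using tp by (simp add: p_def)
  also have "\<dots> = Base b" by (rule Z.run_winv) (use AC in simp)
  finally have link: "run wb \<tau>' (link_word ?u M) (Base a) = Base b" .
  have "\<not> fin_cover wb \<tau>' (Base a)"
  proof (rule not_fin_cover_if_heights)
    fix k
    have "height (run wb \<tau>' (?u @ ?Ti k) (Base a)) \<ge> k" unfolding runX hX by simp
    then show "\<exists>w. height (run wb \<tau>' w (Base a)) \<ge> k" by blast
  qed
  moreover have "run wb \<tau>' w (Base c) = Base (run \<beta> \<tau> w c)"
    if "\<forall>i\<le>length w. run \<beta> \<tau> (take i w) c \<in> A" for w c
    using av[OF avoid_run_Base] Kpos run_Base_prefixes that by simp
  ultimately show ?thesis using act link by (intro exI[of _ \<tau>']) simp
qed

lemma forest_loop: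
  assumes m2: "\<bar>m\<bar> \<ge> 2" and n2: "\<bar>n\<bar> \<ge> 2" and x: "valid (Up True j x)" "j \<noteq> 0"
  defines "z \<equiv> Up False 0 (Up True j x)"
    and "l \<equiv> [(GT, True), (GB, False), (GT, False), (GB, False)]"
  shows "\<not> fin_cover wb wt z \<and> run wb wt l z \<noteq> z \<and>
    (\<exists>\<tau>'. bs_action m n (Collect valid) wb \<tau>' \<and> \<not> fin_cover wb \<tau>' z \<and> run wb \<tau>' l z = z)"
proof -
  have vz: "valid z" using x by (simp add: z_def)
  have zk: "run wb wt (replicate k (GT, False)) z = (Up False 0 ^^ k) z" for k
    by (rule run_replicate_GT) (simp add: z_def)
  have nf: "\<not> fin_cover wb \<tau>' z" if "\<And>k. run wb \<tau>' (replicate k (GT, False)) z = (Up False 0 ^^ k) z" for \<tau>'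
  proof (rule not_fin_cover_if_heights)
    fix k
    have "height (run wb \<tau>' (replicate k (GT, False)) z) \<ge> k" unfolding that by simp
    then show "\<exists>w. height (run wb \<tau>' w z) \<ge> k" by blast
  qed
  define zb where "zb = wb 1 z"
  define y where "y = Up True 0 zb"
  define z3 where "z3 = Up False 0 (wb 1 y)"
  have m1: "1 mod m \<noteq> 0" and n1: "1 mod n \<noteq> 0" using one_mod_neq_0 m2 n2 by auto
  have zbU: "zb = Up False (1 mod n) (wb (m * (1 div n)) (Up True j x))" by (simp add: zb_def z_def)
  have vzb: "valid zb" using vz by (simp add: zb_def)
  have vy: "valid y" using vzb n1 by (simp add: y_def zbU)
  have ybU: "wb 1 y = Up True (1 mod m) (wb (n * (1 div m)) zb)" by (simp add: y_def)
  have vyb: "valid (wb 1 y)" using vy by simp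
  have v3: "valid z3" using vyb m1 by (simp add: z3_def ybU del: wb.simps)
  obtain L where L: "has_per wb (Up True j x) L" using W.has_per_exists[of "Up True j x"] x by auto
  have pz: "has_per wb z (nper m n L)" using has_per_Up[OF _ L, of False 0] vz by (simp add: z_def)
  then have "has_per wb zb (nper m n L)" using W.has_per_beta[of z 1] vz by (simp add: zb_def)
  then have "has_per wb y (nper n m (nper m n L))" using has_per_Up[of True 0 zb] vy by (simp add: y_def)
  then have "has_per wb (wb 1 y) (nper n m (nper m n L))" using W.has_per_beta[of y 1] vy by simp
  then have "has_per wb z3 (nper m n (nper n m (nper m n L)))"
    using has_per_Up[of False 0 "wb 1 y"] v3 by (simp add: z3_def)
  then have p3: "has_per wb z3 (nper m n L)" by (simp add: nper_nper_nper m0 n0)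
  have st: "wb (n * k) z = z \<longleftrightarrow> wb (n * k) z3 = z3" for k using pz p3 by (simp add: has_per_def)
  have h: "height z3 = Suc (Suc (height z))" "height zb = height z" by (simp_all add: z3_def y_def zb_def)
  have z3z: "z3 \<notin> W.cls z" using cls_invariants[of z3 z] h by auto
  define \<tau>' where "\<tau>' = W.stau z z3"
  have act: "bs_action m n (Collect valid) wb \<tau>'"
    unfolding \<tau>'_def by (rule W.stau_action) (use vz v3 z3z st in auto)
  have zbK: "zb \<notin> W.cls z \<union> W.cls z3"
  proof -
    have "zb \<notin> W.cls z" using cls_top_index[of 0 "Up True j x" zb] vz n1 by (auto simp: z_def zbU)
    moreover have "zb \<notin> W.cls z3" using cls_invariants[of zb z3] h by auto
    ultimately show ?thesis by simp
  qed
  have "\<tau>' True z = wt True z3" unfolding \<tau>'_def by (rule W.stau_p) (use vz v3 z3z st in auto)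
  also have "\<dots> = wb 1 y" by (simp add: z3_def)
  finally have s1: "\<tau>' True z = wb 1 y" .
  have s2: "wb (- 1) (wb 1 y) = y" using vy by simp
  have "\<tau>' False y = W.switch z z3 zb" by (simp add: \<tau>'_def W.stau_def y_def)
  also have "\<dots> = zb" using zbK by (simp add: W.switch_def)
  finally have s3: "\<tau>' False y = zb" .
  have s4: "wb (- 1) zb = z" using vz by (simp add: zb_def)
  have loop: "run wb \<tau>' l z = z" by (simp add: l_def s1 s2 s3 s4 del: wb.simps)
  have "run wb \<tau>' (replicate k (GT, False)) z = (Up False 0 ^^ k) z" for k
  proof (induction k)
    case (Suc k)
    let ?w = "(Up False 0 ^^ k) z"
    have f: "free False ?w" by (cases k) (auto simp: z_def)
    have "run wb \<tau>' (replicate (Suc k) (GT, False)) z = \<tau>' False ?w"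
      using Suc by (simp add: replicate_append_same[symmetric] del: replicate.simps)
    also have "\<dots> = W.switch z z3 (Up False 0 ?w)" using f by (simp add: \<tau>'_def W.stau_def)
    also have "\<dots> = Up False 0 ?w"
    proof -
      have "Up False 0 ?w \<notin> W.cls z" using cls_invariants[of "Up False 0 ?w" z] by auto
      moreover have "signs (Up False 0 ?w) \<noteq> signs z3"
        by (cases k) (auto simp: z3_def y_def zb_def z_def)
      then have "Up False 0 ?w \<notin> W.cls z3" using cls_invariants[of "Up False 0 ?w" z3] by auto
      ultimately show ?thesis by (simp add: W.switch_def)
    qed
    finally show ?case by simp
  qed simp
  then have "\<not> fin_cover wb \<tau>' z" by (rule nf)
  moreover have "run wb wt l z \<noteq> z"
  proof -
    have "(- 1) mod n \<noteq> (0::int)" using n2 by (auto simp: mod_eq_0_iff_dvd zdvd1_eq)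
    then show ?thesis
      by (auto simp: l_def z_def dest: arg_cong[of _ _ height])
  qed
  moreover have "\<not> fin_cover wb wt z" using zk by (rule nf)
  ultimately show ?thesis using act loop by blast
qed

end

subsection \<open>Simultaneous joining\<close>

lemma fin_cover_flip: "fin_cover \<beta> (\<lambda>e. \<tau> (\<not> e)) x \<longleftrightarrow> fin_cover \<beta> \<tau> x"
proof -
  have *: "fin_cover \<beta> \<tau> x" if fc: "fin_cover \<beta> (\<lambda>e. \<tau> (\<not> e)) x" for \<tau>
  proof -
    obtain U where U: "finite U" "\<forall>w. \<exists>u\<in>U. \<exists>k. run \<beta> \<tau> (map flip w) x = \<beta> k (run \<beta> \<tau> (map flip u) x)"
      using fc unfolding fin_cover_def run_flip by (elim exE conjE)
    have "\<exists>u\<in>map flip ` U. \<exists>k. run \<beta> \<tau> w x = \<beta> k (run \<beta> \<tau> u x)" for w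
      using U(2)[rule_format, of "map flip w"] by (simp only: map_flip_flip bex_simps)
    then show ?thesis unfolding fin_cover_def using U(1) by (meson finite_imageI)
  qed
  then show ?thesis using *[of "\<lambda>e. \<tau> (\<not> e)"] by auto
qed

lemma run_map_flip: "run \<beta> (\<lambda>e. \<tau> (\<not> e)) (map flip w) x = run \<beta> \<tau> w x"
  by (simp only: run_flip map_flip_flip)

lemma same_ph_swap: "same_ph n m L L' \<longleftrightarrow> same_ph m n L L'"
  by (auto simp: same_ph_def)

definition realizes ::
  "nat \<Rightarrow> (int \<Rightarrow> 'a \<Rightarrow> 'a) \<Rightarrow> (bool \<Rightarrow> 'a \<Rightarrow> 'a) \<Rightarrow> 'a \<Rightarrow> (int \<Rightarrow> 'b \<Rightarrow> 'b) \<Rightarrow> (bool \<Rightarrow> 'b \<Rightarrow> 'b) \<Rightarrow> 'b \<Rightarrow> bool" where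
  "realizes R \<beta> \<tau> x \<beta>' \<tau>' x' \<longleftrightarrow>
     (\<forall>w. length w \<le> R \<longrightarrow> (run \<beta>' \<tau>' w x' = x' \<longleftrightarrow> run \<beta> \<tau> w x = x)) \<and>
     (\<forall>k. \<beta>' k x' = x' \<longleftrightarrow> \<beta> k x = x) \<and> \<not> fin_cover \<beta>' \<tau>' x'"

lemma realizes_flip:
  "realizes R \<beta> (\<lambda>e. \<tau> (\<not> e)) x \<beta>' \<tau>' x' \<longleftrightarrow> realizes R \<beta> \<tau> x \<beta>' (\<lambda>e. \<tau>' (\<not> e)) x'"
  unfolding realizes_def run_flip fin_cover_flip by (metis map_flip_flip length_map)

context bs_action begin

lemma positive_word_escapes_orbits:
  assumes P: "P \<subseteq> C" and nfc: "\<And>x. x \<in> P \<Longrightarrow> \<not> fin_cover \<beta> \<tau> x"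
    and cs: "\<bar>m\<bar> \<le> \<bar>n\<bar> \<or> (\<forall>x\<in>P. \<exists>k. k \<noteq> 0 \<and> \<beta> k x = x)"
    and A: "A \<subseteq> C" "finite (orb ` A)" "a \<in> A" "x \<in> P" "a = run \<beta> \<tau> w x"
  shows "\<exists>w. posw w \<and> run \<beta> \<tau> w a \<notin> A"
proof (rule positive_word_escapes[OF A(1-3)])
  have x: "x \<in> C" using A P by blast
  show "\<not> fin_cover \<beta> \<tau> a" using fin_cover_run[OF x] nfc A by simp
  show "(\<exists>k. k \<noteq> 0 \<and> \<beta> k a = a) \<or> (\<bar>m\<bar> \<le> \<bar>n\<bar> \<and> (\<forall>k. \<beta> k a = a \<longrightarrow> k = 0))"
  proof (cases "\<exists>k. k \<noteq> 0 \<and> \<beta> k a = a")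
    case False
    then have "\<not> (\<exists>k. k \<noteq> 0 \<and> \<beta> k x = x)" using nonzero_period_run[OF x, of w] A(5) by metis
    then have "\<bar>m\<bar> \<le> \<bar>n\<bar>" using cs A(4) by metis
    then show ?thesis using False by metis
  qed metis
qed

lemma common_linking_le:
  fixes lab :: "'a \<Rightarrow> 'l" and X Y :: "'i \<Rightarrow> 'a"
  assumes m2: "\<bar>m\<bar> \<ge> 2" and n2: "\<bar>n\<bar> \<ge> 2"
    and lab: "\<And>a k. a \<in> C \<Longrightarrow> lab (\<beta> k a) = lab a" "\<And>a e. a \<in> C \<Longrightarrow> lab (\<tau> e a) = lab a"
    and I: "finite I" and XY: "\<And>i. i \<in> I \<Longrightarrow> lab (X i) \<noteq> lab (Y i)"
    and P: "X ` I \<union> Y ` I \<subseteq> C" and nfc: "\<And>x. x \<in> X ` I \<union> Y ` I \<Longrightarrow> \<not> fin_cover \<beta> \<tau> x"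
    and ph: "\<And>x y L L'. x \<in> X ` I \<union> Y ` I \<Longrightarrow> y \<in> X ` I \<union> Y ` I \<Longrightarrow>
        has_per \<beta> x L \<Longrightarrow> has_per \<beta> y L' \<Longrightarrow> same_ph m n L L'"
    and cs: "\<bar>m\<bar> \<le> \<bar>n\<bar> \<or> (\<forall>x \<in> X ` I \<union> Y ` I. \<exists>k. k \<noteq> 0 \<and> \<beta> k x = x)"
  shows "\<exists>\<gamma>. \<forall>i\<in>I. \<exists>(C' :: 'a pt set) \<beta>' \<tau>' x' y'. bs_action m n C' \<beta>' \<tau>' \<and> x' \<in> C' \<and> y' \<in> C' \<and>
     realizes R \<beta> \<tau> (X i) \<beta>' \<tau>' x' \<and> realizes R \<beta> \<tau> (Y i) \<beta>' \<tau>' y' \<and> run \<beta>' \<tau>' \<gamma> x' = y'"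
proof -
  define P where "P = X ` I \<union> Y ` I"
  have PC: "P \<subseteq> C" and Pfin: "finite P" using P I by (auto simp: P_def)
  define B where "B = (\<lambda>(w, x). run \<beta> \<tau> w x) ` ({w. length w \<le> R} \<times> P)"
  define A where "A = {\<beta> k b |k b. b \<in> B}"
  have "finite (UNIV :: letter set)"
  proof -
    have "(UNIV :: gen set) = {GB, GT}" by (auto intro: gen.exhaust)
    then have "finite (UNIV :: gen set)" by (metis finite.emptyI finite_insert)
    then show ?thesis by (simp add: finite_prod)
  qed
  then have "finite {w :: word. set w \<subseteq> UNIV \<and> length w \<le> R}" by (rule finite_lists_length_le)
  then have Bfin: "finite B" using Pfin by (auto simp: B_def)
  have BC: "B \<subseteq> C" using PC by (auto simp: B_def)
  have AC: "A \<subseteq> C" using BC by (auto simp: A_def)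
  interpret bs_forest m n C \<beta> \<tau> A
  proof
    fix a k assume "a \<in> A"
    then obtain i b where "b \<in> B" "a = \<beta> i b" by (auto simp: A_def)
    then have "b \<in> B" "\<beta> k a = \<beta> (k + i) b" using BC by (auto simp: beta_beta)
    then show "\<beta> k a \<in> A" unfolding A_def by blast
  qed (rule AC)
  have "orb ` A \<subseteq> orb ` B" using orb_eqI BC by (auto simp: A_def)
  then have orbA: "finite (orb ` A)" using Bfin finite_subset by blast
  have inB: "run \<beta> \<tau> w x \<in> A" if "length w \<le> R" "x \<in> P" for w x
  proof -
    have "run \<beta> \<tau> w x \<in> B" using that by (auto simp: B_def)
    then have "run \<beta> \<tau> w x \<in> B \<and> run \<beta> \<tau> w x = \<beta> 0 (run \<beta> \<tau> w x)" using BC by auto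
    then show ?thesis unfolding A_def by blast
  qed
  have PA: "P \<subseteq> A" using inB[of "[]"] by auto
  have esc: "\<exists>w. posw w \<and> run \<beta> \<tau> w a \<notin> A" if aA: "a \<in> A" for a
  proof -
    obtain k w x where "x \<in> P" "a = \<beta> k (run \<beta> \<tau> w x)" using aA by (auto simp: A_def B_def)
    then have "x \<in> P" "a = run \<beta> \<tau> (w @ bpow k) x" using PC by auto
    then show ?thesis
      using positive_word_escapes_orbits[OF PC _ _ AC orbA aA] nfc cs unfolding P_def by blast
  qed
  obtain g where g: "posw g" "\<And>a. a \<in> P \<Longrightarrow> height (run wb wt g (Base a)) > 0"
    using common_escape[OF esc Pfin PA] by blast
  have "\<exists>L. has_per wb (run wb wt g (Base a)) L" if "a \<in> P" for a
    by (rule W.has_per_exists) (use W.run_closed[of "Base a" g] that PC in auto)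
  then obtain per where per: "\<And>a. a \<in> P \<Longrightarrow> has_per wb (run wb wt g (Base a)) (per a)" by metis
  have sp: "same_ph m n (per a) (per b)" if "a \<in> P" "b \<in> P" for a b
  proof -
    have ab: "a \<in> C" "b \<in> C" using that PC by auto
    obtain L L' where L: "has_per \<beta> a L" "has_per \<beta> b L'" using has_per_exists ab by meson
    have "same_ph m n L (per a)" "same_ph m n L' (per b)"
      using W.same_ph_run[of "Base a" L g] W.same_ph_run[of "Base b" L' g] ab L per that
      by (auto simp: has_per_Base)
    moreover have "same_ph m n L L'" using ph L that by (simp add: P_def)
    ultimately show ?thesis by (simp add: same_ph_def)
  qed
  define N where "N = Suc (sum per P)"
  define M where "M = N + N * nat \<bar>m\<bar>"
  have N: "N \<ge> 1" "M \<ge> 1" by (auto simp: N_def M_def)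
  have perN: "per a \<le> N" if "a \<in> P" for a using that Pfin member_le_sum[of a P per] by (simp add: N_def)
  show ?thesis
  proof (intro exI[of _ "link_word (lead_word g N) M"] ballI)
    fix i assume i: "i \<in> I"
    have ip: "X i \<in> P" "Y i \<in> P" using i by (auto simp: P_def)
    have "(nper m n ^^ M) ((nper n m ^^ N) (per (X i))) = (nper m n ^^ M) ((nper n m ^^ N) (per (Y i)))"
      by (rule nper_iterates_agree[OF m0 n0 sp]) (use ip perN N in \<open>auto simp: M_def\<close>)
    note sw = forest_switch[where lab = lab, OF m2 n2 lab subsetD[OF PA ip(1)] subsetD[OF PA ip(2)] XY[OF i]
        g(1) g(2)[OF ip(1)] g(2)[OF ip(2)] N per[OF ip(1)] per[OF ip(2)] this]
    from sw obtain \<tau>' where act: "bs_action m n (Collect valid) wb \<tau>'" and fc: "\<not> fin_cover wb \<tau>' (Base (X i))"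
      and link: "run wb \<tau>' (link_word (lead_word g N) M) (Base (X i)) = Base (Y i)"
      and rn: "\<And>c w. c \<in> {X i, Y i} \<Longrightarrow> (\<forall>j\<le>length w. run \<beta> \<tau> (take j w) c \<in> A) \<Longrightarrow>
        run wb \<tau>' w (Base c) = Base (run \<beta> \<tau> w c)"
      by blast
    interpret Z: bs_action m n "Collect valid" wb \<tau>' by (rule act)
    have xC: "Base (X i) \<in> Collect valid" "Base (Y i) \<in> Collect valid" using ip PC by auto
    have fc': "\<not> fin_cover wb \<tau>' (Base (Y i))"
      using Z.fin_cover_run[OF xC(1)] fc unfolding link[symmetric] by simp
    have rz: "realizes R \<beta> \<tau> c wb \<tau>' (Base c)" if c: "c \<in> {X i, Y i}" for c
      unfolding realizes_def
    proof (intro conjI allI impI)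
      fix w :: word assume "length w \<le> R"
      then have "run wb \<tau>' w (Base c) = Base (run \<beta> \<tau> w c)"
        by (intro rn c allI impI inB) (use c ip in auto)
      then show "(run wb \<tau>' w (Base c) = Base c) = (run \<beta> \<tau> w c = c)" by simp
    qed (use c fc fc' in auto)
    show "\<exists>(C' :: 'a pt set) \<beta>' \<tau>' x' y'. bs_action m n C' \<beta>' \<tau>' \<and> x' \<in> C' \<and> y' \<in> C' \<and>
     realizes R \<beta> \<tau> (X i) \<beta>' \<tau>' x' \<and> realizes R \<beta> \<tau> (Y i) \<beta>' \<tau>' y' \<and>
     run \<beta>' \<tau>' (link_word (lead_word g N) M) x' = y'"
      using act xC rz[of "X i"] rz[of "Y i"] link by blast
  qed
qed

text \<open>Replacing \<open>t\<close> by its inverse exchanges \<open>m\<close> and \<open>n\<close>, so the restriction on \<open>\<bar>m\<bar>\<close> and \<open>\<bar>n\<bar>\<close> can be dropped.\<close>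
lemma common_linking:
  fixes lab :: "'a \<Rightarrow> 'l" and X Y :: "'i \<Rightarrow> 'a"
  assumes m2: "\<bar>m\<bar> \<ge> 2" and n2: "\<bar>n\<bar> \<ge> 2"
    and lab: "\<And>a k. a \<in> C \<Longrightarrow> lab (\<beta> k a) = lab a" "\<And>a e. a \<in> C \<Longrightarrow> lab (\<tau> e a) = lab a"
    and I: "finite I" and XY: "\<And>i. i \<in> I \<Longrightarrow> lab (X i) \<noteq> lab (Y i)"
    and P: "X ` I \<union> Y ` I \<subseteq> C" and nfc: "\<And>x. x \<in> X ` I \<union> Y ` I \<Longrightarrow> \<not> fin_cover \<beta> \<tau> x"
    and ph: "\<And>x y L L'. x \<in> X ` I \<union> Y ` I \<Longrightarrow> y \<in> X ` I \<union> Y ` I \<Longrightarrow>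
        has_per \<beta> x L \<Longrightarrow> has_per \<beta> y L' \<Longrightarrow> same_ph m n L L'"
  shows "\<exists>\<gamma>. \<forall>i\<in>I. \<exists>(C' :: 'a pt set) \<beta>' \<tau>' x' y'. bs_action m n C' \<beta>' \<tau>' \<and> x' \<in> C' \<and> y' \<in> C' \<and>
     realizes R \<beta> \<tau> (X i) \<beta>' \<tau>' x' \<and> realizes R \<beta> \<tau> (Y i) \<beta>' \<tau>' y' \<and> run \<beta>' \<tau>' \<gamma> x' = y'"
proof (cases "\<bar>m\<bar> \<le> \<bar>n\<bar>")
  case True
  show ?thesis
    by (rule common_linking_le[where lab = lab, OF m2 n2 lab I XY P nfc ph]) (use True in auto)
next
  case False
  interpret F: bs_action n m C \<beta> "\<lambda>e. \<tau> (\<not> e)" by (rule flip_action)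
  have "\<exists>\<gamma>. \<forall>i\<in>I. \<exists>(C' :: 'a pt set) \<beta>' \<tau>' x' y'. bs_action n m C' \<beta>' \<tau>' \<and> x' \<in> C' \<and> y' \<in> C' \<and>
     realizes R \<beta> (\<lambda>e. \<tau> (\<not> e)) (X i) \<beta>' \<tau>' x' \<and> realizes R \<beta> (\<lambda>e. \<tau> (\<not> e)) (Y i) \<beta>' \<tau>' y' \<and>
     run \<beta>' \<tau>' \<gamma> x' = y'"
    by (rule F.common_linking_le[where lab = lab])
      (use n2 m2 lab I XY P nfc False ph in \<open>auto simp: same_ph_swap fin_cover_flip\<close>)
  then obtain \<gamma> where \<gamma>: "\<forall>i\<in>I. \<exists>(C' :: 'a pt set) \<beta>' \<tau>' x' y'. bs_action n m C' \<beta>' \<tau>' \<and> x' \<in> C' \<and> y' \<in> C' \<and>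
     realizes R \<beta> (\<lambda>e. \<tau> (\<not> e)) (X i) \<beta>' \<tau>' x' \<and> realizes R \<beta> (\<lambda>e. \<tau> (\<not> e)) (Y i) \<beta>' \<tau>' y' \<and>
     run \<beta>' \<tau>' \<gamma> x' = y'" by (rule exE)
  show ?thesis
  proof (intro exI[of _ "map flip \<gamma>"] ballI)
    fix i assume "i \<in> I"
    from bspec[OF \<gamma> this] obtain C' :: "'a pt set" and \<beta>' \<tau>' x' y' where *: "bs_action n m C' \<beta>' \<tau>'" "x' \<in> C'" "y' \<in> C'"
     "realizes R \<beta> (\<lambda>e. \<tau> (\<not> e)) (X i) \<beta>' \<tau>' x'" "realizes R \<beta> (\<lambda>e. \<tau> (\<not> e)) (Y i) \<beta>' \<tau>' y'"
     "run \<beta>' \<tau>' \<gamma> x' = y'" by (elim exE conjE)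
    have "run \<beta>' (\<lambda>e. \<tau>' (\<not> e)) (map flip \<gamma>) x' = y'" unfolding run_map_flip using *(6) .
    then show "\<exists>(C' :: 'a pt set) \<beta>' \<tau>' x' y'. bs_action m n C' \<beta>' \<tau>' \<and> x' \<in> C' \<and> y' \<in> C' \<and>
       realizes R \<beta> \<tau> (X i) \<beta>' \<tau>' x' \<and> realizes R \<beta> \<tau> (Y i) \<beta>' \<tau>' y' \<and> run \<beta>' \<tau>' (map flip \<gamma>) x' = y'"
      using *(2-5) bs_action.flip_action[OF *(1)] unfolding realizes_flip by blast
  qed
qed

lemma two_stabilizers_le:
  assumes m2: "\<bar>m\<bar> \<ge> 2" and n2: "\<bar>n\<bar> \<ge> 2" and x: "x \<in> C" and nfc: "\<not> fin_cover \<beta> \<tau> x"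
    and cs: "\<bar>m\<bar> \<le> \<bar>n\<bar> \<or> (\<exists>k. k \<noteq> 0 \<and> \<beta> k x = x)" and L: "has_per \<beta> x L"
  shows "\<exists>(C' :: 'a pt set) \<beta>' \<tau>1 \<tau>2 z l L'. bs_action m n C' \<beta>' \<tau>1 \<and> bs_action m n C' \<beta>' \<tau>2 \<and> z \<in> C' \<and>
     \<not> fin_cover \<beta>' \<tau>1 z \<and> \<not> fin_cover \<beta>' \<tau>2 z \<and> has_per \<beta>' z L' \<and> same_ph m n L L' \<and>
     run \<beta>' \<tau>1 l z \<noteq> z \<and> run \<beta>' \<tau>2 l z = z"
proof -
  have AC: "orb x \<subseteq> C" using x by (auto simp: orb_def)
  have xA: "x \<in> orb x" using orb_self x by blast
  interpret bs_forest m n C \<beta> \<tau> "orb x"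
  proof
    fix a k assume "a \<in> orb x"
    then obtain i where "a = \<beta> i x" by (auto simp: orb_def)
    then have "\<beta> k a = \<beta> (k + i) x" using x by (simp add: beta_beta)
    then show "\<beta> k a \<in> orb x" by (simp add: orb_def)
  qed (rule AC)
  have "orb a = orb x" if "a \<in> orb x" for a
    using that orb_eqI[OF x] by (auto simp: orb_def[of x])
  then have "orb ` orb x \<subseteq> {orb x}" by blast
  then have orbA: "finite (orb ` orb x)" using finite_subset by blast
  have esc: "\<exists>w. posw w \<and> run \<beta> \<tau> w a \<notin> orb x" if aA: "a \<in> orb x" for a
  proof -
    obtain k where "a = run \<beta> \<tau> (bpow k) x" using aA x by (auto simp: orb_def)
    then show ?thesis
      using positive_word_escapes_orbits[of "{x}" "orb x" a x "bpow k"] AC orbA aA nfc cs x by auto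
  qed
  obtain g where g: "posw g" "height (run wb wt g (Base x)) > 0"
    using common_escape[OF esc, of "{x}"] xA by auto
  have xv: "Base x \<in> Collect valid" using x by simp
  obtain K where K: "has_per wb (run wb wt g (Base x)) K"
    using W.has_per_exists[OF W.run_closed[OF xv]] by blast
  obtain j y where y: "run wb wt (lead_word g 1) (Base x) = Up True j y" "j \<noteq> 0"
    "has_per wb (Up True j y) ((nper n m ^^ 1) K)" "asc (lead_word g 1) (Base x)" "valid (Up True j y)"
    by (rule run_lead_word[OF x g order_refl m2 K])
  let ?z = "Up False 0 (Up True j y)"
  have vz: "?z \<in> Collect valid" using y by simp
  obtain L' where L': "has_per wb ?z L'" using W.has_per_exists[OF vz] by blast
  have "?z = run wb wt (lead_word g 1 @ [(GT, False)]) (Base x)" using y by simp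
  then have "same_ph m n L L'"
    using W.same_ph_run[OF xv, of L "lead_word g 1 @ [(GT, False)]" L'] L L' by (simp add: has_per_Base del: fold_append)
  then show ?thesis using forest_loop[OF m2 n2 y(5,2)] W.bs_action_axioms vz L' by blast
qed

lemma two_stabilizers:
  assumes m2: "\<bar>m\<bar> \<ge> 2" and n2: "\<bar>n\<bar> \<ge> 2" and x: "x \<in> C" and nfc: "\<not> fin_cover \<beta> \<tau> x"
    and L: "has_per \<beta> x L"
  shows "\<exists>(C' :: 'a pt set) \<beta>' \<tau>1 \<tau>2 z l L'. bs_action m n C' \<beta>' \<tau>1 \<and> bs_action m n C' \<beta>' \<tau>2 \<and> z \<in> C' \<and>
     \<not> fin_cover \<beta>' \<tau>1 z \<and> \<not> fin_cover \<beta>' \<tau>2 z \<and> has_per \<beta>' z L' \<and> same_ph m n L L' \<and>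
     run \<beta>' \<tau>1 l z \<noteq> z \<and> run \<beta>' \<tau>2 l z = z"
proof (cases "\<bar>m\<bar> \<le> \<bar>n\<bar>")
  case True
  then show ?thesis using two_stabilizers_le[OF assms(1-4) _ L] by blast
next
  case False
  interpret F: bs_action n m C \<beta> "\<lambda>e. \<tau> (\<not> e)" by (rule flip_action)
  obtain C' :: "'a pt set" and \<beta>' \<tau>1 \<tau>2 z l L' where *: "bs_action n m C' \<beta>' \<tau>1" "bs_action n m C' \<beta>' \<tau>2" "z \<in> C'"
     "\<not> fin_cover \<beta>' \<tau>1 z" "\<not> fin_cover \<beta>' \<tau>2 z" "has_per \<beta>' z L'" "same_ph m n L L'"
     "run \<beta>' \<tau>1 l z \<noteq> z" "run \<beta>' \<tau>2 l z = z"
    using F.two_stabilizers_le[OF n2 m2 x _ _ L] nfc False unfolding fin_cover_flip same_ph_swap[of n m]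
    by (metis (no_types, lifting) linorder_not_le less_imp_le)
  have "run \<beta>' (\<lambda>e. \<tau>1 (\<not> e)) (map flip l) z \<noteq> z" "run \<beta>' (\<lambda>e. \<tau>2 (\<not> e)) (map flip l) z = z"
    unfolding run_map_flip using * by auto
  then show ?thesis
    using *(3-7) bs_action.flip_action[OF *(1)] bs_action.flip_action[OF *(2)] fin_cover_flip[of \<beta>' \<tau>1 z] fin_cover_flip[of \<beta>' \<tau>2 z]
    by blast
qed

end

subsection \<open>Words, subgroups and coset actions\<close>

lemma bs_class_eq_iff: "bs_class m n u = bs_class m n v \<longleftrightarrow> bs_eq m n u v"
proof
  assume "bs_class m n u = bs_class m n v"
  then have "v \<in> bs_class m n u" by (simp add: bs_class_def bs_refl)
  then show "bs_eq m n u v" by (simp add: bs_class_def)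
next
  assume "bs_eq m n u v"
  then show "bs_class m n u = bs_class m n v"
    unfolding bs_class_def using bs_sym bs_trans by blast
qed

lemma bs_eq_append_right: "bs_eq m n u v \<Longrightarrow> bs_eq m n (u @ w) (v @ w)"
proof (induction rule: bs_eq.induct)
  case (bs_cancel u x v)
  then show ?case using bs_eq.bs_cancel[of m n u x "v @ w"] by simp
next
  case (bs_rel u v)
  then show ?case using bs_eq.bs_rel[of m n u "v @ w"] by simp
qed (auto intro: bs_refl bs_sym bs_trans)

lemma bs_eq_append_left: "bs_eq m n u v \<Longrightarrow> bs_eq m n (w @ u) (w @ v)"
proof (induction rule: bs_eq.induct)
  case (bs_cancel u x v)
  then show ?case using bs_eq.bs_cancel[of m n "w @ u" x v] by simp
next
  case (bs_rel u v)
  then show ?case using bs_eq.bs_rel[of m n "w @ u" v] by simp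
qed (auto intro: bs_refl bs_sym bs_trans)

lemma bs_eq_append: "bs_eq m n u u' \<Longrightarrow> bs_eq m n v v' \<Longrightarrow> bs_eq m n (u @ v) (u' @ v')"
  using bs_eq_append_left bs_eq_append_right bs_trans by blast

lemma bs_eq_winv_right: "bs_eq m n (w @ winv w) []"
proof (induction w rule: rev_induct)
  case (snoc x w)
  have "bs_eq m n ((w @ [x]) @ winv (w @ [x])) (w @ winv w)"
    using bs_cancel[of m n w x "winv w"] by (simp add: winv_Cons)
  then show ?case using snoc bs_trans by blast
qed (simp add: bs_refl)

lemma bs_eq_winv_left: "bs_eq m n (winv w @ w) []"
  using bs_eq_winv_right[of m n "winv w"] by simp

lemma BS_mult: "bs_class m n u \<otimes>\<^bsub>BS m n\<^esub> bs_class m n v = bs_class m n (u @ v)"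
proof -
  have *: "bs_eq m n w (SOME a. a \<in> bs_class m n w)" for w
  proof -
    have "(SOME a. a \<in> bs_class m n w) \<in> bs_class m n w"
      by (rule someI[of _ w]) (simp add: bs_class_def bs_refl)
    then show ?thesis by (simp add: bs_class_def)
  qed
  show ?thesis using bs_eq_append[OF * *] bs_class_eq_iff by (metis BS_def monoid.select_convs(1))
qed

lemma BS_carrier: "carrier (BS m n) = range (bs_class m n)"
  and BS_one: "\<one>\<^bsub>BS m n\<^esub> = bs_class m n []"
  by (simp_all add: BS_def)

lemma BS_group: "group (BS m n)"
proof (rule groupI)
  fix x assume "x \<in> carrier (BS m n)"
  then obtain w where "x = bs_class m n w" by (auto simp: BS_carrier)
  then have "bs_class m n (winv w) \<otimes>\<^bsub>BS m n\<^esub> x = \<one>\<^bsub>BS m n\<^esub>"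
    using bs_eq_winv_left by (simp add: BS_mult BS_one bs_class_eq_iff)
  then show "\<exists>y\<in>carrier (BS m n). y \<otimes>\<^bsub>BS m n\<^esub> x = \<one>\<^bsub>BS m n\<^esub>" by (auto simp: BS_carrier)
qed (auto simp: BS_carrier BS_one BS_mult)

lemma BS_inv: "inv\<^bsub>BS m n\<^esub> (bs_class m n w) = bs_class m n (winv w)"
  by (rule group.inv_equality[OF BS_group])
    (auto simp: BS_carrier BS_one BS_mult bs_class_eq_iff bs_eq_winv_left)

lemma bs_b_nat_pow: "bs_b m n [^]\<^bsub>BS m n\<^esub> (k::nat) = bs_class m n (replicate k (GB, True))"
proof (induction k)
  case 0
  then show ?case by (simp add: BS_one)
next
  case (Suc k)
  then show ?case by (simp add: BS_mult bs_b_def replicate_append_same)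
qed

lemma winv_replicate: "winv (replicate k l) = replicate k (linv l)"
  by (simp add: winv_def)

lemma bs_b_int_pow: "bs_b m n [^]\<^bsub>BS m n\<^esub> (k::int) = bs_class m n (bpow k)"
proof (cases "k \<ge> 0")
  case True
  then show ?thesis by (simp add: int_pow_def2 bs_b_nat_pow bpow_def)
next
  case False
  then show ?thesis by (simp add: int_pow_def2 bs_b_nat_pow bpow_def BS_inv winv_replicate)
qed

lemma bs_class_bpow_add: "bs_class m n (bpow (j + k)) = bs_class m n (bpow j @ bpow k)"
proof -
  have "bs_b m n \<in> carrier (BS m n)" by (simp add: bs_b_def BS_carrier)
  then show ?thesis using group.int_pow_mult[OF BS_group, of "bs_b m n" m n j k]
    by (simp add: bs_b_int_pow BS_mult)
qed

lemma bs_eq_bpow_add: "bs_eq m n (bpow j @ bpow k) (bpow (j + k))"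
  using bs_class_bpow_add bs_class_eq_iff by metis

lemma bpow_simps [simp]: "bpow 0 = []" "bpow 1 = [(GB, True)]" "bpow (-1) = [(GB, False)]"
  by (simp_all add: bpow_def)

definition wsub :: "int \<Rightarrow> int \<Rightarrow> (word \<Rightarrow> bool) \<Rightarrow> bool" where
  "wsub m n P \<longleftrightarrow> P [] \<and> (\<forall>u v. P u \<longrightarrow> P v \<longrightarrow> P (u @ v)) \<and> (\<forall>u. P u \<longrightarrow> P (winv u)) \<and>
     (\<forall>u v. bs_eq m n u v \<longrightarrow> P u \<longrightarrow> P v)"

definition wmem :: "int \<Rightarrow> int \<Rightarrow> word set set \<Rightarrow> word \<Rightarrow> bool" where
  "wmem m n \<Lambda> w \<longleftrightarrow> bs_class m n w \<in> \<Lambda>"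

lemma wsub_wmem: "\<Lambda> \<in> SubG m n \<Longrightarrow> wsub m n (wmem m n \<Lambda>)"
  unfolding SubG_def mem_Collect_eq wsub_def wmem_def
  by (metis BS_inv BS_mult BS_one bs_class_eq_iff subgroup.m_closed subgroup.m_inv_closed subgroup.one_closed)

lemma SubG_eqI:
  assumes "\<Lambda> \<in> SubG m n" "\<Lambda>' \<in> SubG m n" "\<And>w. wmem m n \<Lambda> w \<longleftrightarrow> wmem m n \<Lambda>' w"
  shows "\<Lambda> = \<Lambda>'"
proof -
  have "\<Lambda> \<subseteq> range (bs_class m n)" "\<Lambda>' \<subseteq> range (bs_class m n)"
    using assms(1,2) subgroup.subset by (auto simp: SubG_def BS_carrier[symmetric])
  then show ?thesis using assms(3) unfolding wmem_def by blast
qed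

definition of_words :: "int \<Rightarrow> int \<Rightarrow> (word \<Rightarrow> bool) \<Rightarrow> word set set" where
  "of_words m n P = bs_class m n ` Collect P"

lemma wmem_of_words: "wsub m n P \<Longrightarrow> wmem m n (of_words m n P) w \<longleftrightarrow> P w"
  unfolding wmem_def of_words_def wsub_def by (auto simp: bs_class_eq_iff) (metis bs_sym)

lemma of_words_SubG:
  assumes "wsub m n P" shows "of_words m n P \<in> SubG m n"
proof -
  have "subgroup (of_words m n P) (BS m n)"
  proof (rule group.subgroupI[OF BS_group])
    show "of_words m n P \<subseteq> carrier (BS m n)" by (auto simp: of_words_def BS_carrier)
    show "of_words m n P \<noteq> {}" using assms by (auto simp: of_words_def wsub_def)
  next
    fix a assume "a \<in> of_words m n P"
    then show "inv\<^bsub>BS m n\<^esub> a \<in> of_words m n P"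
      using assms by (auto simp: of_words_def wsub_def BS_inv)
  next
    fix a b assume "a \<in> of_words m n P" "b \<in> of_words m n P"
    then show "a \<otimes>\<^bsub>BS m n\<^esub> b \<in> of_words m n P"
      using assms by (auto simp: of_words_def wsub_def BS_mult)
  qed
  then show ?thesis by (simp add: SubG_def)
qed

definition wper :: "(word \<Rightarrow> bool) \<Rightarrow> nat \<Rightarrow> bool" where
  "wper P L \<longleftrightarrow> (\<forall>k. P (bpow k) \<longleftrightarrow> int L dvd k)"

definition few_orbits :: "(word \<Rightarrow> bool) \<Rightarrow> bool" where
  "few_orbits P \<longleftrightarrow> (\<exists>U. finite U \<and> (\<forall>w. \<exists>u\<in>U. \<exists>k. P (w @ winv (u @ bpow k))))"

context bs_action begin

definition stab :: "'a \<Rightarrow> word \<Rightarrow> bool" where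
  "stab x w \<longleftrightarrow> run \<beta> \<tau> w x = x"

lemma stab_diff:
  assumes "x \<in> C" shows "stab x (u @ winv v) \<longleftrightarrow> run \<beta> \<tau> u x = run \<beta> \<tau> v x"
  unfolding stab_def using assms
  by (metis comp_apply fold_append run_closed run_winv run_winv')

lemma wsub_stab:
  assumes "x \<in> C" shows "wsub m n (stab x)"
  unfolding wsub_def stab_def using assms run_bs_eq run_winv by (auto, metis+)

lemma wper_stab: "x \<in> C \<Longrightarrow> wper (stab x) L \<longleftrightarrow> has_per \<beta> x L"
  by (simp add: wper_def has_per_def stab_def)

lemma few_orbits_stab: "x \<in> C \<Longrightarrow> few_orbits (stab x) \<longleftrightarrow> fin_cover \<beta> \<tau> x"
  unfolding few_orbits_def fin_cover_def by (simp add: stab_diff del: winv_append)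

lemma stab_run:
  assumes "x \<in> C" shows "stab (run \<beta> \<tau> g x) w \<longleftrightarrow> stab x (g @ w @ winv g)"
  using assms stab_diff[of x "g @ w" g] by (simp add: stab_def)

end

definition coset :: "(word \<Rightarrow> bool) \<Rightarrow> word \<Rightarrow> word set" where
  "coset P w = {v. P (v @ winv w)}"

definition mv :: "(word \<Rightarrow> bool) \<Rightarrow> word \<Rightarrow> word set \<Rightarrow> word set" where
  "mv P u c = {v. \<exists>w\<in>c. P (v @ winv (w @ u))}"

lemma wsub_trans:
  assumes P: "wsub m n P" and "P (u @ winv v)" "P (v @ winv w)" shows "P (u @ winv w)"
proof -
  have "P (u @ winv v @ v @ winv w)" using assms unfolding wsub_def by (metis append_assoc)
  moreover have "bs_eq m n (u @ winv v @ v @ winv w) (u @ winv w)"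
    using bs_eq_append_left[OF bs_eq_append_right[OF bs_eq_winv_left]] by (metis append_Nil append_assoc)
  ultimately show ?thesis using P unfolding wsub_def by blast
qed

lemma wsub_sym: "wsub m n P \<Longrightarrow> P (u @ winv v) \<Longrightarrow> P (v @ winv u)"
  unfolding wsub_def by (metis winv_append winv_winv)

lemma wsub_refl: "wsub m n P \<Longrightarrow> P (u @ winv u)"
  unfolding wsub_def by (meson bs_eq_winv_right bs_sym)

lemma wsub_bs_eq: "wsub m n P \<Longrightarrow> bs_eq m n u v \<Longrightarrow> P u \<longleftrightarrow> P v"
  unfolding wsub_def by (meson bs_sym)

lemma coset_eq_iff:
  assumes P: "wsub m n P" shows "coset P u = coset P v \<longleftrightarrow> P (u @ winv v)"
proof
  assume "coset P u = coset P v"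
  moreover have "u \<in> coset P u" using wsub_refl[OF P] by (simp add: coset_def)
  ultimately show "P (u @ winv v)" by (simp add: coset_def)
next
  assume "P (u @ winv v)"
  then show "coset P u = coset P v"
    unfolding coset_def using wsub_trans[OF P] wsub_sym[OF P] by blast
qed

lemma coset_bs_eq:
  assumes "wsub m n P" "bs_eq m n u v" shows "coset P u = coset P v"
proof -
  have "bs_eq m n (u @ winv v) (v @ winv v)" using assms(2) by (rule bs_eq_append_right)
  then show ?thesis using assms coset_eq_iff wsub_bs_eq wsub_refl by metis
qed

lemma mv_coset:
  assumes P: "wsub m n P" shows "mv P u (coset P w) = coset P (w @ u)"
proof -
  have "P ((w' @ u) @ winv (w @ u)) \<longleftrightarrow> P (w' @ winv w)" for w'
  proof (rule wsub_bs_eq[OF P])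
    have "bs_eq m n (w' @ (u @ winv u) @ winv w) (w' @ [] @ winv w)"
      by (intro bs_eq_append_left bs_eq_append_right bs_eq_winv_right)
    then show "bs_eq m n ((w' @ u) @ winv (w @ u)) (w' @ winv w)" by simp
  qed
  then have "v \<in> mv P u (coset P w) \<longleftrightarrow> v \<in> coset P (w @ u)" for v
    unfolding mv_def coset_def mem_Collect_eq Bex_def
    using wsub_trans[OF P] wsub_sym[OF P] wsub_refl[OF P] by metis
  then show ?thesis by blast
qed

locale coset_action =
  fixes m n :: int and P :: "nat \<Rightarrow> word \<Rightarrow> bool"
  assumes m0: "m \<noteq> 0" and n0: "n \<noteq> 0" and P: "\<And>j. wsub m n (P j)"
begin

definition CC :: "(nat \<times> word set) set" where
  "CC = {(j, coset (P j) w) |j w. True}"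

definition cb :: "int \<Rightarrow> nat \<times> word set \<Rightarrow> nat \<times> word set" where
  "cb k x = (fst x, mv (P (fst x)) (bpow k) (snd x))"

definition ct :: "bool \<Rightarrow> nat \<times> word set \<Rightarrow> nat \<times> word set" where
  "ct e x = (fst x, mv (P (fst x)) [(GT, e)] (snd x))"

lemma cb_coset [simp]: "cb k (j, coset (P j) w) = (j, coset (P j) (w @ bpow k))"
  and ct_coset [simp]: "ct e (j, coset (P j) w) = (j, coset (P j) (w @ [(GT, e)]))"
  by (simp_all add: cb_def ct_def mv_coset[OF P])

sublocale bs_action m n CC cb ct
proof
  fix x k assume "x \<in> CC"
  then obtain j w where x: "x = (j, coset (P j) w)" by (auto simp: CC_def)
  show "cb k x \<in> CC" "ct e x \<in> CC" for e by (auto simp: x CC_def)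
  show "cb 0 x = x" by (simp add: x)
  show "cb (i + k) x = cb i (cb k x)" for i
    using coset_bs_eq[OF P bs_eq_append_left[OF bs_sym[OF bs_eq_bpow_add]], of j w k i] by (simp add: x add.commute)
  show "ct (\<not> e) (ct e x) = x" for e
    using coset_bs_eq[OF P bs_cancel[of m n w "(GT, e)" "[]"], of j] by (simp add: x)
  have "bs_eq m n (([(GT, True)] @ bpow m @ [(GT, False)]) @ [(GT, True)]) (bpow n @ [(GT, True)])"
    using bs_rel[of m n "[]" "[]"] by (intro bs_eq_append_right) simp
  moreover have "bs_eq m n (([(GT, True)] @ bpow m @ [(GT, False)]) @ [(GT, True)]) ([(GT, True)] @ bpow m)"
    using bs_cancel[of m n "[(GT, True)] @ bpow m" "(GT, False)" "[]"] by simp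
  ultimately have "bs_eq m n (bpow n @ [(GT, True)]) ([(GT, True)] @ bpow m)" by (meson bs_sym bs_trans)
  from coset_bs_eq[OF P bs_eq_append_left[OF this], of j w]
  show "ct True (cb n x) = cb m (ct True x)" by (simp add: x)
qed (rule m0 n0)+

lemma run_coset: "run cb ct w (j, coset (P j) u) = (j, coset (P j) (u @ w))"
proof (induction w arbitrary: u)
  case (Cons l w)
  have "lact cb ct l (j, coset (P j) u) = (j, coset (P j) (u @ [l]))"
    by (cases "(cb, ct, l, (j, coset (P j) u))" rule: lact.cases) auto
  then show ?case using Cons[of "u @ [l]"] by simp
qed simp

lemma base_in_CC: "(j, coset (P j) []) \<in> CC"
  by (auto simp: CC_def)

lemma stab_base: "stab (j, coset (P j) []) = P j"
proof
  fix w
  show "stab (j, coset (P j) []) w = P j w" by (simp add: stab_def run_coset coset_eq_iff[OF P])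
qed

lemma fst_cb [simp]: "fst (cb k x) = fst x" and fst_ct [simp]: "fst (ct e x) = fst x"
  by (simp_all add: cb_def ct_def)

end

subsection \<open>Linking subgroups of the same phenotype\<close>

lemma bpow_diff_mem:
  assumes P: "wsub m n P" and eq: "bs_class m n (bpow a) = bs_class m n (bpow b)"
  shows "P (bpow (a - b))"
proof -
  have "bs_eq m n (bpow a @ bpow (- b)) (bpow b @ bpow (- b))"
    using eq bs_class_eq_iff bs_eq_append_right by metis
  then have "bs_eq m n (bpow (a - b)) []"
    using bs_eq_bpow_add[of m n a "- b"] bs_eq_bpow_add[of m n b "- b"]
    by simp (meson bs_sym bs_trans)
  then show ?thesis using P unfolding wsub_def by (meson bs_sym)
qed

lemma b_index_wper:
  assumes \<Lambda>: "\<Lambda> \<in> SubG m n" and L: "wper (wmem m n \<Lambda>) L"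
  shows "b_index m n \<Lambda> = (if L = 0 then \<infinity> else enat L)"
proof -
  define cc where "cc k = {bs_class m n (bpow (i + k)) |i. int L dvd i}" for k
  have mem: "bs_class m n (bpow k) \<in> \<Lambda> \<longleftrightarrow> int L dvd k" for k using L by (simp add: wper_def wmem_def)
  have inter: "b_sub m n \<inter> \<Lambda> = {bs_class m n (bpow i) |i. int L dvd i}"
    unfolding b_sub_def bs_b_int_pow using mem by auto
  have cos: "(b_sub m n \<inter> \<Lambda>) #>\<^bsub>BS m n\<^esub> bs_class m n (bpow k) = cc k" for k
  proof -
    have "bs_class m n (bpow i) \<otimes>\<^bsub>BS m n\<^esub> bs_class m n (bpow k) = bs_class m n (bpow (i + k))" for i
      unfolding BS_mult bs_class_bpow_add ..
    then show ?thesis unfolding inter r_coset_def cc_def by blast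
  qed
  have Ceq: "{(b_sub m n \<inter> \<Lambda>) #>\<^bsub>BS m n\<^esub> g |g. g \<in> b_sub m n} = range cc"
    unfolding cos[symmetric] b_sub_def bs_b_int_pow by auto
  have cc_eq: "cc k = cc j \<longleftrightarrow> int L dvd k - j" for k j
  proof
    assume eq: "cc k = cc j"
    have "bs_class m n (bpow (0 + k)) \<in> cc k" unfolding cc_def by blast
    then obtain i where i: "int L dvd i" "bs_class m n (bpow k) = bs_class m n (bpow (i + j))"
      unfolding eq unfolding cc_def by auto
    have "int L dvd k - (i + j)"
      using bpow_diff_mem[OF wsub_wmem[OF \<Lambda>] i(2)] L by (simp add: wper_def)
    then have "int L dvd k - (i + j) + i" using i(1) by (rule dvd_add)
    then show "int L dvd k - j" by (simp add: algebra_simps)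
  next
    have sub: "cc k \<subseteq> cc j" if "int L dvd k - j" for k j
    proof
      fix y assume "y \<in> cc k"
      then obtain i where i: "int L dvd i" "y = bs_class m n (bpow (i + k))" by (auto simp: cc_def)
      then have "int L dvd i + (k - j)" "y = bs_class m n (bpow ((i + (k - j)) + j))"
        using that by (auto intro: dvd_add)
      then show "y \<in> cc j" unfolding cc_def by blast
    qed
    assume "int L dvd k - j"
    then show "cc k = cc j" using sub[of k j] sub[of j k] by (simp add: dvd_diff_commute)
  qed
  show ?thesis
  proof (cases "L = 0")
    case True
    then have "inj cc" by (auto intro!: injI simp: cc_eq)
    then have "infinite (range cc)" using finite_imageD infinite_UNIV_int by blast
    then show ?thesis using True unfolding b_index_def Ceq by simp
  next
    case False
    have "range cc = cc ` {0..<int L}"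
    proof -
      have "cc k \<in> cc ` {0..<int L}" for k
        using False by (intro image_eqI[of _ _ "k mod int L"]) (auto simp: cc_eq)
      then show ?thesis by blast
    qed
    moreover have "inj_on cc {0..<int L}"
      by (auto intro!: inj_onI simp: cc_eq) (metis mod_eq_dvd_iff mod_pos_pos_trivial)
    ultimately have "finite (range cc)" "card (range cc) = L" by (simp_all add: card_image)
    then show ?thesis using False unfolding b_index_def Ceq by simp
  qed
qed

lemma PH_eq_iff_same_ph:
  assumes "\<Lambda> \<in> SubG m n" "wper (wmem m n \<Lambda>) L" "\<Lambda>' \<in> SubG m n" "wper (wmem m n \<Lambda>') L'"
  shows "PH m n \<Lambda> = PH m n \<Lambda>' \<longleftrightarrow> same_ph m n L L'"
proof -
  have inf: "Ph m n \<infinity> = \<infinity>" "Ph m n (enat l) \<noteq> \<infinity>" "\<infinity> \<noteq> Ph m n (enat l)" for l by (simp_all add: Ph_def)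
  show ?thesis
  proof (cases "L = 0 \<or> L' = 0")
    case True
    then show ?thesis using inf
      by (auto simp: PH_def b_index_wper[OF assms(1,2)] b_index_wper[OF assms(3,4)] same_ph_def)
  next
    case False
    then show ?thesis using Ph_eq_iff_same_ph[of L L' m n]
      by (simp add: PH_def b_index_wper[OF assms(1,2)] b_index_wper[OF assms(3,4)])
  qed
qed

definition Sq :: "int \<Rightarrow> int \<Rightarrow> enat \<Rightarrow> word set set set" where
  "Sq m n q = {\<Lambda> \<in> SubG m n. \<not> few_orbits (wmem m n \<Lambda>) \<and> PH m n \<Lambda> = q}"

definition agree :: "int \<Rightarrow> int \<Rightarrow> nat \<Rightarrow> word set set \<Rightarrow> word set set \<Rightarrow> bool" where
  "agree m n R \<Lambda> \<Lambda>' \<longleftrightarrow> (\<forall>w. length w \<le> R \<longrightarrow> wmem m n \<Lambda> w = wmem m n \<Lambda>' w)"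

lemma conj_act_of_words:
  assumes P: "wsub m n P"
  shows "conj_act m n (of_words m n P) (bs_class m n g) = of_words m n (\<lambda>w. P (g @ w @ winv g))"
proof -
  have e: "bs_eq m n (g @ (winv g @ w @ g) @ winv g) w" for w g
  proof -
    have "bs_eq m n ((g @ winv g) @ w @ (g @ winv g)) ([] @ w @ [])"
      by (intro bs_eq_append bs_eq_winv_right bs_refl)
    then show ?thesis by simp
  qed
  have "conj_act m n (of_words m n P) (bs_class m n g) = {bs_class m n (winv g @ w @ g) |w. P w}"
    unfolding conj_act_def of_words_def BS_inv image_image BS_mult by auto
  also have "\<dots> = bs_class m n ` {w. P (g @ w @ winv g)}"
  proof (intro equalityI subsetI)
    fix y assume "y \<in> {bs_class m n (winv g @ w @ g) |w. P w}"
    then obtain w where w: "y = bs_class m n (winv g @ w @ g)" "P w" by blast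
    have "P (g @ (winv g @ w @ g) @ winv g)" using wsub_bs_eq[OF P e[of g w]] w(2) by simp
    then show "y \<in> bs_class m n ` {w. P (g @ w @ winv g)}" using w(1) by blast
  next
    fix y assume "y \<in> bs_class m n ` {w. P (g @ w @ winv g)}"
    then obtain w where w: "y = bs_class m n w" "P (g @ w @ winv g)" by blast
    have "y = bs_class m n (winv g @ (g @ w @ winv g) @ g)"
      using e[of "winv g" w] w(1) bs_class_eq_iff[of m n] by (metis append_assoc winv_winv)
    then show "y \<in> {bs_class m n (winv g @ w @ g) |w. P w}" using w(2) by blast
  qed
  finally show ?thesis by (simp add: of_words_def)
qed

context bs_action begin

lemma stab_in_Sq:
  assumes x: "x \<in> C" and fc: "\<not> fin_cover \<beta> \<tau> x" and L: "has_per \<beta> x L"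
    and \<Lambda>: "\<Lambda> \<in> SubG m n" "wper (wmem m n \<Lambda>) L'" "same_ph m n L' L"
  shows "of_words m n (stab x) \<in> Sq m n (PH m n \<Lambda>)"
proof -
  note w = wmem_of_words[OF wsub_stab[OF x]]
  have e: "wmem m n (of_words m n (stab x)) = stab x" using w by blast
  have S: "of_words m n (stab x) \<in> SubG m n" by (rule of_words_SubG[OF wsub_stab[OF x]])
  have "wper (wmem m n (of_words m n (stab x))) L" unfolding e using wper_stab[OF x] L by simp
  then have "PH m n \<Lambda> = PH m n (of_words m n (stab x))" using PH_eq_iff_same_ph \<Lambda> S by blast
  then show ?thesis using S fc few_orbits_stab[OF x] by (simp add: Sq_def e)
qed

end

lemma Sq_linking:
  fixes I :: "nat set" and \<Lambda> \<Lambda>' :: "nat \<Rightarrow> word set set"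
  assumes m2: "\<bar>m\<bar> \<ge> 2" and n2: "\<bar>n\<bar> \<ge> 2" and I: "finite I"
    and S: "\<And>i. i \<in> I \<Longrightarrow> \<Lambda> i \<in> Sq m n q" "\<And>i. i \<in> I \<Longrightarrow> \<Lambda>' i \<in> Sq m n q"
  shows "\<exists>\<gamma>. \<forall>i\<in>I. \<exists>\<Delta>\<in>Sq m n q. agree m n R \<Delta> (\<Lambda> i) \<and>
     conj_act m n \<Delta> (bs_class m n \<gamma>) \<in> Sq m n q \<and> agree m n R (conj_act m n \<Delta> (bs_class m n \<gamma>)) (\<Lambda>' i)"
proof -
  define H where "H j = (if even j then \<Lambda> (j div 2) else \<Lambda>' (j div 2))" for j
  define P where "P j = (if j div 2 \<in> I then wmem m n (H j) else (\<lambda>_. True))" for j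
  have HS: "H j \<in> Sq m n q" if "j div 2 \<in> I" for j using S that by (auto simp: H_def)
  interpret coset_action m n P
  proof
    fix j
    show "wsub m n (P j)"
    proof (cases "j div 2 \<in> I")
      case True
      then have "H j \<in> SubG m n" using HS by (auto simp: Sq_def)
      then show ?thesis using True wsub_wmem by (simp add: P_def)
    next
      case False
      then show ?thesis by (simp add: P_def wsub_def)
    qed
  qed (use m2 n2 in auto)
  define pt where "pt j = (j, coset (P j) [])" for j
  have ptC: "pt j \<in> CC" for j using base_in_CC by (simp add: pt_def)
  have st: "stab (pt j) = wmem m n (H j)" if "j div 2 \<in> I" for j
    unfolding pt_def stab_base using that by (simp add: P_def)
  define X where "X i = pt (2 * i)" for i
  define Y where "Y i = pt (2 * i + 1)" for i
  have pts: "\<exists>j. x = pt j \<and> j div 2 \<in> I" if "x \<in> X ` I \<union> Y ` I" for x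
  proof -
    from that consider i where "i \<in> I" "x = pt (2 * i)" | i where "i \<in> I" "x = pt (2 * i + 1)"
      by (auto simp: X_def Y_def)
    then show ?thesis
    proof cases
      case (1 i)
      then show ?thesis by (intro exI[of _ "2 * i"]) simp
    next
      case (2 i)
      then show ?thesis by (intro exI[of _ "2 * i + 1"]) simp
    qed
  qed
  have pph: "same_ph m n L L'"
    if x: "x \<in> X ` I \<union> Y ` I" and y: "y \<in> X ` I \<union> Y ` I" and L: "has_per cb x L" "has_per cb y L'" for x y L L'
  proof -
    obtain i j where ij: "x = pt i" "i div 2 \<in> I" "y = pt j" "j div 2 \<in> I" using pts x y by metis
    have "wper (wmem m n (H i)) L" "wper (wmem m n (H j)) L'"
      using L wper_stab[OF ptC] st ij by metis+
    then show ?thesis using PH_eq_iff_same_ph[of "H i" m n L "H j" L'] HS[OF ij(2)] HS[OF ij(4)]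
      by (auto simp: Sq_def)
  qed
  have pfc: "\<not> fin_cover cb ct x" if x: "x \<in> X ` I \<union> Y ` I" for x
  proof -
    obtain i where i: "x = pt i" "i div 2 \<in> I" using pts x by metis
    then show ?thesis using few_orbits_stab[OF ptC, of i] st[OF i(2)] HS[OF i(2)] by (simp add: Sq_def)
  qed
  have XYC: "X ` I \<union> Y ` I \<subseteq> CC" using ptC by (auto simp: X_def Y_def)
  have "\<exists>\<gamma>. \<forall>i\<in>I. \<exists>(C' :: (nat \<times> word set) pt set) \<beta>' \<tau>' x' y'. bs_action m n C' \<beta>' \<tau>' \<and> x' \<in> C' \<and> y' \<in> C' \<and>
     realizes R cb ct (X i) \<beta>' \<tau>' x' \<and> realizes R cb ct (Y i) \<beta>' \<tau>' y' \<and> run \<beta>' \<tau>' \<gamma> x' = y'"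
    by (rule common_linking[where lab = fst, OF m2 n2 _ _ I _ XYC])
      (use pfc pph in \<open>auto simp: X_def Y_def pt_def\<close>)
  then obtain \<gamma> where \<gamma>: "\<forall>i\<in>I. \<exists>(C' :: (nat \<times> word set) pt set) \<beta>' \<tau>' x' y'. bs_action m n C' \<beta>' \<tau>' \<and> x' \<in> C' \<and> y' \<in> C' \<and>
     realizes R cb ct (X i) \<beta>' \<tau>' x' \<and> realizes R cb ct (Y i) \<beta>' \<tau>' y' \<and> run \<beta>' \<tau>' \<gamma> x' = y'"
    by (rule exE)
  show ?thesis
  proof (intro exI[of _ \<gamma>] ballI)
    fix i assume i: "i \<in> I"
    from bspec[OF \<gamma> i] obtain C' :: "(nat \<times> word set) pt set" and \<beta>' \<tau>' x' y' where
      act: "bs_action m n C' \<beta>' \<tau>'" and xy: "x' \<in> C'" "y' \<in> C'"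
      and rl: "realizes R cb ct (X i) \<beta>' \<tau>' x'" "realizes R cb ct (Y i) \<beta>' \<tau>' y'" and link: "run \<beta>' \<tau>' \<gamma> x' = y'"
      by (elim exE conjE)
    interpret Z: bs_action m n C' \<beta>' \<tau>' by (rule act)
    have key: "of_words m n (Z.stab z) \<in> Sq m n q \<and> agree m n R (of_words m n (Z.stab z)) (H j)"
      if z: "z \<in> C'" "realizes R cb ct (pt j) \<beta>' \<tau>' z" and j: "j div 2 \<in> I" for z j
    proof -
      obtain L where L: "has_per cb (pt j) L" using has_per_exists[OF ptC] by blast
      have wL: "wper (wmem m n (H j)) L" using L wper_stab[OF ptC] st[OF j] by metis
      have L': "has_per \<beta>' z L" using L z(2) by (simp add: has_per_def realizes_def)
      have "of_words m n (Z.stab z) \<in> Sq m n (PH m n (H j))"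
        by (rule Z.stab_in_Sq[OF z(1) _ L' _ wL])
          (use z(2) HS[OF j] in \<open>auto simp: realizes_def Sq_def same_ph_def\<close>)
      moreover have "agree m n R (of_words m n (Z.stab z)) (H j)"
        using z(2) st[OF j] unfolding agree_def realizes_def
        by (simp add: wmem_of_words[OF Z.wsub_stab[OF z(1)]] Z.stab_def flip: stab_def)
      ultimately show ?thesis using HS[OF j] by (auto simp: Sq_def)
    qed
    have "(2 * i) div 2 = i" "(2 * i + 1) div 2 = i" by auto
    then have d: "(2 * i) div 2 \<in> I" "(2 * i + 1) div 2 \<in> I" using i by auto
    have H: "H (2 * i) = \<Lambda> i" "H (2 * i + 1) = \<Lambda>' i" by (auto simp: H_def)
    have "conj_act m n (of_words m n (Z.stab x')) (bs_class m n \<gamma>) = of_words m n (Z.stab y')"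
      unfolding conj_act_of_words[OF Z.wsub_stab[OF xy(1)]] link[symmetric]
      using Z.stab_run[OF xy(1), of \<gamma>] by presburger
    then show "\<exists>\<Delta>\<in>Sq m n q. agree m n R \<Delta> (\<Lambda> i) \<and>
     conj_act m n \<Delta> (bs_class m n \<gamma>) \<in> Sq m n q \<and> agree m n R (conj_act m n \<Delta> (bs_class m n \<gamma>)) (\<Lambda>' i)"
      using key[OF xy(1) rl(1)[unfolded X_def] d(1)] key[OF xy(2) rl(2)[unfolded Y_def] d(2)] H by auto
  qed
qed

lemma Sq_two_elements:
  assumes m2: "\<bar>m\<bar> \<ge> 2" and n2: "\<bar>n\<bar> \<ge> 2" and \<Lambda>: "\<Lambda> \<in> Sq m n q"
  shows "\<exists>\<Lambda>1\<in>Sq m n q. \<exists>\<Lambda>2\<in>Sq m n q. \<Lambda>1 \<noteq> \<Lambda>2"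
proof -
  have S: "\<Lambda> \<in> SubG m n" "PH m n \<Lambda> = q" "\<not> few_orbits (wmem m n \<Lambda>)" using \<Lambda> by (auto simp: Sq_def)
  interpret coset_action m n "\<lambda>_. wmem m n \<Lambda>"
    using m2 n2 wsub_wmem[OF S(1)] by unfold_locales auto
  let ?x = "(0, coset (wmem m n \<Lambda>) [])"
  have x: "?x \<in> CC" by (rule base_in_CC)
  have st: "stab ?x = wmem m n \<Lambda>" by (rule stab_base)
  obtain L where L: "has_per cb ?x L" using has_per_exists[OF x] by blast
  then have wL: "wper (wmem m n \<Lambda>) L" using wper_stab[OF x] st by metis
  have fc: "\<not> fin_cover cb ct ?x" using few_orbits_stab[OF x] st S(3) by metis
  from two_stabilizers[OF m2 n2 x fc L]
  obtain C' :: "(nat \<times> word set) pt set" and \<beta>' \<tau>1 \<tau>2 z l L' where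
    *: "bs_action m n C' \<beta>' \<tau>1" "bs_action m n C' \<beta>' \<tau>2" "z \<in> C'"
     "\<not> fin_cover \<beta>' \<tau>1 z" "\<not> fin_cover \<beta>' \<tau>2 z" "has_per \<beta>' z L'" "same_ph m n L L'"
     "run \<beta>' \<tau>1 l z \<noteq> z" "run \<beta>' \<tau>2 l z = z" by (elim exE conjE)
  interpret A1: bs_action m n C' \<beta>' \<tau>1 by (rule *)
  interpret A2: bs_action m n C' \<beta>' \<tau>2 by (rule *)
  have "wmem m n (of_words m n (A2.stab z)) l" "\<not> wmem m n (of_words m n (A1.stab z)) l"
    using wmem_of_words[OF A1.wsub_stab[OF *(3)]] wmem_of_words[OF A2.wsub_stab[OF *(3)]] *(8,9)
    by (simp_all add: A1.stab_def A2.stab_def)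
  then have "of_words m n (A1.stab z) \<noteq> of_words m n (A2.stab z)" by auto
  then show ?thesis
    using A1.stab_in_Sq[OF *(3,4,6) S(1) wL *(7)] A2.stab_in_Sq[OF *(3,5,6) S(1) wL *(7)] S(2) by blast
qed

subsection \<open>The space of subgroups\<close>

lemma topspace_Sub_top: "topspace (Sub_top m n) = SubG m n"
proof -
  have "SubG m n \<in> {{\<Lambda> \<in> SubG m n. I \<subseteq> \<Lambda> \<and> Ex \<inter> \<Lambda> = {}} | I Ex. finite I \<and> finite Ex}"
    by (rule CollectI, rule exI[of _ "{}"], rule exI[of _ "{}"]) auto
  then show ?thesis unfolding Sub_top_def topspace_subtopology topology_generated_by_topspace by blast
qed

lemma Sub_top_nbhd:
  assumes T: "openin (Sub_top m n) T" and \<Lambda>: "\<Lambda> \<in> T"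
  shows "\<exists>R. \<forall>\<Lambda>'\<in>SubG m n. agree m n R \<Lambda>' \<Lambda> \<longrightarrow> \<Lambda>' \<in> T"
proof -
  let ?B = "{{\<Lambda> \<in> SubG m n. I \<subseteq> \<Lambda> \<and> Ex \<inter> \<Lambda> = {}} | I Ex. finite I \<and> finite Ex}"
  obtain T' where T': "openin (topology_generated_by ?B) T'" "T = T' \<inter> SubG m n"
    using T unfolding Sub_top_def openin_subtopology by blast
  have "generate_topology_on ?B T'" using T'(1) by (rule openin_topology_generated_by)
  then have "\<forall>\<Lambda>\<in>T' \<inter> SubG m n. \<exists>R. \<forall>\<Lambda>'\<in>SubG m n. agree m n R \<Lambda>' \<Lambda> \<longrightarrow> \<Lambda>' \<in> T'"
  proof (induction rule: generate_topology_on.induct)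
    case (Int a b)
    show ?case
    proof
      fix \<Lambda> assume \<Lambda>: "\<Lambda> \<in> a \<inter> b \<inter> SubG m n"
      obtain R R' where R: "\<forall>\<Lambda>'\<in>SubG m n. agree m n R \<Lambda>' \<Lambda> \<longrightarrow> \<Lambda>' \<in> a"
         "\<forall>\<Lambda>'\<in>SubG m n. agree m n R' \<Lambda>' \<Lambda> \<longrightarrow> \<Lambda>' \<in> b" using Int.IH \<Lambda> by blast
      have "agree m n (max R R') \<Lambda>' \<Lambda> \<Longrightarrow> agree m n R \<Lambda>' \<Lambda> \<and> agree m n R' \<Lambda>' \<Lambda>" for \<Lambda>'
        by (auto simp: agree_def)
      then show "\<exists>R. \<forall>\<Lambda>'\<in>SubG m n. agree m n R \<Lambda>' \<Lambda> \<longrightarrow> \<Lambda>' \<in> a \<inter> b" using R by blast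
    qed
  next
    case (UN K)
    then show ?case by blast
  next
    case (Basis s)
    then obtain I Ex where s: "s = {\<Lambda> \<in> SubG m n. I \<subseteq> \<Lambda> \<and> Ex \<inter> \<Lambda> = {}}" and fin: "finite I" "finite Ex"
      by blast
    show ?case
    proof
      fix \<Lambda> assume \<Lambda>: "\<Lambda> \<in> s \<inter> SubG m n"
      define r where "r c = (SOME w. bs_class m n w = c)" for c
      have r: "bs_class m n (r c) = c" if "c \<in> range (bs_class m n)" for c
        using that someI_ex[of "\<lambda>w. bs_class m n w = c"] by (auto simp: r_def)
      define R where "R = (\<Sum>c\<in>I \<union> Ex. length (r c))"
      have R: "length (r c) \<le> R" if "c \<in> I \<union> Ex" for c
        unfolding R_def using fin that by (intro member_le_sum) auto
      have sub: "\<Delta> \<subseteq> range (bs_class m n)" if "\<Delta> \<in> SubG m n" for \<Delta>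
        using that subgroup.subset by (auto simp: SubG_def BS_carrier[symmetric])
      have "\<Lambda>' \<in> s" if \<Lambda>': "\<Lambda>' \<in> SubG m n" "agree m n R \<Lambda>' \<Lambda>" for \<Lambda>'
      proof -
        have "c \<in> \<Lambda>' \<longleftrightarrow> c \<in> \<Lambda>" if c: "c \<in> I \<union> Ex" for c
        proof (cases "c \<in> range (bs_class m n)")
          case True
          have "wmem m n \<Lambda>' (r c) = wmem m n \<Lambda> (r c)" using \<Lambda>'(2) R[OF c] by (simp add: agree_def)
          then show ?thesis using r[OF True] by (simp add: wmem_def)
        next
          case False
          then show ?thesis using sub \<Lambda>'(1) \<Lambda> by blast
        qed
        then show ?thesis using \<Lambda> \<Lambda>'(1) unfolding s by blast
      qed
      then show "\<exists>R. \<forall>\<Lambda>'\<in>SubG m n. agree m n R \<Lambda>' \<Lambda> \<longrightarrow> \<Lambda>' \<in> s" by blast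
    qed
  qed simp
  then show ?thesis using T'(2) \<Lambda> by blast
qed

lemma Sq_dense_in_itself:
  assumes m2: "\<bar>m\<bar> \<ge> 2" and n2: "\<bar>n\<bar> \<ge> 2"
  shows "Sq m n q \<subseteq> Sub_top m n derived_set_of Sq m n q"
proof
  fix \<Lambda> assume \<Lambda>: "\<Lambda> \<in> Sq m n q"
  have "\<exists>y. y \<noteq> \<Lambda> \<and> y \<in> Sq m n q \<and> y \<in> T" if T: "\<Lambda> \<in> T" "openin (Sub_top m n) T" for T
  proof (rule ccontr)
    assume iso: "\<not> ?thesis"
    obtain R where R: "\<forall>\<Lambda>'\<in>SubG m n. agree m n R \<Lambda>' \<Lambda> \<longrightarrow> \<Lambda>' \<in> T" using Sub_top_nbhd[OF T(2,1)] by blast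
    have "\<Delta> = \<Lambda>" if \<Delta>: "\<Delta> \<in> Sq m n q" for \<Delta>
    proof (rule SubG_eqI)
      fix w :: word
      define R' where "R' = max R (length w)"
      define Y where "Y i = (if i = (0::nat) then \<Lambda> else \<Delta>)" for i
      have "\<exists>\<gamma>. \<forall>i\<in>{0, 1}. \<exists>\<Theta>\<in>Sq m n q. agree m n R' \<Theta> \<Lambda> \<and>
        conj_act m n \<Theta> (bs_class m n \<gamma>) \<in> Sq m n q \<and> agree m n R' (conj_act m n \<Theta> (bs_class m n \<gamma>)) (Y i)"
        by (rule Sq_linking[where \<Lambda> = "\<lambda>_. \<Lambda>", OF m2 n2]) (use \<Lambda> \<Delta> in \<open>auto simp: Y_def\<close>)
      then obtain \<gamma> where \<gamma>: "\<forall>i\<in>{0, 1}. \<exists>\<Theta>\<in>Sq m n q. agree m n R' \<Theta> \<Lambda> \<and>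
        conj_act m n \<Theta> (bs_class m n \<gamma>) \<in> Sq m n q \<and> agree m n R' (conj_act m n \<Theta> (bs_class m n \<gamma>)) (Y i)"
        by blast
      have "\<Theta> = \<Lambda>" if "\<Theta> \<in> Sq m n q" "agree m n R' \<Theta> \<Lambda>" for \<Theta>
      proof -
        have "agree m n R \<Theta> \<Lambda>" using that(2) by (simp add: agree_def R'_def)
        then have "\<Theta> \<in> T" using R that(1) by (simp add: Sq_def)
        then show ?thesis using iso that(1) by blast
      qed
      then have "agree m n R' (conj_act m n \<Lambda> (bs_class m n \<gamma>)) (Y i)" if "i \<in> {0, 1}" for i
        using \<gamma> that by blast
      from this[of 0] this[of 1] show "wmem m n \<Delta> w = wmem m n \<Lambda> w"
        by (simp add: Y_def agree_def R'_def)
    qed (use \<Lambda> \<Delta> in \<open>auto simp: Sq_def\<close>)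
    then show False using Sq_two_elements[OF m2 n2 \<Lambda>] by blast
  qed
  moreover have "\<Lambda> \<in> topspace (Sub_top m n)" using \<Lambda> by (simp add: topspace_Sub_top Sq_def)
  ultimately show "\<Lambda> \<in> Sub_top m n derived_set_of Sq m n q" unfolding in_derived_set_of by blast
qed

lemma few_orbits_finitely_generated:
  assumes m0: "m \<noteq> 0" and n0: "n \<noteq> 0" and P: "wsub m n P" and few: "few_orbits P"
  shows "\<exists>F. finite F \<and> (\<forall>w\<in>F. P w) \<and>
    (\<forall>P'. wsub m n P' \<longrightarrow> (\<forall>w\<in>F. P' w) \<longrightarrow> (\<forall>w. P w \<longrightarrow> P' w))"
proof -
  interpret X: coset_action m n "\<lambda>_. P" using m0 n0 P by unfold_locales
  let ?x = "(0, coset P [])"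
  have xC: "?x \<in> X.CC" by (rule X.base_in_CC)
  have stx: "X.stab ?x = P" by (rule X.stab_base)
  obtain U where U: "finite U" "\<And>w. \<exists>u\<in>U. \<exists>k. P (w @ winv (u @ bpow k))"
    using few unfolding few_orbits_def by blast
  obtain fu fs where fus: "\<And>w. fu w \<in> U \<and> P (w @ winv (fu w @ bpow (fs w)))" using U(2) by metis
  define V where "V = insert [] U"
  have Vfin: "finite V" using U by (simp add: V_def)
  have "\<exists>L. \<forall>k. P (u @ bpow k @ winv u) \<longleftrightarrow> int L dvd k" for u
  proof -
    have ux: "run X.cb X.ct u ?x \<in> X.CC" using xC by simp
    obtain L where "wper (X.stab (run X.cb X.ct u ?x)) L"
      using X.has_per_exists[OF ux] X.wper_stab[OF ux] by blast
    then show ?thesis using X.stab_run[OF xC, of u] stx by (auto simp: wper_def)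
  qed
  then obtain Lf where Lf: "\<And>u k. P (u @ bpow k @ winv u) \<longleftrightarrow> int (Lf u) dvd k" by metis
  define Vb where "Vb = {u \<in> V. \<exists>k. P (u @ bpow k)}"
  have "\<exists>k. P (u @ bpow k)" if "u \<in> Vb" for u using that by (auto simp: Vb_def)
  then obtain \<kappa> where \<kappa>: "\<And>u. u \<in> Vb \<Longrightarrow> P (u @ bpow (\<kappa> u))" by metis
  define stp where "stp = (\<lambda>(u, e, r). u @ bpow r @ [(GT, e)])"
  define D where "D = V \<times> (UNIV :: bool set) \<times> {- (\<bar>m\<bar> + \<bar>n\<bar>)..\<bar>m\<bar> + \<bar>n\<bar>}"
  define F1 where "F1 = (\<lambda>w. w @ winv (fu w @ bpow (fs w))) ` stp ` D"
  define F2 where "F2 = (\<lambda>u. u @ bpow (\<kappa> u)) ` Vb"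
  define F3 where "F3 = (\<lambda>u. u @ bpow (int (Lf u)) @ winv u) ` V"
  have fin: "finite (F1 \<union> F2 \<union> F3)" using Vfin by (simp add: F1_def F2_def F3_def D_def Vb_def)
  have PF: "P w" if "w \<in> F1 \<union> F2 \<union> F3" for w
    using that fus \<kappa> Lf by (auto simp: F1_def F2_def F3_def simp del: winv_append)
  have gen: "P' w" if P': "wsub m n P'" and F: "\<forall>w\<in>F1 \<union> F2 \<union> F3. P' w" and w: "P w" for P' w
  proof -
    define Q where "Q v \<longleftrightarrow> P v \<and> P' v" for v
    have Q: "wsub m n Q" using P P' unfolding wsub_def Q_def by blast
    have QF: "Q v" if "v \<in> F1 \<union> F2 \<union> F3" for v using that PF F by (simp add: Q_def)
    interpret K: coset_action m n "\<lambda>_. Q" using m0 n0 Q by unfold_locales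
    let ?r = "run K.cb K.ct"
    let ?y = "(0, coset Q [])"
    have yC: "?y \<in> K.CC" by (rule K.base_in_CC)
    have sty: "K.stab ?y = Q" by (rule K.stab_base)
    have diff: "Q (u @ winv v) \<longleftrightarrow> ?r u ?y = ?r v ?y" for u v using K.stab_diff[OF yC] sty by metis
    have cov: "\<exists>u\<in>V. \<exists>k. ?r v ?y = K.cb k (?r u ?y)" for v
    proof (induction v rule: rev_induct)
      case Nil
      have "?r [] ?y = K.cb 0 (?r [] ?y)" using yC by simp
      then show ?case unfolding V_def by blast
    next
      case (snoc l v)
      then obtain u k where u: "u \<in> V" "?r v ?y = K.cb k (?r u ?y)" by blast
      let ?z = "?r u ?y"
      have zC: "?z \<in> K.CC" using yC by simp
      obtain g e where l: "l = (g, e)" by (cases l)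
      show ?case
      proof (cases g)
        case GB
        have "?r (v @ [l]) ?y = K.cb ((if e then 1 else -1) + k) ?z"
          using u l GB zC by (simp add: K.beta_add)
        then show ?thesis using u(1) by blast
      next
        case GT
        define r where "r = k mod K.Ca e"
        define c where "c = k div K.Ca e"
        have k: "k = K.Ca e * c + r" by (simp add: r_def c_def)
        have "\<bar>r\<bar> < \<bar>K.Ca e\<bar>" unfolding r_def using K.Ca_neq_0 by (rule abs_mod_less)
        then have r: "\<bar>r\<bar> \<le> \<bar>m\<bar> + \<bar>n\<bar>" by (cases e) auto
        define s where "s = u @ bpow r @ [(GT, e)]"
        have "(u, e, r) \<in> D" using u(1) r by (auto simp: D_def)
        then have "s \<in> stp ` D" unfolding s_def stp_def by (rule rev_image_eqI) simp
        then have "Q (s @ winv (fu s @ bpow (fs s)))" using QF by (simp add: F1_def del: winv_append)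
        then have "?r s ?y = ?r (fu s @ bpow (fs s)) ?y" unfolding diff .
        then have rs: "?r s ?y = K.cb (fs s) (?r (fu s) ?y)" using yC by simp
        have "?r (v @ [l]) ?y = K.ct e (K.cb (K.Ca e * c) (K.cb r ?z))"
          using u l GT zC k by (simp add: K.beta_add)
        also have "\<dots> = K.cb (K.Mo e * c) (?r s ?y)"
          using zC by (simp add: K.tau_beta_gen s_def)
        also have "\<dots> = K.cb (K.Mo e * c + fs s) (?r (fu s) ?y)"
          unfolding rs using yC by (simp add: K.beta_add)
        finally show ?thesis using fus[of s] unfolding V_def by blast
      qed
    qed
    obtain u k where u: "u \<in> V" "?r w ?y = K.cb k (?r u ?y)" using cov by blast
    have zC: "?r u ?y \<in> K.CC" using yC by simp
    have rw: "?r w ?y = ?r (u @ bpow k) ?y" using u yC by simp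
    then have "Q (w @ winv (u @ bpow k))" unfolding diff .
    then have "X.stab ?x (w @ winv (u @ bpow k))" unfolding stx Q_def ..
    then have xw: "run X.cb X.ct w ?x = run X.cb X.ct (u @ bpow k) ?x" using X.stab_diff[OF xC] by blast
    have xw1: "run X.cb X.ct w ?x = ?x" using w stx by (simp add: X.stab_def[symmetric])
    then have "X.stab ?x (u @ bpow k)" unfolding X.stab_def using xw by simp
    then have Puk: "P (u @ bpow k)" using stx by simp
    then have uVb: "u \<in> Vb" using u(1) by (auto simp: Vb_def)
    then have Quk: "Q (u @ bpow (\<kappa> u))" using QF by (simp add: F2_def)
    then have yk: "?r (u @ bpow (\<kappa> u)) ?y = ?y" using sty by (metis K.stab_def)
    have "run X.cb X.ct (u @ bpow (\<kappa> u)) ?x = ?x" using \<kappa>[OF uVb] stx by (metis X.stab_def)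
    then have "X.cb k (run X.cb X.ct u ?x) = X.cb (\<kappa> u) (run X.cb X.ct u ?x)"
      using xw xw1 xC by simp
    then have "X.cb (k - \<kappa> u) (run X.cb X.ct u ?x) = run X.cb X.ct u ?x"
      using X.beta_beta_eq_iff xC by simp
    then have "X.stab ?x (u @ bpow (k - \<kappa> u) @ winv u)"
      using X.stab_run[OF xC, of u "bpow (k - \<kappa> u)"] xC by (simp add: X.stab_def)
    then have "int (Lf u) dvd k - \<kappa> u" using stx Lf by simp
    then obtain c where c: "k - \<kappa> u = c * int (Lf u)" by (metis dvdE mult.commute)
    have "Q (u @ bpow (int (Lf u)) @ winv u)" using QF u(1) by (simp add: F3_def)
    then have "K.stab (?r u ?y) (bpow (int (Lf u)))" using K.stab_run[OF yC] sty by simp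
    then have "K.cb (int (Lf u)) (?r u ?y) = ?r u ?y" using zC by (simp add: K.stab_def)
    then have "K.cb (k - \<kappa> u) (?r u ?y) = ?r u ?y" unfolding c using K.beta_fixed_mult zC by blast
    then have "K.cb k (?r u ?y) = K.cb (\<kappa> u) (?r u ?y)" using K.beta_beta_eq_iff zC by blast
    then have "?r w ?y = ?y" using u(2) yk yC by simp
    then have "K.stab ?y w" by (simp add: K.stab_def)
    then show "P' w" using sty by (simp add: Q_def)
  qed
  show ?thesis
  proof (intro exI[of _ "F1 \<union> F2 \<union> F3"] conjI fin ballI allI impI)
    fix w assume "w \<in> F1 \<union> F2 \<union> F3"
    then show "P w" by (rule PF)
  next
    fix P' w assume "wsub m n P'" "\<forall>w\<in>F1 \<union> F2 \<union> F3. P' w" "P w"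
    then show "P' w" by (rule gen)
  qed
qed

definition dcoset :: "(word \<Rightarrow> bool) \<Rightarrow> word \<Rightarrow> word set" where
  "dcoset P w = {v. \<exists>k. P (v @ winv (w @ bpow k))}"

lemma dcoset_eqI:
  assumes P: "wsub m n P" and k: "P (w @ winv (u @ bpow k))"
  shows "dcoset P w = dcoset P u"
proof -
  have shift: "coset P (w @ bpow j) = coset P (u @ bpow (k + j))" for j
  proof -
    have "coset P w = coset P (u @ bpow k)" using coset_eq_iff[OF P] k by blast
    then have "coset P (w @ bpow j) = coset P ((u @ bpow k) @ bpow j)" using mv_coset[OF P] by metis
    also have "\<dots> = coset P (u @ bpow (k + j))"
      using coset_bs_eq[OF P bs_eq_append_left[OF bs_eq_bpow_add], of u k j] by simp
    finally show ?thesis .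
  qed
  have d: "dcoset P x = (\<Union>j. coset P (x @ bpow j))" for x by (auto simp: dcoset_def coset_def)
  show ?thesis
  proof
    show "dcoset P w \<subseteq> dcoset P u" unfolding d shift by blast
    have "coset P (u @ bpow j) = coset P (w @ bpow (j - k))" for j unfolding shift by simp
    then show "dcoset P u \<subseteq> dcoset P w" unfolding d by blast
  qed
qed

lemma dcoset_eqD:
  assumes P: "wsub m n P" and "dcoset P w = dcoset P u"
  obtains k where "P (w @ winv (u @ bpow k))"
proof -
  have "w @ winv (w @ bpow 0) = w @ winv w" by simp
  then have "w \<in> dcoset P w" unfolding dcoset_def using wsub_refl[OF P, of w] by (metis mem_Collect_eq)
  then have "w \<in> dcoset P u" using assms(2) by simp
  then show ?thesis using that unfolding dcoset_def by blast
qed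

lemma finite_dcosets:
  assumes P: "wsub m n P" and few: "few_orbits P" shows "finite (range (dcoset P))"
proof -
  obtain U where U: "finite U" "\<forall>w. \<exists>u\<in>U. \<exists>k. P (w @ winv (u @ bpow k))"
    using few unfolding few_orbits_def by (elim exE conjE)
  have "dcoset P w \<in> dcoset P ` U" for w
  proof -
    obtain u k where "u \<in> U" "P (w @ winv (u @ bpow k))" using U(2) by metis
    then show ?thesis using dcoset_eqI[OF P] by (metis imageI)
  qed
  then have "range (dcoset P) \<subseteq> dcoset P ` U" by blast
  then show ?thesis using U(1) finite_subset by blast
qed

lemma finite_cosets:
  assumes m0: "m \<noteq> 0" and n0: "n \<noteq> 0" and P: "wsub m n P" and few: "few_orbits P"
    and k: "k \<noteq> 0" "P (bpow k)"
  shows "finite (range (coset P))"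
proof -
  interpret X: coset_action m n "\<lambda>_. P" using m0 n0 P by unfold_locales
  let ?x = "(0, coset P [])"
  have xC: "?x \<in> X.CC" by (rule X.base_in_CC)
  have stx: "X.stab ?x = P" by (rule X.stab_base)
  have "X.cb k ?x = ?x" using k stx xC X.stab_def[of ?x "bpow k"] by simp
  then have "\<exists>k. k \<noteq> 0 \<and> X.cb k ?x = ?x" using k(1) by blast
  then have orb: "finite (X.orb (run X.cb X.ct u ?x))" for u
    using X.nonzero_period_run[OF xC, of u] X.finite_orb xC X.run_closed by metis
  have "fin_cover X.cb X.ct ?x" using X.few_orbits_stab[OF xC] few stx by simp
  then obtain U where U: "finite U" "\<forall>w. \<exists>u\<in>U. \<exists>k. run X.cb X.ct w ?x = X.cb k (run X.cb X.ct u ?x)"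
    unfolding fin_cover_def by (elim exE conjE)
  have "coset P w \<in> snd ` (\<Union>u\<in>U. X.orb (run X.cb X.ct u ?x))" for w
  proof -
    obtain u k where u: "u \<in> U" "run X.cb X.ct w ?x = X.cb k (run X.cb X.ct u ?x)" using U(2) by metis
    have "run X.cb X.ct w ?x = (0, coset P w)" using X.run_coset[of w 0 "[]"] by simp
    then have "(0, coset P w) \<in> X.orb (run X.cb X.ct u ?x)" using u(2) unfolding X.orb_def by (metis rangeI)
    then show ?thesis using u(1) by force
  qed
  then have "range (coset P) \<subseteq> snd ` (\<Union>u\<in>U. X.orb (run X.cb X.ct u ?x))" by blast
  moreover have "finite (snd ` (\<Union>u\<in>U. X.orb (run X.cb X.ct u ?x)))" using U(1) orb by blast
  ultimately show ?thesis by (rule finite_subset)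
qed

lemma few_orbits_mono:
  assumes "few_orbits P" and "\<And>w. P w \<Longrightarrow> P' w" shows "few_orbits P'"
proof -
  obtain U where "finite U" "\<forall>w. \<exists>u\<in>U. \<exists>k. P (w @ winv (u @ bpow k))"
    using assms(1) unfolding few_orbits_def by (elim exE conjE)
  then have "finite U \<and> (\<forall>w. \<exists>u\<in>U. \<exists>k. P' (w @ winv (u @ bpow k)))" using assms(2) by metis
  then show ?thesis unfolding few_orbits_def by (rule exI)
qed

lemma mv_Nil_coset:
  assumes P1: "wsub m n P1" and P2: "wsub m n P2" and le: "\<And>w. P1 w \<Longrightarrow> P2 w"
  shows "mv P2 [] (coset P1 w) = coset P2 w"
proof -
  have "v \<in> mv P2 [] (coset P1 w) \<longleftrightarrow> v \<in> coset P2 w" for v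
    unfolding mv_def coset_def mem_Collect_eq Bex_def append_Nil2
    using wsub_trans[OF P2] wsub_refl[OF P1] le by metis
  then show ?thesis by blast
qed

lemma mv_Nil_dcoset:
  assumes P1: "wsub m n P1" and P2: "wsub m n P2" and le: "\<And>w. P1 w \<Longrightarrow> P2 w"
  shows "mv P2 [] (dcoset P1 w) = dcoset P2 w"
proof -
  have "v \<in> mv P2 [] (dcoset P1 w) \<longleftrightarrow> v \<in> dcoset P2 w" for v
    unfolding mv_def dcoset_def mem_Collect_eq Bex_def append_Nil2
    using wsub_trans[OF P2] wsub_refl[OF P1] le by metis
  then show ?thesis by blast
qed

text \<open>A subgroup with finitely many \<open>b\<close>-orbits is finitely generated, so the subgroups containing
  it form a neighbourhood. In a dense-in-itself set one may therefore always pass to a strictly larger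
  subgroup, which lowers the index, or the number of \<open>b\<close>-orbits if these are infinite.\<close>
lemma perfect_kernel_many_orbits:
  assumes m0: "m \<noteq> 0" and n0: "n \<noteq> 0" and \<Lambda>: "\<Lambda> \<in> perfect_kernel (Sub_top m n)"
  shows "\<not> few_orbits (wmem m n \<Lambda>)"
proof
  assume few: "few_orbits (wmem m n \<Lambda>)"
  let ?P = "wmem m n"
  obtain S where S: "S \<subseteq> SubG m n" "S \<subseteq> Sub_top m n derived_set_of S" "\<Lambda> \<in> S"
    using \<Lambda> unfolding perfect_kernel_def topspace_Sub_top by blast
  define G where "G = {\<Delta> \<in> S. few_orbits (?P \<Delta>)}"
  have \<Lambda>G: "\<Lambda> \<in> G" using S few by (simp add: G_def)
  have wG: "wsub m n (?P \<Delta>)" if "\<Delta> \<in> G" for \<Delta> using that S(1) wsub_wmem by (auto simp: G_def)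
  have larger: "\<exists>\<Theta>\<in>G. \<Theta> \<noteq> \<Delta> \<and> (\<forall>w. ?P \<Delta> w \<longrightarrow> ?P \<Theta> w)" if \<Delta>: "\<Delta> \<in> G" for \<Delta>
  proof -
    obtain F where F: "finite F" "\<forall>w\<in>F. ?P \<Delta> w"
      "\<And>P'. wsub m n P' \<Longrightarrow> \<forall>w\<in>F. P' w \<Longrightarrow> \<forall>w. ?P \<Delta> w \<longrightarrow> P' w"
      using few_orbits_finitely_generated[OF m0 n0 wG[OF \<Delta>]] \<Delta> unfolding G_def by blast
    define T where "T = {\<Theta> \<in> SubG m n. bs_class m n ` F \<subseteq> \<Theta> \<and> {} \<inter> \<Theta> = {}}"
    have "openin (Sub_top m n) T"
      unfolding Sub_top_def openin_subtopology
    proof (intro exI[of _ T] conjI)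
      show "openin (topology_generated_by
        {{\<Lambda> \<in> SubG m n. I \<subseteq> \<Lambda> \<and> Ex \<inter> \<Lambda> = {}} | I Ex. finite I \<and> finite Ex}) T"
        by (rule topology_generated_by_Basis) (use F(1) in \<open>unfold T_def, blast\<close>)
    qed (auto simp: T_def)
    moreover have "\<Delta> \<in> T" using F(2) \<Delta> S(1) by (auto simp: T_def wmem_def G_def)
    moreover have "\<Delta> \<in> Sub_top m n derived_set_of S" using \<Delta> S(2) by (auto simp: G_def)
    ultimately obtain \<Theta> where \<Theta>: "\<Theta> \<noteq> \<Delta>" "\<Theta> \<in> S" "\<Theta> \<in> T" unfolding in_derived_set_of by blast
    have "\<forall>w\<in>F. ?P \<Theta> w" using \<Theta>(3) by (auto simp: T_def wmem_def)
    then have le: "\<forall>w. ?P \<Delta> w \<longrightarrow> ?P \<Theta> w" using F(3)[of "?P \<Theta>"] wsub_wmem \<Theta>(2) S(1) by blast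
    have "few_orbits (?P \<Theta>)" using \<Delta> le few_orbits_mono unfolding G_def by blast
    then show ?thesis using \<Theta> le by (auto simp: G_def)
  qed
  show False
  proof (cases "\<exists>\<Delta>\<in>G. \<exists>k. k \<noteq> 0 \<and> ?P \<Delta> (bpow k)")
    case True
    then obtain \<Delta>0 where "\<Delta>0 \<in> G \<and> (\<exists>k. k \<noteq> 0 \<and> ?P \<Delta>0 (bpow k))" by blast
    from ex_has_least_nat[where P = "\<lambda>\<Delta>. \<Delta> \<in> G \<and> (\<exists>k. k \<noteq> 0 \<and> ?P \<Delta> (bpow k))" and m = "\<lambda>\<Delta>. card (range (coset (?P \<Delta>)))", OF this]
    obtain \<Delta> where \<Delta>: "\<Delta> \<in> G" "\<exists>k. k \<noteq> 0 \<and> ?P \<Delta> (bpow k)"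
      and min: "\<And>\<Theta>. \<Theta> \<in> G \<Longrightarrow> \<exists>k. k \<noteq> 0 \<and> ?P \<Theta> (bpow k) \<Longrightarrow>
        card (range (coset (?P \<Delta>))) \<le> card (range (coset (?P \<Theta>)))" by blast
    obtain \<Theta> where \<Theta>: "\<Theta> \<in> G" "\<Theta> \<noteq> \<Delta>" "\<forall>w. ?P \<Delta> w \<longrightarrow> ?P \<Theta> w" using larger[OF \<Delta>(1)] by blast
    have fin: "finite (range (coset (?P \<Delta>)))"
      using finite_cosets[OF m0 n0 wG[OF \<Delta>(1)]] \<Delta> by (auto simp: G_def)
    have img: "range (coset (?P \<Theta>)) = mv (?P \<Theta>) [] ` range (coset (?P \<Delta>))"
      using mv_Nil_coset[OF wG[OF \<Delta>(1)] wG[OF \<Theta>(1)]] \<Theta>(3) by (simp add: image_image)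
    have "card (range (coset (?P \<Delta>))) \<le> card (range (coset (?P \<Theta>)))" using min \<Theta> \<Delta>(2) by blast
    then have "inj_on (mv (?P \<Theta>) []) (range (coset (?P \<Delta>)))"
      unfolding img using fin by (meson card_image_le eq_card_imp_inj_on le_antisym)
    moreover have "mv (?P \<Theta>) [] (coset (?P \<Delta>) w) = coset (?P \<Theta>) w" for w
      using mv_Nil_coset[OF wG[OF \<Delta>(1)] wG[OF \<Theta>(1)]] \<Theta>(3) by blast
    ultimately have inj: "coset (?P \<Theta>) w = coset (?P \<Theta>) [] \<Longrightarrow> coset (?P \<Delta>) w = coset (?P \<Delta>) []" for w
      by (metis inj_onD rangeI)
    have "?P \<Theta> w \<Longrightarrow> ?P \<Delta> w" for w
      using inj[of w] coset_eq_iff[OF wG[OF \<Delta>(1)], of w "[]"] coset_eq_iff[OF wG[OF \<Theta>(1)], of w "[]"] by simp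
    then have "\<Theta> = \<Delta>" using \<Theta> \<Delta> S(1) by (intro SubG_eqI[of _ m n]) (auto simp: G_def)
    then show False using \<Theta>(2) by contradiction
  next
    case False
    from ex_has_least_nat[where P = "\<lambda>\<Delta>. \<Delta> \<in> G" and m = "\<lambda>\<Delta>. card (range (dcoset (?P \<Delta>)))", OF \<Lambda>G]
    obtain \<Delta> where \<Delta>: "\<Delta> \<in> G"
      and min: "\<And>\<Theta>. \<Theta> \<in> G \<Longrightarrow> card (range (dcoset (?P \<Delta>))) \<le> card (range (dcoset (?P \<Theta>)))" by blast
    obtain \<Theta> where \<Theta>: "\<Theta> \<in> G" "\<Theta> \<noteq> \<Delta>" "\<forall>w. ?P \<Delta> w \<longrightarrow> ?P \<Theta> w" using larger[OF \<Delta>] by blast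
    note w\<Delta> = wG[OF \<Delta>] and w\<Theta> = wG[OF \<Theta>(1)]
    have fin: "finite (range (dcoset (?P \<Delta>)))" using finite_dcosets[OF w\<Delta>] \<Delta> by (auto simp: G_def)
    have mvd: "mv (?P \<Theta>) [] (dcoset (?P \<Delta>) w) = dcoset (?P \<Theta>) w" for w
      using mv_Nil_dcoset[OF w\<Delta> w\<Theta>] \<Theta>(3) by blast
    then have img: "range (dcoset (?P \<Theta>)) = mv (?P \<Theta>) [] ` range (dcoset (?P \<Delta>))"
      by (simp add: image_image)
    have "inj_on (mv (?P \<Theta>) []) (range (dcoset (?P \<Delta>)))"
      using min[OF \<Theta>(1)] unfolding img using fin by (meson card_image_le eq_card_imp_inj_on le_antisym)
    then have inj: "dcoset (?P \<Theta>) w = dcoset (?P \<Theta>) [] \<Longrightarrow> dcoset (?P \<Delta>) w = dcoset (?P \<Delta>) []" for w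
      using mvd by (metis inj_onD rangeI)
    have "?P \<Delta> w" if w: "?P \<Theta> w" for w
    proof -
      have "?P \<Theta> (w @ winv ([] @ bpow 0))" using w by simp
      then have "dcoset (?P \<Delta>) w = dcoset (?P \<Delta>) []" using inj dcoset_eqI[OF w\<Theta>] by blast
      then obtain k where k: "?P \<Delta> (w @ winv ([] @ bpow k))" using dcoset_eqD[OF w\<Delta>] by blast
      then have "?P \<Theta> (w @ winv (bpow k))" using \<Theta>(3) by simp
      then have "?P \<Theta> (bpow k @ winv w)" by (rule wsub_sym[OF w\<Theta>])
      moreover have "?P \<Theta> (w @ winv [])" using w by simp
      ultimately have "?P \<Theta> (bpow k @ winv [])" by (rule wsub_trans[OF w\<Theta>])
      then have "k = 0" using False \<Theta>(1) by auto
      then show ?thesis using k by simp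
    qed
    then have "\<Theta> = \<Delta>" using \<Theta> \<Delta> S(1) by (intro SubG_eqI[of _ m n]) (auto simp: G_def)
    then show False using \<Theta>(2) by contradiction
  qed
qed

theorem theoremC:
  fixes m n :: int and q :: enat
  assumes "\<bar>m\<bar> \<ge> 2" and "\<bar>n\<bar> \<ge> 2"
    and "q \<in> phenotypes m n"
  shows "\<forall>(d::nat) (U :: nat \<Rightarrow> word set set set) (V :: nat \<Rightarrow> word set set set).
     d \<ge> 1
     \<and> (\<forall>i\<in>{1..d}. openin (subtopology (Sub_top m n) (Kq m n q)) (U i) \<and> U i \<noteq> {})
     \<and> (\<forall>i\<in>{1..d}. openin (subtopology (Sub_top m n) (Kq m n q)) (V i) \<and> V i \<noteq> {})
     \<and> (\<forall>i\<in>{1..d}. \<forall>j\<in>{1..d}. i \<noteq> j \<longrightarrow> U i \<inter> U j = {})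
     \<and> (\<forall>i\<in>{1..d}. \<forall>j\<in>{1..d}. i \<noteq> j \<longrightarrow> V i \<inter> V j = {})
     \<longrightarrow> (\<exists>\<gamma> \<in> carrier (BS m n).
            \<forall>i\<in>{1..d}. (\<lambda>\<Lambda>. conj_act m n \<Lambda> \<gamma>) ` (U i) \<inter> V i \<noteq> {})"
proof (intro allI impI, elim conjE)
  fix d :: nat and U V :: "nat \<Rightarrow> word set set set"
  assume U: "\<forall>i\<in>{1..d}. openin (subtopology (Sub_top m n) (Kq m n q)) (U i) \<and> U i \<noteq> {}"
    and V: "\<forall>i\<in>{1..d}. openin (subtopology (Sub_top m n) (Kq m n q)) (V i) \<and> V i \<noteq> {}"
  have mn: "m \<noteq> 0" "n \<noteq> 0" using assms by auto
  have KS: "Kq m n q = Sq m n q"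
  proof
    have "perfect_kernel (Sub_top m n) \<subseteq> SubG m n"
      unfolding perfect_kernel_def topspace_Sub_top by blast
    then show "Kq m n q \<subseteq> Sq m n q"
      using perfect_kernel_many_orbits[OF mn] by (auto simp: Kq_def Sq_def)
    have "Sq m n q \<subseteq> topspace (Sub_top m n)" by (auto simp: topspace_Sub_top Sq_def)
    then have "Sq m n q \<subseteq> perfect_kernel (Sub_top m n)"
      using Sq_dense_in_itself[OF assms(1,2), of q] unfolding perfect_kernel_def by blast
    then show "Sq m n q \<subseteq> Kq m n q" by (auto simp: Kq_def Sq_def)
  qed
  have nb: "\<exists>\<Lambda> R. \<Lambda> \<in> Sq m n q \<and> (\<forall>R'\<ge>R. \<forall>\<Delta>\<in>Sq m n q. agree m n R' \<Delta> \<Lambda> \<longrightarrow> \<Delta> \<in> W)"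
    if W: "openin (subtopology (Sub_top m n) (Kq m n q)) W" "W \<noteq> {}" for W
  proof -
    obtain T where T: "openin (Sub_top m n) T" "W = T \<inter> Sq m n q"
      using W(1) unfolding openin_subtopology KS by blast
    obtain \<Lambda> where \<Lambda>: "\<Lambda> \<in> W" using W(2) by blast
    then have "\<Lambda> \<in> T" using T(2) by blast
    then obtain R where R: "\<forall>\<Lambda>'\<in>SubG m n. agree m n R \<Lambda>' \<Lambda> \<longrightarrow> \<Lambda>' \<in> T" using Sub_top_nbhd[OF T(1)] by blast
    have "\<Delta> \<in> W" if "R' \<ge> R" "\<Delta> \<in> Sq m n q" "agree m n R' \<Delta> \<Lambda>" for R' \<Delta>
    proof -
      have "agree m n R \<Delta> \<Lambda>" using that(1,3) by (auto simp: agree_def)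
      then show ?thesis using R that(2) T(2) by (auto simp: Sq_def)
    qed
    then show ?thesis using \<Lambda> T(2) by blast
  qed
  have "\<forall>i\<in>{1..d}. \<exists>\<Lambda> R. \<Lambda> \<in> Sq m n q \<and> (\<forall>R'\<ge>R. \<forall>\<Delta>\<in>Sq m n q. agree m n R' \<Delta> \<Lambda> \<longrightarrow> \<Delta> \<in> U i)"
    using U nb by metis
  then obtain \<Lambda> R where UR: "\<forall>i\<in>{1..d}. \<Lambda> i \<in> Sq m n q \<and>
      (\<forall>R'\<ge>R i. \<forall>\<Delta>\<in>Sq m n q. agree m n R' \<Delta> (\<Lambda> i) \<longrightarrow> \<Delta> \<in> U i)" by metis
  have "\<forall>i\<in>{1..d}. \<exists>\<Lambda> R. \<Lambda> \<in> Sq m n q \<and> (\<forall>R'\<ge>R. \<forall>\<Delta>\<in>Sq m n q. agree m n R' \<Delta> \<Lambda> \<longrightarrow> \<Delta> \<in> V i)"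
    using V nb by metis
  then obtain \<Lambda>' R' where VR: "\<forall>i\<in>{1..d}. \<Lambda>' i \<in> Sq m n q \<and>
      (\<forall>r\<ge>R' i. \<forall>\<Delta>\<in>Sq m n q. agree m n r \<Delta> (\<Lambda>' i) \<longrightarrow> \<Delta> \<in> V i)" by metis
  define Q where "Q = (\<Sum>i=1..d. R i + R' i)"
  have Q: "R i \<le> Q" "R' i \<le> Q" if "i \<in> {1..d}" for i
    using member_le_sum[of i "{1..d}" "\<lambda>i. R i + R' i"] that by (auto simp: Q_def)
  have "\<exists>\<gamma>. \<forall>i\<in>{1..d}. \<exists>\<Delta>\<in>Sq m n q. agree m n Q \<Delta> (\<Lambda> i) \<and>
     conj_act m n \<Delta> (bs_class m n \<gamma>) \<in> Sq m n q \<and> agree m n Q (conj_act m n \<Delta> (bs_class m n \<gamma>)) (\<Lambda>' i)"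
    by (rule Sq_linking[OF assms(1,2)]) (use UR VR in auto)
  then obtain \<gamma> where \<gamma>: "\<forall>i\<in>{1..d}. \<exists>\<Delta>\<in>Sq m n q. agree m n Q \<Delta> (\<Lambda> i) \<and>
     conj_act m n \<Delta> (bs_class m n \<gamma>) \<in> Sq m n q \<and> agree m n Q (conj_act m n \<Delta> (bs_class m n \<gamma>)) (\<Lambda>' i)"
    by blast
  show "\<exists>\<gamma> \<in> carrier (BS m n). \<forall>i\<in>{1..d}. (\<lambda>\<Lambda>. conj_act m n \<Lambda> \<gamma>) ` (U i) \<inter> V i \<noteq> {}"
  proof (intro bexI[of _ "bs_class m n \<gamma>"] ballI)
    fix i assume i: "i \<in> {1..d}"
    from bspec[OF \<gamma> i] obtain \<Delta> where \<Delta>: "\<Delta> \<in> Sq m n q" "agree m n Q \<Delta> (\<Lambda> i)"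
      "conj_act m n \<Delta> (bs_class m n \<gamma>) \<in> Sq m n q" "agree m n Q (conj_act m n \<Delta> (bs_class m n \<gamma>)) (\<Lambda>' i)"
      by blast
    have "\<Delta> \<in> U i" using UR i Q(1)[OF i] \<Delta>(1,2) by blast
    moreover have "conj_act m n \<Delta> (bs_class m n \<gamma>) \<in> V i" using VR i Q(2)[OF i] \<Delta>(3,4) by blast
    ultimately show "(\<lambda>\<Lambda>. conj_act m n \<Lambda> (bs_class m n \<gamma>)) ` (U i) \<inter> V i \<noteq> {}" by blast
  qed (simp add: BS_carrier)
qed

end
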